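(* Let $\mathbb{A}$ be a liberal finitely bounded homogeneous binary core and let $\mathbb{B}$ be a first-order expansion of $\mathbb{A}$ with bounded strict width. Then $\mathbb{B}$ has relational width $(2, \mathrm{MaxBound}_{\mathbb{A}})$.
   Context: All structures have a countably infinite domain $A$ and a finite relational signature. A structure $\mathbb{A}$ is homogeneous if every isomorphism between finite substructures of $\mathbb{A}$ extends to an automorphism of $\mathbb{A}$. It is finitely bounded if there is a (fixed) finite set $\mathcal{F}_{\mathbb{A}}$ of finite structures of its signature such that a finite structure $\Delta$ embeds into $\mathbb{A}$ if and only if no member of $\mathcal{F}_{\mathbb{A}}$ embeds into $\Delta$. $\mathbb{A}$ is a binary core if its signature consists of equality $=$ and binary relation symbols $R_1,\dots,R_\kappa$, each interpreted as an anti-reflexive relation (contained in $\neq$), such that for any two distinct $a,b\in A$ there is exactly one $i\in[\kappa]$ with $(a,b)\in R_i$. $\mathbb{A}$ is liberal if $\mathcal{F}_{\mathbb{A}}$ contains no structure with $3$, $4$, $5$ or $6$ elements. $\mathrm{MaxBound}_{\mathbb{A}}$ is the maximum of $3$ and the size of the largest structure in $\mathcal{F}_{\mathbb{A}}$. A first-order expansion $\mathbb{B}$ of $\mathbb{A}$ is an expansion of $\mathbb{A}$ (same domain) by relations each first-order definable in $\mathbb{A}$. CSP: a constraint is a pair $((x_1,\dots,x_k),R)$ with variables $x_i$ and a $k$-ary relation $R$; its projection to a subtuple $(x_{i_1},\dots,x_{i_m})$ of its scope is $((x_{i_1},\dots,x_{i_m}),\{(t[i_1],\dots,t[i_m]):t\in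 R\})$. An instance of $\mathrm{CSP}(\mathbb{B})$ over a finite variable set $V$ is a finite set of constraints whose relations are relations of $\mathbb{B}$; a solution is a map $V\to A$ satisfying all constraints; for $W\subseteq V$, a partial solution is a map $W\to A$ satisfying the projections of all constraints to the variables of their scopes lying in $W$. An instance is non-trivial if no constraint has the empty relation. For $k\le l$, an instance is $(k,l)$-minimal if (i) every set of at most $l$ variables is contained in the scope of some constraint and (ii) for every set $X$ of at most $k$ variables, any two constraints whose scopes contain $X$ have the same projection to $X$. $\mathbb{B}$ has relational width $(k,l)$ if every $(k,l)$-minimal instance of $\mathrm{CSP}(\mathbb{B})$ has a solution if and only if it is non-trivial. $\mathbb{B}$ has strict width $k$ if there is $l$ such that every partial solution of every $(k,l)$-minimal instance of $\mathrm{CSP}(\mathbb{B})$ extends to a solution; it has bounded strict width if it has strict width $k$ for some $k$. Standing convention: when $(k,l)$-minimal instances are considered, $\mathbb{B}$ is assumed to contain all relations of arity at most $l$ that are primitive-positively definable in $\mathbb{B}$. *)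

theory Defs
  imports "HOL-Library.Countable_Set"
begin

section \<open>Relational structures\<close>

text \<open>A signature is a partial map from symbols to arities. Tuples are lists. Equality is treated as a
  logical symbol: it is not listed in \<open>sig\<close>, it is interpreted as the identity in every structure,
  it may be used in formulas, and it is a relation of every structure (see \<open>relations\<close> below).\<close>

record ('s, 'a) rstruct =
  univ :: "'a set"
  sig :: "'s \<rightharpoonup> nat"
  interp :: "'s \<Rightarrow> 'a list set"

definition wf_rstruct :: "('s, 'a) rstruct \<Rightarrow> bool" where
  "wf_rstruct S \<longleftrightarrow> finite (dom (sig S)) \<and>
     (\<forall>s n. sig S s = Some n \<longrightarrow> interp S s \<subseteq> {xs. length xs = n \<and> set xs \<subseteq> univ S})"

definition embedding :: "('a \<Rightarrow> 'b) \<Rightarrow> ('s, 'a) rstruct \<Rightarrow> ('s, 'b) rstruct \<Rightarrow> bool" where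
  "embedding f S T \<longleftrightarrow> sig S = sig T \<and> inj_on f (univ S) \<and> f ` univ S \<subseteq> univ T \<and>
     (\<forall>s n xs. sig S s = Some n \<and> length xs = n \<and> set xs \<subseteq> univ S \<longrightarrow>
        (xs \<in> interp S s \<longleftrightarrow> map f xs \<in> interp T s))"

definition embeds :: "('s, 'a) rstruct \<Rightarrow> ('s, 'b) rstruct \<Rightarrow> bool" where
  "embeds S T \<longleftrightarrow> (\<exists>f. embedding f S T)"

definition isomorphism :: "('a \<Rightarrow> 'b) \<Rightarrow> ('s, 'a) rstruct \<Rightarrow> ('s, 'b) rstruct \<Rightarrow> bool" where
  "isomorphism f S T \<longleftrightarrow> embedding f S T \<and> f ` univ S = univ T"

definition automorphism :: "('a \<Rightarrow> 'a) \<Rightarrow> ('s, 'a) rstruct \<Rightarrow> bool" where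
  "automorphism f S \<longleftrightarrow> isomorphism f S S"

definition substructure :: "('s, 'a) rstruct \<Rightarrow> 'a set \<Rightarrow> ('s, 'a) rstruct" where
  "substructure S X =
     \<lparr>univ = X, sig = sig S, interp = (\<lambda>s. {xs \<in> interp S s. set xs \<subseteq> X})\<rparr>"

definition homogeneous :: "('s, 'a) rstruct \<Rightarrow> bool" where
  "homogeneous S \<longleftrightarrow>
     (\<forall>X Y f. finite X \<and> X \<subseteq> univ S \<and> finite Y \<and> Y \<subseteq> univ S \<and>
        isomorphism f (substructure S X) (substructure S Y) \<longrightarrow>
        (\<exists>g. automorphism g S \<and> (\<forall>x\<in>X. g x = f x)))"

text \<open>Finite structures are taken with elements in \<^typ>\<open>nat\<close>, which is no restriction up to isomorphism.\<close>

definition finite_rstruct :: "('s \<rightharpoonup> nat) \<Rightarrow> ('s, nat) rstruct \<Rightarrow> bool" where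
  "finite_rstruct \<sigma> D \<longleftrightarrow> wf_rstruct D \<and> sig D = \<sigma> \<and> finite (univ D)"

definition finitely_bounded_by :: "('s, 'a) rstruct \<Rightarrow> ('s, nat) rstruct set \<Rightarrow> bool" where
  "finitely_bounded_by S F \<longleftrightarrow> finite F \<and> (\<forall>E\<in>F. finite_rstruct (sig S) E) \<and>
     (\<forall>D. finite_rstruct (sig S) D \<longrightarrow> (embeds D S \<longleftrightarrow> \<not> (\<exists>E\<in>F. embeds E D)))"

definition liberal :: "('s, nat) rstruct set \<Rightarrow> bool" where
  "liberal F \<longleftrightarrow> (\<forall>E\<in>F. card (univ E) \<notin> {3, 4, 5, 6})"

definition MaxBound :: "('s, nat) rstruct set \<Rightarrow> nat" where
  "MaxBound F = Max (insert 3 ((\<lambda>E. card (univ E)) ` F))"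

definition binary_core :: "('s, 'a) rstruct \<Rightarrow> bool" where
  "binary_core S \<longleftrightarrow>
     (\<forall>s \<in> dom (sig S). sig S s = Some 2 \<and> (\<forall>a. [a, a] \<notin> interp S s)) \<and>
     (\<forall>a \<in> univ S. \<forall>b \<in> univ S. a \<noteq> b \<longrightarrow> (\<exists>!s. s \<in> dom (sig S) \<and> [a, b] \<in> interp S s))"


section \<open>First-order and primitive positive definability\<close>

datatype 's fm =
    Equal nat nat
  | Atom 's "nat list"
  | Neg "'s fm"
  | Conj "'s fm" "'s fm"
  | Exi nat "'s fm"

primrec wf_fm :: "('s \<rightharpoonup> nat) \<Rightarrow> 's fm \<Rightarrow> bool" where
  "wf_fm \<sigma> (Equal i j) \<longleftrightarrow> True"
| "wf_fm \<sigma> (Atom s is) \<longleftrightarrow> \<sigma> s = Some (length is)"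
| "wf_fm \<sigma> (Neg \<phi>) \<longleftrightarrow> wf_fm \<sigma> \<phi>"
| "wf_fm \<sigma> (Conj \<phi> \<psi>) \<longleftrightarrow> wf_fm \<sigma> \<phi> \<and> wf_fm \<sigma> \<psi>"
| "wf_fm \<sigma> (Exi i \<phi>) \<longleftrightarrow> wf_fm \<sigma> \<phi>"

primrec fv :: "'s fm \<Rightarrow> nat set" where
  "fv (Equal i j) = {i, j}"
| "fv (Atom s is) = set is"
| "fv (Neg \<phi>) = fv \<phi>"
| "fv (Conj \<phi> \<psi>) = fv \<phi> \<union> fv \<psi>"
| "fv (Exi i \<phi>) = fv \<phi> - {i}"

primrec sat :: "('s, 'a) rstruct \<Rightarrow> (nat \<Rightarrow> 'a) \<Rightarrow> 's fm \<Rightarrow> bool" where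
  "sat S v (Equal i j) \<longleftrightarrow> v i = v j"
| "sat S v (Atom s is) \<longleftrightarrow> map v is \<in> interp S s"
| "sat S v (Neg \<phi>) \<longleftrightarrow> \<not> sat S v \<phi>"
| "sat S v (Conj \<phi> \<psi>) \<longleftrightarrow> sat S v \<phi> \<and> sat S v \<psi>"
| "sat S v (Exi i \<phi>) \<longleftrightarrow> (\<exists>a \<in> univ S. sat S (v(i := a)) \<phi>)"

primrec primitive_positive :: "'s fm \<Rightarrow> bool" where
  "primitive_positive (Equal i j) \<longleftrightarrow> True"
| "primitive_positive (Atom s is) \<longleftrightarrow> True"
| "primitive_positive (Neg \<phi>) \<longleftrightarrow> False"
| "primitive_positive (Conj \<phi> \<psi>) \<longleftrightarrow> primitive_positive \<phi> \<and> primitive_positive \<psi>"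
| "primitive_positive (Exi i \<phi>) \<longleftrightarrow> primitive_positive \<phi>"

definition defined_by :: "('s, 'a) rstruct \<Rightarrow> 's fm \<Rightarrow> nat \<Rightarrow> 'a list set \<Rightarrow> bool" where
  "defined_by S \<phi> n R \<longleftrightarrow> wf_fm (sig S) \<phi> \<and> fv \<phi> \<subseteq> {..<n} \<and>
     R = {xs. length xs = n \<and> set xs \<subseteq> univ S \<and> sat S (\<lambda>i. xs ! i) \<phi>}"

definition fo_definable :: "('s, 'a) rstruct \<Rightarrow> nat \<Rightarrow> 'a list set \<Rightarrow> bool" where
  "fo_definable S n R \<longleftrightarrow> (\<exists>\<phi>. defined_by S \<phi> n R)"

definition pp_definable :: "('s, 'a) rstruct \<Rightarrow> nat \<Rightarrow> 'a list set \<Rightarrow> bool" where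
  "pp_definable S n R \<longleftrightarrow> (\<exists>\<phi>. primitive_positive \<phi> \<and> defined_by S \<phi> n R)"

definition fo_expansion :: "('s, 'a) rstruct \<Rightarrow> ('s, 'a) rstruct \<Rightarrow> bool" where
  "fo_expansion A B \<longleftrightarrow> wf_rstruct B \<and> univ B = univ A \<and> sig A \<subseteq>\<^sub>m sig B \<and>
     (\<forall>s \<in> dom (sig A). interp B s = interp A s) \<and>
     (\<forall>s n. sig B s = Some n \<longrightarrow> fo_definable A n (interp B s))"


section \<open>Constraint satisfaction, minimality and width\<close>

text \<open>The relations of a structure, each paired with its arity (which the empty relation does not
  determine).\<close>

definition relations :: "('s, 'a) rstruct \<Rightarrow> (nat \<times> 'a list set) set" where
  "relations B = {(2, {[a, a] | a. a \<in> univ B})} \<union> {(n, interp B s) | s n. sig B s = Some n}"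

text \<open>When \<open>(k, l)\<close>-minimal instances are considered, \<open>B\<close> is assumed to contain all relations of arity
  at most \<open>l\<close> that are primitive-positively definable in \<open>B\<close>. This is implemented by adding these
  relations to those of \<open>B\<close>.\<close>

definition relations_upto :: "('s, 'a) rstruct \<Rightarrow> nat \<Rightarrow> (nat \<times> 'a list set) set" where
  "relations_upto B l = relations B \<union> {(n, R) | n R. n \<le> l \<and> pp_definable B n R}"

type_synonym 'a constraint = "nat list \<times> 'a list set"

text \<open>An instance is given by its variable set and its constraints; variables are natural numbers,
  which is no restriction since variable sets are finite. The variables in a scope are pairwise
  distinct: otherwise \<open>((x, x), \<noteq>)\<close> alone would be a non-trivial minimal instance without a solution.\<close>

definition csp_instance ::
    "(nat \<times> 'a list set) set \<Rightarrow> nat set \<Rightarrow> 'a constraint set \<Rightarrow> bool" where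
  "csp_instance \<Gamma> V C \<longleftrightarrow> finite V \<and> finite C \<and>
     (\<forall>(xs, R) \<in> C. set xs \<subseteq> V \<and> distinct xs \<and> (length xs, R) \<in> \<Gamma>)"

definition satisfies :: "(nat \<Rightarrow> 'a) \<Rightarrow> 'a constraint \<Rightarrow> bool" where
  "satisfies h c \<longleftrightarrow> map h (fst c) \<in> snd c"

text \<open>For \<open>t \<in> R\<close>, the map \<open>map_of (zip xs t)\<close> sends the variable \<open>xs ! i\<close> to the entry \<open>t ! i\<close>.\<close>

definition projection :: "'a constraint \<Rightarrow> nat list \<Rightarrow> 'a constraint" where
  "projection c ys = (ys, {map (\<lambda>y. the (map_of (zip (fst c) t) y)) ys | t. t \<in> snd c})"

definition partial_solution ::
    "('s, 'a) rstruct \<Rightarrow> 'a constraint set \<Rightarrow> nat set \<Rightarrow> (nat \<Rightarrow> 'a) \<Rightarrow> bool" where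
  "partial_solution B C W h \<longleftrightarrow> h ` W \<subseteq> univ B \<and>
     (\<forall>c \<in> C. satisfies h (projection c (filter (\<lambda>x. x \<in> W) (fst c))))"

definition solution ::
    "('s, 'a) rstruct \<Rightarrow> nat set \<Rightarrow> 'a constraint set \<Rightarrow> (nat \<Rightarrow> 'a) \<Rightarrow> bool" where
  "solution B V C h \<longleftrightarrow> h ` V \<subseteq> univ B \<and> (\<forall>c \<in> C. satisfies h c)"

definition nontrivial :: "'a constraint set \<Rightarrow> bool" where
  "nontrivial C \<longleftrightarrow> (\<forall>c \<in> C. snd c \<noteq> {})"

definition minimal :: "nat \<Rightarrow> nat \<Rightarrow> nat set \<Rightarrow> 'a constraint set \<Rightarrow> bool" where
  "minimal k l V C \<longleftrightarrow>
     (\<forall>X. X \<subseteq> V \<and> card X \<le> l \<longrightarrow> (\<exists>c \<in> C. X \<subseteq> set (fst c))) \<and>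
     (\<forall>X. X \<subseteq> V \<and> card X \<le> k \<longrightarrow>
        (\<forall>c \<in> C. \<forall>d \<in> C. X \<subseteq> set (fst c) \<and> X \<subseteq> set (fst d) \<longrightarrow>
           (\<forall>ys. distinct ys \<and> set ys = X \<longrightarrow> projection c ys = projection d ys)))"

definition relational_width :: "('s, 'a) rstruct \<Rightarrow> nat \<Rightarrow> nat \<Rightarrow> bool" where
  "relational_width B k l \<longleftrightarrow> k \<le> l \<and>
     (\<forall>V C. csp_instance (relations_upto B l) V C \<and> minimal k l V C \<longrightarrow>
        ((\<exists>h. solution B V C h) \<longleftrightarrow> nontrivial C))"

definition strict_width :: "('s, 'a) rstruct \<Rightarrow> nat \<Rightarrow> bool" where
  "strict_width B k \<longleftrightarrow>
     (\<exists>l\<ge>k. \<forall>V C. csp_instance (relations_upto B l) V C \<and> minimal k l V C \<longrightarrow>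
        (\<forall>W h. W \<subseteq> V \<and> partial_solution B C W h \<longrightarrow>
           (\<exists>g. solution B V C g \<and> (\<forall>x\<in>W. g x = h x))))"

definition bounded_strict_width :: "('s, 'a) rstruct \<Rightarrow> bool" where
  "bounded_strict_width B \<longleftrightarrow> (\<exists>k. strict_width B k)"

end

theory Submission
  imports Defs
begin

text \<open>
  Since \<open>A\<close> is homogeneous with binary relations, a relation definable in \<open>A\<close> is determined by the types of
  pairs in its tuples, and liberality allows to extend any set of at most five elements by a new element of
  arbitrarily prescribed types. Given a \<open>(2, MaxBound)\<close>-minimal instance, it suffices to shrink the set of
  types allowed on each pair of variables to a singleton while keeping all binary projections equal to
  these sets: the resulting labelling is realized on every set of at most \<open>MaxBound\<close> variables, hence in \<open>A\<close>,
  and constraints depend on types only.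

  If a family of type sets cannot be shrunk further, then every restriction of a pair \<open>(x, y)\<close> to a
  proper subset of its types restricts another pair, and following these implications one reaches a cycle.
  Composing it gives a quaternary relation \<open>Q\<close> with \<open>C(x, y) \<longrightarrow> C(u, v)\<close> for a proper subset \<open>C\<close> of the types, and
  by freely gluing copies of \<open>Q\<close> a ternary relation \<open>T\<close> with \<open>C(x, y) \<longrightarrow> C(x, z)\<close> that contains all triples
  where both pairs have type \<open>o1\<close> or both have type \<open>o2\<close>, with \<open>o1 \<in> C\<close> and \<open>o2 \<notin> C\<close>. Chaining \<open>T\<close> over
  arbitrarily many first variables, which are assigned the same value, contradicts strict width.
  Equalities are dealt with first, by showing that a type of distinct elements on one pair never
  forces equality on another.
\<close>

section \<open>Formulas and projections\<close>

text \<open>Where the sizes 3 to 6 come from: gluing two quaternary tuples along a common pair gives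
  six points, and the last one is added over five. Points can be added freely when no bound has
  between 3 and 6 elements; smaller bounds do no harm, because all types of pairs are taken from
  \<open>A\<close>.

  The obstacle is overlap. Consecutive pairs on a cycle of implications may share a variable, in any
  position, whereas the relation refuted by strict width shares exactly the first one. So every
  implication records the overlap (\<open>pattern\<close>) of its witnesses. Iterating a cycle makes
  the record idempotent: either nothing is shared or one position is kept, and from both a relation
  from \<open>(x, y)\<close> to \<open>(x, z)\<close> can be produced. The contradiction also needs
  loops at \<open>o1\<close> and at \<open>o2\<close> in one and the same relation; they are found
  in a set of such relations that is closed under composition.

  Equalities go first because free gluing prescribes only types of distinct elements, and because
  overlaps are well defined only once it is settled which variables are equal.\<close>

primrec rename_fm :: "(nat \<Rightarrow> nat) \<Rightarrow> 's fm \<Rightarrow> 's fm" where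
  "rename_fm p (Equal i j) = Equal (p i) (p j)"
| "rename_fm p (Atom s is) = Atom s (map p is)"
| "rename_fm p (Neg \<phi>) = Neg (rename_fm p \<phi>)"
| "rename_fm p (Conj \<phi> \<psi>) = Conj (rename_fm p \<phi>) (rename_fm p \<psi>)"
| "rename_fm p (Exi i \<phi>) = Exi (p i) (rename_fm p \<phi>)"

text \<open>Bound variables are renamed along with the free ones, so injectivity of \<open>p\<close>
  is what rules out capture.\<close>

lemma sat_rename_fm: "inj p \<Longrightarrow> sat S v (rename_fm p \<phi>) \<longleftrightarrow> sat S (v \<circ> p) \<phi>"
proof (induction \<phi> arbitrary: v)
  case (Exi i \<phi>)
  have "(v(p i := a)) \<circ> p = (v \<circ> p)(i := a)" for a
    using Exi.prems by (auto simp: fun_eq_iff inj_eq)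
  then show ?case using Exi.IH[OF Exi.prems] by (simp del: fun_upd_apply o_apply add: comp_assoc)
qed (auto simp: comp_def)

lemma fv_rename_fm: "inj p \<Longrightarrow> fv (rename_fm p \<phi>) = p ` fv \<phi>"
  by (induction \<phi>) (auto simp: inj_eq)

lemma wf_rename_fm [simp]: "wf_fm \<sigma> (rename_fm p \<phi>) \<longleftrightarrow> wf_fm \<sigma> \<phi>"
  by (induction \<phi>) auto

lemma pp_rename_fm [simp]: "primitive_positive (rename_fm p \<phi>) \<longleftrightarrow> primitive_positive \<phi>"
  by (induction \<phi>) auto

lemma finite_fv [simp]: "finite (fv \<phi>)"
  by (induction \<phi>) auto

lemma sat_cong: "(\<And>i. i \<in> fv \<phi> \<Longrightarrow> v i = w i) \<Longrightarrow> sat S v \<phi> \<longleftrightarrow> sat S w \<phi>"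
proof (induction \<phi> arbitrary: v w)
  case (Atom s ks)
  then have "map v ks = map w ks" by simp
  then show ?case by (simp del: map_eq_conv)
next
  case (Exi i \<phi>)
  have "sat S (v(i := a)) \<phi> \<longleftrightarrow> sat S (w(i := a)) \<phi>" for a
    by (rule Exi.IH) (use Exi.prems in auto)
  then show ?case by simp
next
  case (Neg \<phi>)
  then show ?case by (metis fv.simps(3) sat.simps(3))
next
  case (Conj \<phi> \<psi>)
  then show ?case by (metis UnCI fv.simps(4) sat.simps(4))
qed simp

abbreviation exi_list :: "nat list \<Rightarrow> 's fm \<Rightarrow> 's fm" where
  "exi_list is \<phi> \<equiv> foldr Exi is \<phi>"

lemma exi_list_simps:
  "primitive_positive (exi_list is \<phi>) \<longleftrightarrow> primitive_positive \<phi>"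
  "wf_fm \<sigma> (exi_list is \<phi>) \<longleftrightarrow> wf_fm \<sigma> \<phi>"
  "fv (exi_list is \<phi>) = fv \<phi> - set is"
  by (induction "is") auto

lemma sat_exi_list:
  "sat S v (exi_list is \<phi>) \<longleftrightarrow>
     (\<exists>g. (\<forall>i\<in>set is. g i \<in> univ S) \<and> (\<forall>i. i \<notin> set is \<longrightarrow> g i = v i) \<and> sat S g \<phi>)"
proof (induction "is" arbitrary: v)
  case Nil
  show ?case by (simp add: fun_eq_iff[symmetric] del: fun_eq_iff)
next
  case (Cons i "is")
  show ?case (is "?L \<longleftrightarrow> ?R")
  proof
    assume ?L
    then obtain a where a: "a \<in> univ S" "sat S (v(i := a)) (exi_list is \<phi>)" by auto
    then obtain g where g: "\<forall>j\<in>set is. g j \<in> univ S"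
      "\<forall>j. j \<notin> set is \<longrightarrow> g j = (v(i := a)) j" "sat S g \<phi>"
      unfolding Cons by (elim exE conjE)
    have "g j = v j" if "j \<notin> set (i # is)" for j using that g(2) by simp
    moreover have "g i \<in> univ S" using g(1,2) a(1) by (cases "i \<in> set is") auto
    ultimately show ?R using g(1,3) by (intro exI[of _ g]) simp
  next
    assume ?R
    then obtain g where g: "\<forall>j\<in>set (i # is). g j \<in> univ S"
      "\<forall>j. j \<notin> set (i # is) \<longrightarrow> g j = v j" "sat S g \<phi>" by (elim exE conjE)
    then have "sat S (v(i := g i)) (exi_list is \<phi>)"
      unfolding Cons by (intro exI[of _ g]) simp
    then show ?L using g(1) by auto
  qed
qed

text \<open>The empty conjunction has to be primitive positive and closed, since
  \<open>defined_by\<close> restricts the free variables. \<open>Exi 0 (Equal 0 0)\<close> is such a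
  formula, and it is true when the universe is nonempty.\<close>

definition conj_list :: "'s fm list \<Rightarrow> 's fm" where
  "conj_list \<phi>s = foldr Conj \<phi>s (Exi 0 (Equal 0 0))"

lemma conj_list_simps:
  "primitive_positive (conj_list \<phi>s) \<longleftrightarrow> (\<forall>\<phi>\<in>set \<phi>s. primitive_positive \<phi>)"
  "wf_fm \<sigma> (conj_list \<phi>s) \<longleftrightarrow> (\<forall>\<phi>\<in>set \<phi>s. wf_fm \<sigma> \<phi>)"
  "univ S \<noteq> {} \<Longrightarrow> sat S v (conj_list \<phi>s) \<longleftrightarrow> (\<forall>\<phi>\<in>set \<phi>s. sat S v \<phi>)"
  "fv (conj_list \<phi>s) = (\<Union>\<phi>\<in>set \<phi>s. fv \<phi>)"
  by (induction \<phi>s) (auto simp: conj_list_def)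

section \<open>Projections of primitive positive relations\<close>

lemma pp_definable_image_distinct:
  assumes "primitive_positive \<phi>" "wf_fm (sig S) \<phi>" "distinct ys" "univ S \<noteq> {}"
  shows "pp_definable S (length ys) {map g ys | g. range g \<subseteq> univ S \<and> sat S g \<phi>}"
proof -
  define zs where "zs = sorted_list_of_set (fv \<phi> - set ys)"
  have zs: "set zs = fv \<phi> - set ys" unfolding zs_def by simp
  define ix where "ix = the_inv_into {..<length ys} (nth ys)"
  have inj: "inj_on (nth ys) {..<length ys}" using assms(3) by (simp add: inj_on_nth)
  have ix: "ix (ys ! i) = i" if "i < length ys" for i
    unfolding ix_def using the_inv_into_f_f[OF inj] that by simp
  \<comment> \<open>\<open>p\<close> moves the entries of \<open>ys\<close> to their positions, as
    \<open>defined_by\<close> requires, and shifts all other variables past these positions, so that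
    it is injective on all of \<open>nat\<close>.\<close>
  define p where "p z = (if z \<in> set ys then ix z else z + length ys)" for z
  have pix: "p (ys ! i) = i" if "i < length ys" for i
    using that ix by (simp add: p_def)
  have plt: "p z < length ys \<longleftrightarrow> z \<in> set ys" for z
    using pix by (cases "z \<in> set ys") (auto simp: p_def in_set_conv_nth[of z])
  have "inj p"
  proof (rule injI)
    fix x y assume e: "p x = p y"
    then have "x \<in> set ys \<longleftrightarrow> y \<in> set ys" using plt by metis
    moreover have "x = y" if "x \<in> set ys" "y \<in> set ys"
      using that e pix by (metis in_set_conv_nth)
    moreover have "x = y" if "x \<notin> set ys" "y \<notin> set ys"
      using that e by (simp add: p_def)
    ultimately show "x = y" by blast
  qed
  define \<psi> where "\<psi> = rename_fm p (exi_list zs \<phi>)"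
  have fv: "fv (exi_list zs \<phi>) \<subseteq> set ys" using zs by (auto simp: exi_list_simps)
  then have "fv \<psi> \<subseteq> {..<length ys}"
    unfolding \<psi>_def fv_rename_fm[OF \<open>inj p\<close>] using plt by auto
  moreover have "{map g ys | g. range g \<subseteq> univ S \<and> sat S g \<phi>}
      = {xs. length xs = length ys \<and> set xs \<subseteq> univ S \<and> sat S (\<lambda>i. xs ! i) \<psi>}" (is "?L = ?R")
  proof (intro set_eqI iffI)
    fix xs assume "xs \<in> ?L"
    then obtain g where g: "range g \<subseteq> univ S" "sat S g \<phi>" and xs: "xs = map g ys" by auto
    have "sat S g (exi_list zs \<phi>)"
      unfolding sat_exi_list using g by (intro exI[of _ g]) auto
    moreover have "sat S g (exi_list zs \<phi>) \<longleftrightarrow> sat S ((\<lambda>i. xs ! i) \<circ> p) (exi_list zs \<phi>)"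
    proof (rule sat_cong)
      fix z assume "z \<in> fv (exi_list zs \<phi>)"
      then obtain i where "i < length ys" "z = ys ! i" using fv by (metis in_set_conv_nth subsetD)
      then show "g z = ((\<lambda>i. xs ! i) \<circ> p) z" using pix xs by simp
    qed
    ultimately show "xs \<in> ?R" using g xs by (auto simp: \<psi>_def sat_rename_fm[OF \<open>inj p\<close>])
  next
    fix xs assume xs: "xs \<in> ?R"
    then have "sat S ((\<lambda>i. xs ! i) \<circ> p) (exi_list zs \<phi>)"
      by (simp add: \<psi>_def sat_rename_fm[OF \<open>inj p\<close>])
    then obtain g where g: "\<forall>i\<in>set zs. g i \<in> univ S"
        "\<forall>i. i \<notin> set zs \<longrightarrow> g i = ((\<lambda>i. xs ! i) \<circ> p) i" "sat S g \<phi>"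
      unfolding sat_exi_list by blast
    obtain e where e: "e \<in> univ S" using assms(4) by blast
    \<comment> \<open>Variables outside the formula and \<open>ys\<close> get the value
      \<open>e\<close>, because the assignments on the left have their whole range in the
      universe.\<close>
    define g' where "g' z = (if z \<in> set zs \<union> set ys then g z else e)" for z
    have gys: "g' (ys ! i) = xs ! i" if "i < length ys" for i
      using that g(2) zs pix by (simp add: g'_def)
    have "g' z \<in> univ S" for z
    proof (cases "z \<in> set ys")
      case True
      then obtain i where "i < length ys" "z = ys ! i" by (metis in_set_conv_nth)
      then show ?thesis using gys xs by (auto dest: nth_mem)
    next
      case False
      then show ?thesis using g(1) e by (auto simp: g'_def)
    qed
    then have "range g' \<subseteq> univ S" by auto
    moreover have "sat S g' \<phi> \<longleftrightarrow> sat S g \<phi>"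
      by (rule sat_cong) (use zs in \<open>auto simp: g'_def\<close>)
    moreover have "xs = map g' ys" using gys xs by (auto intro: nth_equalityI)
    ultimately show "xs \<in> ?L" using g(3) by blast
  qed
  moreover have "primitive_positive \<psi>" "wf_fm (sig S) \<psi>"
    using assms by (auto simp: \<psi>_def exi_list_simps)
  ultimately show ?thesis unfolding pp_definable_def defined_by_def by blast
qed

text \<open>A renaming cannot move a repeated entry of \<open>ys\<close> to two positions, so every
  position gets a fresh variable \<open>M + i\<close> that is tied to \<open>ys ! i\<close> by an
  equation.\<close>

lemma pp_definable_image:
  assumes "primitive_positive \<phi>" "wf_fm (sig S) \<phi>" "univ S \<noteq> {}"
  shows "pp_definable S (length ys) {map g ys | g. range g \<subseteq> univ S \<and> sat S g \<phi>}"
proof -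
  define M where "M = Suc (Max (fv \<phi> \<union> set ys \<union> {0}))"
  have M: "i < M" if "i \<in> fv \<phi> \<union> set ys" for i
    using that unfolding M_def by (simp add: less_Suc_eq_le)
  define n where "n = length ys"
  define zs where "zs = [M..<M + n]"
  define \<psi> where "\<psi> = Conj \<phi> (conj_list (map (\<lambda>i. Equal (M + i) (ys ! i)) [0..<n]))"
  have "{map g ys | g. range g \<subseteq> univ S \<and> sat S g \<phi>}
      = {map g zs | g. range g \<subseteq> univ S \<and> sat S g \<psi>}" (is "?L = ?R")
  proof (intro set_eqI iffI)
    fix xs assume "xs \<in> ?L"
    then obtain g where g: "range g \<subseteq> univ S" "sat S g \<phi>" and xs: "xs = map g ys" by auto
    define g' where "g' z = (if M \<le> z \<and> z < M + n then g (ys ! (z - M)) else g z)" for z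
    have "sat S g' \<phi> \<longleftrightarrow> sat S g \<phi>"
      by (rule sat_cong) (use M in \<open>fastforce simp: g'_def\<close>)
    moreover have "g' (M + i) = g' (ys ! i)" if "i < n" for i
      using that M[of "ys ! i"] by (auto simp: g'_def n_def)
    moreover have "range g' \<subseteq> univ S" using g by (auto simp: g'_def)
    moreover have "xs = map g' zs"
      unfolding xs zs_def g'_def n_def by (auto intro: nth_equalityI)
    ultimately show "xs \<in> ?R" using g assms by (auto simp: \<psi>_def conj_list_simps)
  next
    fix xs assume "xs \<in> ?R"
    then obtain g where g: "range g \<subseteq> univ S" "sat S g \<psi>" and xs: "xs = map g zs" by auto
    have "g (M + i) = g (ys ! i)" if "i < n" for i
      using g(2) that assms(3) by (auto simp: \<psi>_def conj_list_simps)
    then have "xs = map g ys" unfolding xs zs_def n_def by (auto intro: nth_equalityI)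
    then show "xs \<in> ?L" using g by (auto simp: \<psi>_def)
  qed
  moreover have "primitive_positive \<psi>" "wf_fm (sig S) \<psi>"
    using assms by (auto simp: \<psi>_def conj_list_simps)
  ultimately show ?thesis
    using pp_definable_image_distinct[of \<psi> S zs] assms(3) by (simp add: zs_def n_def)
qed

text \<open>A defining formula speaks about positions; to be conjoined with others it has to be put
  on an arbitrary tuple of distinct variables, with its remaining variables out of the way.\<close>

lemma pp_definable_formula:
  assumes "pp_definable S (length xs) R" "distinct xs"
  obtains \<phi> where "primitive_positive \<phi>" "wf_fm (sig S) \<phi>"
    "\<And>g. range g \<subseteq> univ S \<Longrightarrow> sat S g \<phi> \<longleftrightarrow> map g xs \<in> R"
proof -
  obtain \<phi> where \<phi>: "primitive_positive \<phi>" "wf_fm (sig S) \<phi>" "fv \<phi> \<subseteq> {..<length xs}"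
    and R: "R = {ys. length ys = length xs \<and> set ys \<subseteq> univ S \<and> sat S (\<lambda>i. ys ! i) \<phi>}"
    using assms(1) unfolding pp_definable_def defined_by_def by blast
  define M where "M = Suc (Max (set xs \<union> {0}))"
  have M: "i < M" if "i \<in> set xs" for i
    using that unfolding M_def by (simp add: less_Suc_eq_le)
  define p where "p i = (if i < length xs then xs ! i else i + M)" for i
  have "inj p"
  proof (rule injI)
    fix i j assume e: "p i = p j"
    have small: "p i < M \<longleftrightarrow> i < length xs" for i using M[of "xs ! i"] by (simp add: p_def)
    then have "i < length xs \<longleftrightarrow> j < length xs" using e by metis
    then show "i = j" using e assms(2)
      by (cases "i < length xs") (simp_all add: p_def nth_eq_iff_index_eq)
  qed
  show ?thesis
  proof
    fix g :: "nat \<Rightarrow> 'b" assume g: "range g \<subseteq> univ S"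
    have "sat S (g \<circ> p) \<phi> \<longleftrightarrow> sat S (\<lambda>i. map g xs ! i) \<phi>"
      by (rule sat_cong) (use \<phi>(3) in \<open>auto simp: p_def\<close>)
    then show "sat S g (rename_fm p \<phi>) \<longleftrightarrow> map g xs \<in> R"
      unfolding sat_rename_fm[OF \<open>inj p\<close>] R using g by auto
  qed (use \<phi> in auto)
qed

text \<open>The form in which later constructions obtain primitive positive relations: a finite
  constraint system and a projection of its solution set, with no formula in sight.\<close>

lemma pp_definable_projection:
  fixes S :: "('s, 'a) rstruct" and \<Phi> :: "(nat list \<times> 'a list set) set"
  assumes "finite \<Phi>" "\<And>xs R. (xs, R) \<in> \<Phi> \<Longrightarrow> distinct xs \<and> pp_definable S (length xs) R"
    and "univ S \<noteq> {}"
  shows "pp_definable S (length ys)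
    {map g ys | g. range g \<subseteq> univ S \<and> (\<forall>(xs, R)\<in>\<Phi>. map g xs \<in> R)}"
proof -
  have "\<exists>\<phi>. primitive_positive \<phi> \<and> wf_fm (sig S) \<phi> \<and>
      (\<forall>g. range g \<subseteq> univ S \<longrightarrow> sat S g \<phi> = (map g (fst c) \<in> snd c))" if "c \<in> \<Phi>" for c
    using assms(2)[of "fst c" "snd c"] that by (auto elim!: pp_definable_formula)
  then obtain f where f: "\<And>c. c \<in> \<Phi> \<Longrightarrow> primitive_positive (f c) \<and> wf_fm (sig S) (f c) \<and>
      (\<forall>g. range g \<subseteq> univ S \<longrightarrow> sat S g (f c) = (map g (fst c) \<in> snd c))"
    by metis
  obtain cs where cs: "set cs = \<Phi>" using assms(1) finite_list by blast
  have "{map g ys | g. range g \<subseteq> univ S \<and> (\<forall>(xs, R)\<in>\<Phi>. map g xs \<in> R)}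
     = {map g ys | g. range g \<subseteq> univ S \<and> sat S g (conj_list (map f cs))}"
  proof -
    have "(\<forall>(xs, R)\<in>\<Phi>. map g xs \<in> R) = sat S g (conj_list (map f cs))"
      if "range g \<subseteq> univ S" for g
      using f cs assms(3) that by (auto simp: conj_list_simps split: prod.splits)
    then show ?thesis by (intro Collect_cong ex_cong1 conj_cong) auto
  qed
  then show ?thesis
    using pp_definable_image[of "conj_list (map f cs)" S ys] f cs assms(3)
    by (simp add: conj_list_simps)
qed

lemma pp_definable_symbol:
  assumes "wf_rstruct S" "sig S s = Some n"
  shows "pp_definable S n (interp S s)"
  unfolding pp_definable_def defined_by_def
proof (intro exI conjI)
  have "map (\<lambda>i. xs ! i) [0..<n] = xs" if "length xs = n" for xs :: "'b list"
    using that by (metis map_nth)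
  moreover have "interp S s \<subseteq> {xs. length xs = n \<and> set xs \<subseteq> univ S}"
    using assms unfolding wf_rstruct_def by blast
  ultimately show "interp S s = {xs. length xs = n \<and> set xs \<subseteq> univ S \<and> sat S (\<lambda>i. xs ! i) (Atom s [0..<n])}"
    by auto
qed (use assms in auto)

lemma pp_definable_equality: "pp_definable S 2 {[a, a] | a. a \<in> univ S}"
  unfolding pp_definable_def defined_by_def
proof (intro exI conjI)
  show "{[a, a] | a. a \<in> univ S} = {xs. length xs = 2 \<and> set xs \<subseteq> univ S \<and> sat S (\<lambda>i. xs ! i) (Equal 0 1)}"
    by (auto simp: numeral_2_eq_2 length_Suc_conv)
qed auto

lemma pp_definable_tuple:
  assumes "pp_definable S n R" "xs \<in> R"
  shows "length xs = n" "set xs \<subseteq> univ S"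
  using assms unfolding pp_definable_def defined_by_def by auto

lemma pp_definable_relations_upto:
  assumes "wf_rstruct S" "(n, R) \<in> relations_upto S l"
  shows "pp_definable S n R"
  using assms pp_definable_symbol pp_definable_equality
  unfolding relations_upto_def relations_def by fastforce

section \<open>Invariance of definable relations\<close>

lemma sat_invariant:
  assumes g: "bij_betw g (univ S) (univ S)"
    and inv: "\<And>s xs. sig S s = Some (length xs) \<Longrightarrow> set xs \<subseteq> univ S \<Longrightarrow>
      map g xs \<in> interp S s \<longleftrightarrow> xs \<in> interp S s"
    and "wf_fm (sig S) \<phi>" "range v \<subseteq> univ S"
  shows "sat S (g \<circ> v) \<phi> \<longleftrightarrow> sat S v \<phi>"
  using assms(3,4)
proof (induction \<phi> arbitrary: v)
  case (Equal i j)
  then have "v i \<in> univ S" "v j \<in> univ S" by auto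
  then show ?case using g by (auto simp: bij_betw_def inj_on_def)
next
  case (Atom s ks)
  then have "set (map v ks) \<subseteq> univ S" by auto
  then show ?case using inv[of s "map v ks"] Atom by (simp add: comp_def)
next
  case (Exi i \<phi>)
  have IH: "sat S ((g \<circ> v)(i := g a)) \<phi> \<longleftrightarrow> sat S (v(i := a)) \<phi>" if "a \<in> univ S" for a
  proof -
    have "(g \<circ> v)(i := g a) = g \<circ> v(i := a)" by auto
    then show ?thesis using Exi.IH[of "v(i := a)"] Exi.prems that
      by (simp add: image_subset_iff del: o_apply fun_upd_apply) (simp add: fun_upd_def)
  qed
  \<comment> \<open>Surjectivity of \<open>g\<close>: witnesses of the quantifier may be taken in
    its image.\<close>
  have "(\<exists>a\<in>univ S. sat S ((g \<circ> v)(i := a)) \<phi>) \<longleftrightarrow> (\<exists>a\<in>univ S. sat S ((g \<circ> v)(i := g a)) \<phi>)"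
    using g by (metis (no_types, lifting) bij_betw_def image_iff)
  then show ?case using IH by (simp del: o_apply add: fun_upd_def)
qed auto

lemma definable_invariant:
  assumes g: "bij_betw g (univ S) (univ S)"
    and inv: "\<And>s xs. sig S s = Some (length xs) \<Longrightarrow> set xs \<subseteq> univ S \<Longrightarrow>
      map g xs \<in> interp S s \<longleftrightarrow> xs \<in> interp S s"
    and "defined_by S \<phi> n R" "length xs = n" "set xs \<subseteq> univ S" "univ S \<noteq> {}"
  shows "map g xs \<in> R \<longleftrightarrow> xs \<in> R"
proof -
  obtain e where e: "e \<in> univ S" using assms(6) by blast
  define v where "v i = (if i < n then xs ! i else e)" for i
  have R: "wf_fm (sig S) \<phi>" "fv \<phi> \<subseteq> {..<n}"
    "R = {xs. length xs = n \<and> set xs \<subseteq> univ S \<and> sat S (\<lambda>i. xs ! i) \<phi>}"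
    using assms(3) unfolding defined_by_def by auto
  have "range v \<subseteq> univ S" using e assms(4,5) by (auto simp: v_def)
  then have "sat S (g \<circ> v) \<phi> \<longleftrightarrow> sat S v \<phi>" using sat_invariant[OF g inv R(1)] by blast
  moreover have "sat S (g \<circ> v) \<phi> \<longleftrightarrow> sat S (\<lambda>i. map g xs ! i) \<phi>"
    by (rule sat_cong) (use R(2) assms(4) in \<open>auto simp: v_def\<close>)
  moreover have "sat S v \<phi> \<longleftrightarrow> sat S (\<lambda>i. xs ! i) \<phi>"
    by (rule sat_cong) (use R(2) assms(4) in \<open>auto simp: v_def\<close>)
  moreover have "set (map g xs) \<subseteq> univ S" using g assms(5) by (auto simp: bij_betw_def)
  ultimately show ?thesis using R(3) assms(4,5) by auto
qed

section \<open>Types of pairs and one-point extensions\<close>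

locale liberal_expansion =
  fixes A B :: "('s, 'a) rstruct" and F :: "('s, nat) rstruct set"
  assumes wf_A: "wf_rstruct A"
    and infinite_univ: "infinite (univ A)"
    and homogeneous: "homogeneous A"
    and bounded: "finitely_bounded_by A F"
    and core: "binary_core A"
    and liberal: "liberal F"
    and expansion: "fo_expansion A B"
begin

abbreviation U :: "'a set" where "U \<equiv> univ A"

definition lab :: "'a \<Rightarrow> 'a \<Rightarrow> 's set" where
  "lab a b = {s \<in> dom (sig A). [a, b] \<in> interp A s}"

text \<open>As all relations of \<open>A\<close> are binary and antireflexive, the two label sets
  determine the isomorphism type of the pair.\<close>

definition tp :: "'a \<Rightarrow> 'a \<Rightarrow> 's set \<times> 's set" where
  "tp a b = (lab a b, lab b a)"

text \<open>Antireflexivity empties the labels of \<open>(a, a)\<close>, while distinct elements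
  always carry one. So equality is just one more type, and transfer arguments need no separate
  clause for it.\<close>

definition eq_tp :: "'s set \<times> 's set" where
  "eq_tp = ({}, {})"

definition neq_tps :: "('s set \<times> 's set) set" where
  "neq_tps = {tp a b | a b. a \<in> U \<and> b \<in> U \<and> a \<noteq> b}"

lemma univ_B [simp]: "univ B = U"
  using expansion by (simp add: fo_expansion_def)

lemma wf_B: "wf_rstruct B"
  using expansion by (simp add: fo_expansion_def)

lemma univ_nonempty: "U \<noteq> {}"
  using infinite_univ by auto

lemma sig_A: "s \<in> dom (sig A) \<Longrightarrow> sig A s = Some 2"
  using core unfolding binary_core_def by blast

lemma finite_dom: "finite (dom (sig A))"
  using wf_A by (simp add: wf_rstruct_def)

lemma tp_swap: "tp b a = prod.swap (tp a b)"
  by (simp add: tp_def)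

lemma lab_refl [simp]: "lab a a = {}"
  using core unfolding binary_core_def lab_def by blast

lemma tp_refl [simp]: "tp a a = eq_tp"
  by (simp add: tp_def eq_tp_def)

lemma lab_eq_empty_iff: "a \<in> U \<Longrightarrow> b \<in> U \<Longrightarrow> lab a b = {} \<longleftrightarrow> a = b"
  using core unfolding binary_core_def lab_def by fastforce

lemma tp_eq_iff [simp]: "a \<in> U \<Longrightarrow> b \<in> U \<Longrightarrow> tp a b = eq_tp \<longleftrightarrow> a = b"
  using lab_eq_empty_iff[of a b] by (auto simp: tp_def eq_tp_def)

lemma neq_tps_I: "a \<in> U \<Longrightarrow> b \<in> U \<Longrightarrow> a \<noteq> b \<Longrightarrow> tp a b \<in> neq_tps"
  by (auto simp: neq_tps_def)

lemma eq_tp_notin: "eq_tp \<notin> neq_tps"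
  by (auto simp: neq_tps_def) (metis tp_eq_iff)

lemma swap_neq_tps: "t \<in> neq_tps \<Longrightarrow> prod.swap t \<in> neq_tps"
  by (auto simp: neq_tps_def) (metis tp_swap)

lemma neq_tps_nonempty: "neq_tps \<noteq> {}"
proof -
  obtain a where a: "a \<in> U" using univ_nonempty by blast
  obtain b where "b \<in> U - {a}" using infinite_univ by (metis ex_in_conv finite.emptyI infinite_remove)
  then show ?thesis using a neq_tps_I by blast
qed

definition tps :: "('s set \<times> 's set) set" where
  "tps = {tp a b | a b. a \<in> U \<and> b \<in> U}"

lemma finite_tps: "finite tps"
proof (rule finite_subset)
  show "tps \<subseteq> Pow (dom (sig A)) \<times> Pow (dom (sig A))" by (auto simp: tps_def tp_def lab_def)
qed (use finite_dom in auto)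

lemma tps_cases: "t \<in> tps \<longleftrightarrow> t = eq_tp \<or> t \<in> neq_tps"
  using univ_nonempty unfolding tps_def neq_tps_def by auto (metis tp_refl)+

text \<open>Homogeneity for indexed families with possible repetitions: \<open>eq_tp\<close> is the
  type of equal elements only, so \<open>f\<close> and \<open>f'\<close> have the same coincidences
  and sending \<open>f i\<close> to \<open>f' i\<close> is well defined.\<close>

lemma extend_automorphism:
  assumes "finite I" "f ` I \<subseteq> U" "f' ` I \<subseteq> U"
    and tp: "\<And>i j. i \<in> I \<Longrightarrow> j \<in> I \<Longrightarrow> tp (f i) (f j) = tp (f' i) (f' j)"
  obtains g where "automorphism g A" "\<And>i. i \<in> I \<Longrightarrow> g (f i) = f' i"
proof -
  define \<phi> where "\<phi> x = f' (inv_into I f x)" for x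
  have eq: "f i = f j \<longleftrightarrow> f' i = f' j" if "i \<in> I" "j \<in> I" for i j
    using tp[OF that] that assms(2,3) by (metis image_subset_iff tp_eq_iff)
  have \<phi>: "\<phi> (f i) = f' i" if "i \<in> I" for i
    unfolding \<phi>_def using eq that by (metis f_inv_into_f imageI inv_into_into)
  have "isomorphism \<phi> (substructure A (f ` I)) (substructure A (f' ` I))"
    unfolding isomorphism_def embedding_def
  proof (intro conjI allI impI)
    show "inj_on \<phi> (univ (substructure A (f ` I)))"
      by (auto simp: inj_on_def substructure_def \<phi> eq)
    show "\<phi> ` univ (substructure A (f ` I)) \<subseteq> univ (substructure A (f' ` I))"
      "\<phi> ` univ (substructure A (f ` I)) = univ (substructure A (f' ` I))"
      by (auto simp: substructure_def \<phi> image_image)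
  next
    fix s n xs
    assume a: "sig (substructure A (f ` I)) s = Some n \<and> length xs = n \<and>
      set xs \<subseteq> univ (substructure A (f ` I))"
    then have s: "s \<in> dom (sig A)" by (auto simp: substructure_def)
    then have "length xs = 2" using a sig_A by (auto simp: substructure_def)
    then obtain i j where ij: "i \<in> I" "j \<in> I" "xs = [f i, f j]"
      using a by (auto simp: substructure_def length_Suc_conv numeral_2_eq_2)
    have "s \<in> lab (f i) (f j) \<longleftrightarrow> s \<in> lab (f' i) (f' j)"
      using tp[OF ij(1,2)] by (simp add: tp_def)
    then show "xs \<in> interp (substructure A (f ` I)) s \<longleftrightarrow>
        map \<phi> xs \<in> interp (substructure A (f' ` I)) s"
      using ij s by (auto simp: substructure_def lab_def \<phi>)
  qed (simp add: substructure_def)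
  then obtain g where "automorphism g A" "\<forall>x\<in>f ` I. g x = \<phi> x"
    using homogeneous assms(1-3) unfolding homogeneous_def by (metis finite_imageI)
  then show thesis using that \<phi> by auto
qed

lemma automorphism_bij: "automorphism g A \<Longrightarrow> bij_betw g U U"
  by (auto simp: automorphism_def isomorphism_def embedding_def bij_betw_def)

lemma automorphism_tp:
  assumes "automorphism g A" "a \<in> U" "b \<in> U"
  shows "tp (g a) (g b) = tp a b"
proof -
  have "[g x, g y] \<in> interp A s \<longleftrightarrow> [x, y] \<in> interp A s"
    if "s \<in> dom (sig A)" "x \<in> U" "y \<in> U" for s x y
  proof -
    have "sig A s = Some (length [x, y])" "set [x, y] \<subseteq> U" using sig_A[OF that(1)] that by simp_all
    then have "[x, y] \<in> interp A s \<longleftrightarrow> map g [x, y] \<in> interp A s"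
      using assms(1) unfolding automorphism_def isomorphism_def embedding_def by blast
    then show ?thesis by simp
  qed
  then show ?thesis using assms(2,3) by (auto simp: tp_def lab_def)
qed

lemma automorphism_fo_definable:
  assumes "automorphism g A" "fo_definable A n R" "length xs = n" "set xs \<subseteq> U"
  shows "map g xs \<in> R \<longleftrightarrow> xs \<in> R"
proof -
  have "map g xs \<in> interp A s \<longleftrightarrow> xs \<in> interp A s"
    if "sig A s = Some (length xs)" "set xs \<subseteq> U" for s xs
    using assms(1) that unfolding automorphism_def isomorphism_def embedding_def by blast
  then show ?thesis
    using definable_invariant[OF automorphism_bij[OF assms(1)]] assms(2-4) univ_nonempty
    unfolding fo_definable_def by blast
qed

lemma automorphism_pp_definable:
  assumes "automorphism g A" "pp_definable B n R" "length xs = n" "set xs \<subseteq> U"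
  shows "map g xs \<in> R \<longleftrightarrow> xs \<in> R"
proof -
  have "map g xs \<in> interp B s \<longleftrightarrow> xs \<in> interp B s"
    if "sig B s = Some (length xs)" "set xs \<subseteq> U" for s xs
    using automorphism_fo_definable[OF assms(1)] expansion that unfolding fo_expansion_def by blast
  then show ?thesis
    using definable_invariant[of g B] automorphism_bij[OF assms(1)] assms(2-4) univ_nonempty
    unfolding pp_definable_def by auto
qed

text \<open>Tuples with the same types of pairs lie in one orbit of the automorphism group of
  \<open>A\<close>, and this group preserves every relation definable in \<open>B\<close>.\<close>

lemma pp_definable_transfer:
  assumes R: "pp_definable B n R" and xs: "xs \<in> R" and ys: "length ys = n" "set ys \<subseteq> U"
    and tp: "\<And>i j. i < n \<Longrightarrow> j < n \<Longrightarrow> tp (xs ! i) (xs ! j) = tp (ys ! i) (ys ! j)"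
  shows "ys \<in> R"
proof -
  have len: "length xs = n" "set xs \<subseteq> U" using pp_definable_tuple[OF R xs] by auto
  obtain g where g: "automorphism g A" "\<And>i. i < n \<Longrightarrow> g (xs ! i) = ys ! i"
    using extend_automorphism[of "{..<n}" "nth xs" "nth ys"] tp len ys
    by (metis (no_types, lifting) finite_lessThan image_subset_iff lessThan_iff nth_mem subset_code(1))
  then have "map g xs = ys" using len ys by (auto intro: nth_equalityI)
  then show ?thesis using automorphism_pp_definable[OF g(1) R len] xs by simp
qed

section \<open>Realizing labellings by types in \<open>A\<close>\<close>

definition realizes :: "(nat \<Rightarrow> 'a) \<Rightarrow> nat set \<Rightarrow> (nat \<Rightarrow> nat \<Rightarrow> 's set \<times> 's set) \<Rightarrow> bool" where
  "realizes f X \<tau> \<longleftrightarrow> f ` X \<subseteq> U \<and> (\<forall>x\<in>X. \<forall>y\<in>X. tp (f x) (f y) = \<tau> x y)"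

lemma F_member:
  assumes "E \<in> F"
  shows "finite_rstruct (sig A) E" "\<not> embeds E A"
proof -
  show E: "finite_rstruct (sig A) E" using bounded assms by (simp add: finitely_bounded_by_def)
  have "embedding id E E" by (auto simp: embedding_def)
  then show "\<not> embeds E A"
    using bounded assms E unfolding finitely_bounded_by_def embeds_def by blast
qed

text \<open>A bound embedded into the structure read off from \<tau> occupies a subset of
  \<open>V\<close> of its own size; a realization of \<tau> on that subset would embed the bound
  into \<open>A\<close>. Hence only subsets of the size of a bound have to be checked, which is the
  source of \<open>MaxBound\<close>.\<close>

lemma embed_labelling:
  assumes V: "finite V"
    and sub: "\<And>X. X \<subseteq> V \<Longrightarrow> card X \<in> (\<lambda>E. card (univ E)) ` F \<Longrightarrow> \<exists>f. realizes f X \<tau>"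
    and refl: "\<And>x. x \<in> V \<Longrightarrow> \<tau> x x = eq_tp"
    and neq: "\<And>x y. x \<in> V \<Longrightarrow> y \<in> V \<Longrightarrow> x \<noteq> y \<Longrightarrow> \<tau> x y \<in> neq_tps"
    and sym: "\<And>x y. x \<in> V \<Longrightarrow> y \<in> V \<Longrightarrow> \<tau> y x = prod.swap (\<tau> x y)"
  shows "\<exists>f. realizes f V \<tau>"
proof -
  have fst_neq: "fst (\<tau> x y) \<noteq> {}" if xy: "x \<in> V" "y \<in> V" "x \<noteq> y" for x y
  proof -
    obtain a b where "a \<in> U" "b \<in> U" "a \<noteq> b" "\<tau> x y = tp a b"
      using neq[OF xy] by (auto simp: neq_tps_def)
    then show ?thesis by (simp add: tp_def lab_eq_empty_iff)
  qed
  have fst_dom: "fst (\<tau> x y) \<subseteq> dom (sig A)" if "x \<in> V" "y \<in> V" for x y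
  proof (cases "x = y")
    case True
    then show ?thesis using refl that by (simp add: eq_tp_def)
  next
    case False
    with neq[OF that] obtain a b where "\<tau> x y = tp a b"
      unfolding neq_tps_def by blast
    then show ?thesis by (auto simp: tp_def lab_def)
  qed
  define D :: "('s, nat) rstruct" where
    "D = \<lparr>univ = V, sig = sig A, interp = (\<lambda>s. {[x, y] | x y. x \<in> V \<and> y \<in> V \<and> s \<in> fst (\<tau> x y)})\<rparr>"
  have two: "n = 2" if "sig A s = Some n" for s n using that sig_A[of s] by (simp add: domI)
  have "interp D s \<subseteq> {xs. length xs = n \<and> set xs \<subseteq> univ D}" if "sig D s = Some n" for s n
  proof -
    have "n = 2" using that by (intro two) (simp add: D_def)
    then show ?thesis by (auto simp: D_def)
  qed
  then have "finite_rstruct (sig A) D"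
    using V finite_dom by (simp add: finite_rstruct_def wf_rstruct_def) (simp add: D_def)
  moreover have "\<not> embeds E D" if "E \<in> F" for E
  proof
    assume "embeds E D"
    then obtain e where e: "embedding e E D" by (auto simp: embeds_def)
    define X where "X = e ` univ E"
    have X: "X \<subseteq> V" "card X = card (univ E)"
      using e by (auto simp: X_def embedding_def D_def card_image)
    have "card X \<in> (\<lambda>E. card (univ E)) ` F" using X(2) \<open>E \<in> F\<close> by simp
    then obtain f where f: "realizes f X \<tau>" using sub[OF X(1)] by blast
    have labf: "lab (f x) (f y) = fst (\<tau> x y)" if "x \<in> X" "y \<in> X" for x y
    proof -
      have "tp (f x) (f y) = \<tau> x y" using f that by (simp add: realizes_def)
      then show ?thesis by (metis fst_conv tp_def)
    qed
    have "inj_on f X"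
      by (rule inj_onI) (metis X(1) fst_neq lab_refl labf subsetD)
    then have "inj_on (f \<circ> e) (univ E)"
      using e by (auto simp: comp_inj_on embedding_def X_def)
    moreover have "(xs \<in> interp E s) = (map (f \<circ> e) xs \<in> interp A s)"
      if xs: "sig E s = Some n" "length xs = n" "set xs \<subseteq> univ E" for s n xs
    proof -
      have s: "sig A s = Some n" using e xs(1) by (simp add: embedding_def D_def)
      then have "length xs = 2" using xs two by auto
      then obtain p q where pq: "xs = [p, q]" "p \<in> univ E" "q \<in> univ E"
        using xs(3) by (cases xs; cases "tl xs") auto
      have "xs \<in> interp E s \<longleftrightarrow> map e xs \<in> interp D s"
        using e xs unfolding embedding_def by blast
      also have "\<dots> \<longleftrightarrow> s \<in> fst (\<tau> (e p) (e q))" 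
      proof -
        have "e p \<in> V" "e q \<in> V" using pq X(1) by (auto simp: X_def)
        then show ?thesis using pq(1) by (simp add: D_def)
      qed
      also have "\<dots> \<longleftrightarrow> s \<in> lab (f (e p)) (f (e q))" using labf pq by (simp add: X_def)
      also have "\<dots> \<longleftrightarrow> map (f \<circ> e) xs \<in> interp A s" using s pq by (auto simp: lab_def)
      finally show ?thesis .
    qed
    ultimately have "embedding (f \<circ> e) E A"
      using e f unfolding embedding_def realizes_def X_def D_def by (simp add: image_comp)
    then show False using F_member(2)[OF that] by (auto simp: embeds_def)
  qed
  ultimately have "embeds D A" using bounded unfolding finitely_bounded_by_def by blast
  then obtain f where f: "embedding f D A" by (auto simp: embeds_def)
  have "[x, y] \<in> interp D s \<longleftrightarrow> [f x, f y] \<in> interp A s"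
    if "x \<in> V" "y \<in> V" "s \<in> dom (sig A)" for x y s
  proof -
    have "sig D s = Some 2" "set [x, y] \<subseteq> univ D" using that sig_A by (simp_all add: D_def)
    then have "[x, y] \<in> interp D s \<longleftrightarrow> map f [x, y] \<in> interp A s"
      using f unfolding embedding_def by (metis One_nat_def Suc_1 length_Cons list.size(3))
    then show ?thesis by simp
  qed
  then have mem: "s \<in> fst (\<tau> x y) \<longleftrightarrow> [f x, f y] \<in> interp A s"
    if "x \<in> V" "y \<in> V" "s \<in> dom (sig A)" for x y s
    using that by (simp add: D_def)
  have "lab (f x) (f y) = fst (\<tau> x y)" if "x \<in> V" "y \<in> V" for x y
    using mem[OF that] fst_dom[OF that] unfolding lab_def by blast
  then have "tp (f x) (f y) = \<tau> x y" if "x \<in> V" "y \<in> V" for x y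
    using that sym[OF that] by (simp add: tp_def prod_eq_iff)
  then have "realizes f V \<tau>"
    using f unfolding realizes_def embedding_def D_def by simp
  then show ?thesis by blast
qed

text \<open>Together with the new point there are at most six, so liberality leaves only subsets
  with at most two points to check, and every type in \<open>neq_tps\<close> is realized by a pair.
  This yields a copy of \<open>X\<close> with a new point; homogeneity moves the copy onto
  \<open>X\<close>.\<close>

lemma one_point_extension:
  assumes X: "finite X" "X \<subseteq> U" "card X \<le> 5" and \<phi>: "\<And>x. x \<in> X \<Longrightarrow> \<phi> x \<in> neq_tps"
  shows "\<exists>z\<in>U. z \<notin> X \<and> (\<forall>x\<in>X. tp x z = \<phi> x)"
proof -
  define n where "n = card X"
  obtain h where h: "bij_betw h {0..<n} X" using ex_bij_betw_nat_finite[OF X(1)] n_def by blast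
  have hX: "h i \<in> X" if "i < n" for i using h that by (auto simp: bij_betw_def)
  \<comment> \<open>The index \<open>n\<close> stands for the new point, the smaller indices for the
    elements of \<open>X\<close>.\<close>
  define \<tau> where "\<tau> i j = (if i = n then if j = n then eq_tp else prod.swap (\<phi> (h j))
    else if j = n then \<phi> (h i) else tp (h i) (h j))" for i j
  have refl: "\<tau> i i = eq_tp" for i by (simp add: \<tau>_def)
  have neq: "\<tau> i j \<in> neq_tps" if "i \<in> {..n}" "j \<in> {..n}" "i \<noteq> j" for i j
  proof -
    have "h i \<noteq> h j" if "i < n" "j < n" using h that \<open>i \<noteq> j\<close> by (auto simp: bij_betw_def inj_on_def)
    then show ?thesis using that \<phi> hX swap_neq_tps X(2) unfolding \<tau>_def
      by (auto intro!: neq_tps_I)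
  qed
  have sym: "\<tau> j i = prod.swap (\<tau> i j)" for i j
    by (auto simp: \<tau>_def eq_tp_def tp_def)
  have realized: "\<exists>f. realizes f Y \<tau>" if Y: "Y \<subseteq> {..n}" "card Y \<in> (\<lambda>E. card (univ E)) ` F" for Y
  proof -
    have fY: "finite Y" using Y(1) finite_subset by blast
    have "card Y \<le> 6" using card_mono[OF _ Y(1)] X(3) by (simp add: n_def)
    moreover have "card Y \<notin> {3, 4, 5, 6}" using Y(2) liberal by (auto simp: liberal_def)
    ultimately have "card Y \<le> 2" by auto
    then consider "Y = {}" | i where "Y = {i}" | i j where "Y = {i, j}" "i \<noteq> j"
      using fY by (metis One_nat_def card_0_eq card_1_singletonE card_2_iff le_SucE le_zero_eq numeral_2_eq_2)
    then show ?thesis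
    proof cases
      case 1
      then show ?thesis by (simp add: realizes_def)
    next
      case 2
      obtain a where "a \<in> U" using univ_nonempty by blast
      then have "realizes (\<lambda>_. a) Y \<tau>" using 2 refl by (simp add: realizes_def)
      then show ?thesis by blast
    next
      case 3
      then obtain a b where ab: "a \<in> U" "b \<in> U" "a \<noteq> b" "\<tau> i j = tp a b"
        using neq[of i j] Y(1) by (auto simp: neq_tps_def)
      then have "realizes (\<lambda>k. if k = i then a else b) Y \<tau>"
        using 3 refl sym[of j i] by (auto simp: realizes_def tp_swap[of b a])
      then show ?thesis by blast
    qed
  qed
  have "\<exists>f. realizes f {..n} \<tau>"
    by (rule embed_labelling[OF finite_atMost realized refl neq sym])
  then obtain f where f: "realizes f {..n} \<tau>" ..
  have "tp (f i) (f j) = tp (h i) (h j)" if "i < n" "j < n" for i j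
    using f that by (simp add: realizes_def \<tau>_def)
  moreover have "f ` {..<n} \<subseteq> U" "h ` {..<n} \<subseteq> U" using f hX X(2) by (auto simp: realizes_def)
  ultimately obtain g where g: "automorphism g A" "\<And>i. i \<in> {..<n} \<Longrightarrow> g (f i) = h i"
    using extend_automorphism[of "{..<n}" f h] by (metis finite_lessThan lessThan_iff)
  have gU: "g a \<in> U" if "a \<in> U" for a using automorphism_bij[OF g(1)] that by (auto simp: bij_betw_def)
  note tpg = automorphism_tp[OF g(1)]
  have fU: "f i \<in> U" if "i \<le> n" for i using f that by (auto simp: realizes_def)
  have z: "tp x (g (f n)) = \<phi> x" if x: "x \<in> X" for x
  proof -
    obtain i where i: "i < n" "x = h i" using h x by (auto simp: bij_betw_def)
    then have "tp x (g (f n)) = tp (g (f i)) (g (f n))" using g(2) by simp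
    also have "\<dots> = tp (f i) (f n)" using tpg fU i(1) by simp
    also have "\<dots> = \<phi> x" using f i by (simp add: realizes_def \<tau>_def)
    finally show ?thesis .
  qed
  have "g (f n) \<notin> X" using z \<phi> eq_tp_notin tp_refl by metis
  moreover have "g (f n) \<in> U" using gU fU by simp
  ultimately show ?thesis using z by blast
qed


section \<open>Primitive positive relations and strict width\<close>

lemma extend_by_one:
  assumes "length xs \<le> 5" "set xs \<subseteq> U" "\<forall>x\<in>set xs. \<phi> x \<in> neq_tps"
  shows "\<exists>z\<in>U. z \<notin> set xs \<and> (\<forall>x\<in>set xs. tp x z = \<phi> x)"
  using assms card_length[of xs] by (intro one_point_extension) auto

abbreviation pp :: "nat \<Rightarrow> 'a list set \<Rightarrow> bool" where
  "pp n R \<equiv> pp_definable B n R"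

text \<open>The default \<open>hd xs\<close> keeps the range inside the set of entries:
  \<open>pp_projection\<close> works with total assignments into \<open>U\<close>.\<close>

definition pick :: "'b list \<Rightarrow> nat \<Rightarrow> 'b" where
  "pick xs i = (if i < length xs then xs ! i else hd xs)"

lemma range_pick: "xs \<noteq> [] \<Longrightarrow> set xs \<subseteq> X \<Longrightarrow> range (pick xs) \<subseteq> X"
  by (auto simp: pick_def)

lemma pick_nth [simp]: "i < length xs \<Longrightarrow> pick xs i = xs ! i"
  by (simp add: pick_def)

lemma pp_projection:
  fixes \<Phi> :: "(nat list \<times> 'a list set) set"
  assumes "finite \<Phi>" "\<And>xs R. (xs, R) \<in> \<Phi> \<Longrightarrow> distinct xs \<and> pp (length xs) R"
    and "R = {map g ys | g. range g \<subseteq> U \<and> (\<forall>(xs, R)\<in>\<Phi>. map g xs \<in> R)}" "n = length ys"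
  shows "pp n R"
  using pp_definable_projection[of \<Phi> B ys] assms univ_nonempty by auto

definition rel :: "('s set \<times> 's set) set \<Rightarrow> 'a list set" where
  "rel T = {[a, b] | a b. a \<in> U \<and> b \<in> U \<and> tp a b \<in> T}"

lemma rel_iff: "[a, b] \<in> rel T \<longleftrightarrow> a \<in> U \<and> b \<in> U \<and> tp a b \<in> T"
  by (simp add: rel_def)

lemma pp_subset: "pp n R \<Longrightarrow> xs \<in> R \<Longrightarrow> set xs \<subseteq> U"
  using pp_definable_tuple(2)[of B n R xs] by simp

lemma pp_Int:
  assumes "pp 2 (rel S)" "pp 2 (rel T)"
  shows "pp 2 (rel (S \<inter> T))"
proof (rule pp_projection[where \<Phi> = "{([0, 1], rel S), ([0, 1], rel T)}" and ys = "[0, 1]"])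
  show "rel (S \<inter> T) = {map g [0::nat, 1] | g. range g \<subseteq> U \<and>
      (\<forall>(xs, R)\<in>{([0, 1], rel S), ([0, 1], rel T)}. map g xs \<in> R)}" (is "?L = ?R")
  proof (intro equalityI subsetI)
    fix xs assume "xs \<in> ?L"
    then obtain a b where xs: "xs = [a, b]" "a \<in> U" "b \<in> U" "tp a b \<in> S \<inter> T" by (auto simp: rel_def)
    then show "xs \<in> ?R"
      using range_pick[of "[a, b]" U] by (intro CollectI exI[of _ "pick [a, b]"]) (simp add: rel_iff)
  qed (auto simp: rel_iff)
qed (use assms in \<open>auto simp: eval_nat_numeral\<close>)

lemma pp_interp: "s \<in> dom (sig A) \<Longrightarrow> pp 2 (interp A s)"
proof -
  assume s: "s \<in> dom (sig A)"
  then have "sig B s = Some 2" "interp B s = interp A s"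
    using expansion sig_A[OF s] unfolding fo_expansion_def map_le_def by auto
  then show ?thesis using pp_definable_symbol[OF wf_B] by metis
qed

lemma lab_singleton:
  assumes "a \<in> U" "b \<in> U" "a \<noteq> b"
  obtains s where "s \<in> dom (sig A)" "lab a b = {s}"
    "\<And>x y. x \<in> U \<Longrightarrow> y \<in> U \<Longrightarrow> lab x y = {s} \<longleftrightarrow> [x, y] \<in> interp A s"
proof -
  have ex1: "\<exists>!s. s \<in> lab x y" if "x \<in> U" "y \<in> U" "x \<noteq> y" for x y
    using core that unfolding binary_core_def lab_def by blast
  then obtain s where s: "s \<in> lab a b" using assms by blast
  have "lab x y = {s} \<longleftrightarrow> [x, y] \<in> interp A s" if xy: "x \<in> U" "y \<in> U" for x y
  proof
    assume "lab x y = {s}"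
    then show "[x, y] \<in> interp A s" by (auto simp: lab_def)
  next
    assume "[x, y] \<in> interp A s"
    then have "s \<in> lab x y" using s by (simp add: lab_def)
    moreover from this have "x \<noteq> y" by auto
    ultimately show "lab x y = {s}" using ex1[OF xy] by blast
  qed
  moreover have "lab a b = {s}" using ex1[OF assms] s by blast
  moreover have "s \<in> dom (sig A)" using s by (simp add: lab_def)
  ultimately show thesis using that by blast
qed

text \<open>The relation symbol holding between two distinct elements is unique, so a type other
  than equality amounts to one atom in each direction.\<close>

lemma pp_rel_singleton:
  assumes "t \<in> tps"
  shows "pp 2 (rel {t})"
proof (cases "t = eq_tp")
  case True
  then have "rel {t} = {[a, a] | a. a \<in> U}" by (auto simp: rel_def)
  then show ?thesis using pp_definable_equality[of B] by simp
next
  case False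
  then have "t \<in> neq_tps" using assms tps_cases by blast
  then obtain a b where ab: "a \<in> U" "b \<in> U" "a \<noteq> b" "t = tp a b" unfolding neq_tps_def by blast
  obtain s where s: "s \<in> dom (sig A)" "lab a b = {s}"
    "\<And>x y. x \<in> U \<Longrightarrow> y \<in> U \<Longrightarrow> lab x y = {s} \<longleftrightarrow> [x, y] \<in> interp A s"
    using lab_singleton ab by metis
  obtain r where r: "r \<in> dom (sig A)" "lab b a = {r}"
    "\<And>x y. x \<in> U \<Longrightarrow> y \<in> U \<Longrightarrow> lab x y = {r} \<longleftrightarrow> [x, y] \<in> interp A r"
    using lab_singleton ab by metis
  have t: "tp x y = t \<longleftrightarrow> [x, y] \<in> interp A s \<and> [y, x] \<in> interp A r" if "x \<in> U" "y \<in> U" for x y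
    using s r that ab(4) by (simp add: tp_def)
  show ?thesis
  proof (rule pp_projection[where \<Phi> = "{([0, 1], interp A s), ([1, 0], interp A r)}" and ys = "[0, 1]"])
    show "rel {t} = {map g [0::nat, 1] | g. range g \<subseteq> U \<and>
        (\<forall>(xs, R)\<in>{([0, 1], interp A s), ([1, 0], interp A r)}. map g xs \<in> R)}" (is "?L = ?R")
    proof (intro equalityI subsetI)
      fix xs assume "xs \<in> ?L"
      then obtain a b where xs: "xs = [a, b]" "a \<in> U" "b \<in> U" "tp a b = t" by (auto simp: rel_def)
      then show "xs \<in> ?R"
        using range_pick[of "[a, b]" U] t
        by (intro CollectI exI[of _ "pick [a, b]"]) (simp add: rel_iff)
    next
      fix xs assume "xs \<in> ?R"
      then obtain g where g: "range g \<subseteq> U" "xs = [g (0::nat), g 1]" "[g 0, g 1] \<in> interp A s" "[g 1, g 0] \<in> interp A r"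
        by (auto simp del: One_nat_def)
      then have "g 0 \<in> U" "g 1 \<in> U" by auto
      then show "xs \<in> ?L" using g t by (simp add: rel_iff)
    qed
  qed (use pp_interp[OF s(1)] pp_interp[OF r(1)] in \<open>auto simp: eval_nat_numeral\<close>)
qed

lemma ex_tp:
  assumes "b \<in> U" "t \<in> tps"
  obtains z where "z \<in> U" "tp b z = t"
proof (cases "t = eq_tp")
  case True
  then show ?thesis using that[of b] assms(1) by simp
next
  case False
  then have "t \<in> neq_tps" using assms(2) tps_cases by blast
  then show ?thesis using extend_by_one[of "[b]" "\<lambda>_. t"] assms(1) that by auto
qed

lemma swap_tps: "t \<in> tps \<Longrightarrow> prod.swap t \<in> tps"
proof -
  assume "t \<in> tps"
  then obtain a b where "a \<in> U" "b \<in> U" "t = tp a b" unfolding tps_def by blast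
  then show ?thesis unfolding tps_def using tp_swap[where a = a and b = b, symmetric] by blast
qed

lemma ex_tp':
  assumes "b \<in> U" "t \<in> tps"
  obtains z where "z \<in> U" "tp z b = t"
proof -
  obtain z where "z \<in> U" "tp b z = prod.swap t" using ex_tp[OF assms(1) swap_tps[OF assms(2)]] .
  then show thesis using that[of z] tp_swap[of z b] by simp
qed

text \<open>With two distinct types \<open>\<alpha>\<close>, \<open>\<beta>\<close> of pairs of distinct elements, \<open>x \<noteq> y\<close> holds iff some \<open>z\<close>
  has type \<open>\<alpha>\<close> over \<open>x\<close> and \<open>\<beta>\<close> over \<open>y\<close>.\<close>

lemma pp_rel_neq: "pp 2 (rel neq_tps)"
proof (cases "\<exists>\<alpha> \<beta>. \<alpha> \<in> neq_tps \<and> \<beta> \<in> neq_tps \<and> \<alpha> \<noteq> \<beta>")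
  case False
  obtain t where "t \<in> neq_tps" using neq_tps_nonempty by blast
  then have "neq_tps = {t}" "t \<in> tps" using False tps_cases by blast+
  then show ?thesis using pp_rel_singleton by metis
next
  case True
  then obtain \<alpha> \<beta> where ab: "\<alpha> \<in> neq_tps" "\<beta> \<in> neq_tps" "\<alpha> \<noteq> \<beta>" by blast
  show ?thesis
  proof (rule pp_projection[where \<Phi> = "{([0, 2], rel {\<alpha>}), ([1, 2], rel {\<beta>})}" and ys = "[0, 1]"])
    show "rel neq_tps = {map g [0::nat, 1] | g. range g \<subseteq> U \<and>
        (\<forall>(xs, R)\<in>{([0, 2], rel {\<alpha>}), ([1, 2], rel {\<beta>})}. map g xs \<in> R)}" (is "?L = ?R")
    proof (intro equalityI subsetI)
      fix xs assume "xs \<in> ?L"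
      then obtain x y where xs: "xs = [x, y]" "x \<in> U" "y \<in> U" "tp x y \<in> neq_tps" by (auto simp: rel_def)
      then have ne: "x \<noteq> y" using eq_tp_notin by auto
      obtain z where "z \<in> U" "tp x z = \<alpha>" "tp y z = \<beta>"
        using extend_by_one[of "[x, y]" "\<lambda>u. if u = x then \<alpha> else \<beta>"] xs ab ne by auto
      then show "xs \<in> ?R" using range_pick[of "[x, y, z]" U] xs
        by (intro CollectI exI[of _ "pick [x, y, z]"]) (simp add: rel_iff)
    next
      fix xs assume "xs \<in> ?R"
      then obtain g where "xs = [g (0::nat), g 1]" "tp (g 0) (g 2) = \<alpha>" "tp (g 1) (g 2) = \<beta>"
        "g 0 \<in> U" "g 1 \<in> U" by (auto simp: rel_iff simp del: One_nat_def)
      then show "xs \<in> ?L" using ab(3) by (auto simp: rel_iff intro!: neq_tps_I)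
    qed
    have "\<alpha> \<in> tps" "\<beta> \<in> tps" using ab tps_cases by auto
    then show "distinct xs \<and> pp (length xs) R"
      if "(xs, R) \<in> {([0::nat, 2], rel {\<alpha>}), ([1, 2], rel {\<beta>})}" for xs R
      using that pp_rel_singleton[of \<alpha>] pp_rel_singleton[of \<beta>] by (auto simp: eval_nat_numeral)
  qed auto
qed

section \<open>Strict width as an extension property of constraint systems\<close>

definition extension_property :: "nat \<Rightarrow> nat \<Rightarrow> bool" where
  "extension_property k l \<longleftrightarrow> k \<le> l \<and> (\<forall>V C. csp_instance (relations_upto B l) V C \<and> minimal k l V C \<longrightarrow>
        (\<forall>W h. W \<subseteq> V \<and> partial_solution B C W h \<longrightarrow>
           (\<exists>g. solution B V C g \<and> (\<forall>x\<in>W. g x = h x))))"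

lemma bounded_strict_width_iff: "bounded_strict_width B \<longleftrightarrow> (\<exists>k l. extension_property k l)"
  unfolding bounded_strict_width_def strict_width_def extension_property_def by blast

lemma projection_map:
  assumes "set ys \<subseteq> set xs"
  shows "projection (xs, {map g xs | g. P g}) ys = (ys, {map g ys | g. P g})"
proof -
  have "map (\<lambda>y. the (map_of (zip xs (map g xs)) y)) ys = map g ys" for g :: "nat \<Rightarrow> 'b"
    using assms by (auto simp: map_of_zip_map)
  then have "{map (\<lambda>y. the (map_of (zip xs t) y)) ys | t. t \<in> {map g xs | g. P g}} = {map g ys | g. P g}"
    by (auto simp del: map_eq_conv) (metis (no_types, lifting))
  then show ?thesis by (simp add: projection_def)
qed

text \<open>Adding to a set of constraints the projections of its solution set to all sets of at most \<open>l\<close>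
  variables makes it \<open>(k, l)\<close>-minimal without changing the solutions.\<close>

lemma decomposition:
  fixes \<Phi> :: "(nat list \<times> 'a list set) set"
  assumes ext: "extension_property k l"
    and V: "finite V" "W \<subseteq> V" and h: "h ` W \<subseteq> U"
    and fin: "finite \<Phi>"
    and \<Phi>: "\<And>xs R. (xs, R) \<in> \<Phi> \<Longrightarrow> distinct xs \<and> set xs \<subseteq> V \<and> length xs \<le> l \<and> pp (length xs) R"
    and local: "\<And>X. X \<subseteq> W \<Longrightarrow> card X \<le> l \<Longrightarrow>
      \<exists>g. range g \<subseteq> U \<and> (\<forall>(xs, R)\<in>\<Phi>. map g xs \<in> R) \<and> (\<forall>x\<in>X. g x = h x)"
  obtains g where "g ` V \<subseteq> U" "\<And>xs R. (xs, R) \<in> \<Phi> \<Longrightarrow> map g xs \<in> R" "\<And>x. x \<in> W \<Longrightarrow> g x = h x"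
proof -
  define G where "G g \<longleftrightarrow> range g \<subseteq> U \<and> (\<forall>(xs, R)\<in>\<Phi>. map g xs \<in> R)" for g
  \<comment> \<open>Each constraint is the full projection of one solution set, so any two agree on
    all common variables, whatever \<open>k\<close> is.\<close>
  define c where "c X = (sorted_list_of_set X, {map g (sorted_list_of_set X) | g. G g})" for X
  define C where "C = c ` {X. X \<subseteq> V \<and> card X \<le> l}"
  have fX: "finite X" if "X \<subseteq> V" for X using that V(1) finite_subset by blast
  have pp: "pp (length xs) {map g xs | g. G g}" for xs
    by (rule pp_projection[OF fin]) (use \<Phi> in \<open>auto simp: G_def\<close>)
  have "csp_instance (relations_upto B l) V C"
    unfolding csp_instance_def
  proof (intro conjI ballI)
    show "finite C" using V(1) by (simp add: C_def)
    fix d assume "d \<in> C"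
    then obtain X where X: "X \<subseteq> V" "card X \<le> l" "d = c X" by (auto simp: C_def)
    define xs where "xs = sorted_list_of_set X"
    have xs: "set xs = X" "distinct xs" "length xs = card X" "d = (xs, {map g xs | g. G g})"
      using fX[OF X(1)] by (simp_all add: xs_def c_def X(3))
    then have "(length xs, {map g xs | g. G g}) \<in> relations_upto B l"
      using pp[of xs] X(2) unfolding relations_upto_def by auto
    then show "case d of (xs, R) \<Rightarrow> set xs \<subseteq> V \<and> distinct xs \<and> (length xs, R) \<in> relations_upto B l"
      using xs X(1) by simp
  qed (use V(1) in simp)
  moreover have "minimal k l V C"
    unfolding minimal_def
  proof (intro conjI allI impI ballI)
    fix X assume "X \<subseteq> V \<and> card X \<le> l"
    then show "\<exists>d\<in>C. X \<subseteq> set (fst d)"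
      using fX by (intro bexI[of _ "c X"]) (auto simp: C_def c_def)
  next
    fix X d e ys
    assume "d \<in> C" "e \<in> C" "X \<subseteq> set (fst d) \<and> X \<subseteq> set (fst e)" "distinct ys \<and> set ys = X"
    then show "projection d ys = projection e ys"
      by (auto simp: C_def c_def projection_map)
  qed
  moreover have "partial_solution B C W h"
    unfolding partial_solution_def
  proof (intro conjI ballI)
    fix d assume "d \<in> C"
    then obtain X where X: "X \<subseteq> V" "card X \<le> l" "d = c X" by (auto simp: C_def)
    define ys where "ys = filter (\<lambda>x. x \<in> W) (sorted_list_of_set X)"
    have "set ys \<subseteq> X \<inter> W" using fX[OF X(1)] by (auto simp: ys_def)
    \<comment> \<open>Scopes have at most \<open>l\<close> variables, so for a partial solution it
      is enough that \<open>h\<close> extends from every set of at most \<open>l\<close> elements of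
      \<open>W\<close>.\<close>
    moreover have "card (X \<inter> W) \<le> l" using card_mono[of X "X \<inter> W"] fX[OF X(1)] X(2) by auto
    then obtain g where g: "G g" "\<forall>x\<in>X \<inter> W. g x = h x"
      using local[of "X \<inter> W"] by (auto simp: G_def)
    ultimately have "map h ys = map g ys" by (auto simp: subset_eq)
    moreover have "projection d ys = (ys, {map g ys | g. G g})"
      unfolding X(3) c_def by (rule projection_map) (auto simp: ys_def)
    ultimately show "satisfies h (projection d (filter (\<lambda>x. x \<in> W) (fst d)))"
      using g(1) by (auto simp: satisfies_def X(3) c_def ys_def)
  qed (use h in simp)
  ultimately obtain g where g: "solution B V C g" "\<forall>x\<in>W. g x = h x"
    using ext V(2) unfolding extension_property_def by blast
  show thesis
  proof
    show "g ` V \<subseteq> U" using g(1) by (simp add: solution_def)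
    fix xs R assume xs: "(xs, R) \<in> \<Phi>"
    \<comment> \<open>The scope \<open>xs\<close> has at most \<open>l\<close> variables; hence its
      own projection is among the constraints and gives back \<open>R\<close>.\<close>
    then have "c (set xs) \<in> C" using \<Phi>[OF xs] card_length[of xs] by (auto simp: C_def)
    then have "map g (sorted_list_of_set (set xs)) \<in> {map g (sorted_list_of_set (set xs)) | g. G g}"
      using g(1) by (auto simp: solution_def satisfies_def c_def)
    then obtain g' where "G g'" "map g (sorted_list_of_set (set xs)) = map g' (sorted_list_of_set (set xs))"
      by auto
    then have "G g'" "map g xs = map g' xs" by auto
    then show "map g xs \<in> R" using xs by (auto simp: G_def simp del: map_eq_conv)
  qed (use g(2) in simp)
qed

text \<open>For smaller \<open>l\<close> the instance s(x, y), y = z, x = z would be minimal: every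
  pair of variables has its own scope, and all projections to single variables are full. The empty
  partial solution would then have to extend, although there is no solution. The bound allows
  ternary constraints in \<open>decomposition\<close>.\<close>

lemma width_ge_3:
  assumes "extension_property k l"
  shows "3 \<le> l"
proof (rule ccontr)
  assume "\<not> 3 \<le> l"
  then have l: "l \<le> 2" "k \<le> 2" using assms by (auto simp: extension_property_def)
  obtain t where t: "t \<in> neq_tps" using neq_tps_nonempty by blast
  then obtain a b where ab: "a \<in> U" "b \<in> U" "a \<noteq> b" unfolding neq_tps_def by blast
  obtain s where s: "s \<in> dom (sig A)" "lab a b = {s}" using lab_singleton ab by metis
  have ne: "[x, x] \<notin> interp A s" for x using lab_refl[of x] s(1) unfolding lab_def by blast
  define E where "E = {[x, x] | x. x \<in> U}"
  define C where "C = {([0::nat, 1], interp A s), ([1, 2], E), ([0, 2], E)}"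
  have ab_s: "[a, b] \<in> interp A s" using s by (auto simp: lab_def)
  have shape: "\<exists>x y. xs = [x, y] \<and> x \<in> U \<and> y \<in> U" if "xs \<in> interp A s" for xs
    using pp_definable_tuple[OF pp_interp[OF s(1)] that]
    by (cases xs; cases "tl xs") (auto simp: length_Suc_conv numeral_2_eq_2)
  have left: "\<exists>y. [x, y] \<in> interp A s" if x: "x \<in> U" for x
  proof -
    obtain y where y: "y \<in> U" "tp x y = tp a b" using ex_tp[OF x, of "tp a b"] ab by (auto simp: tps_def)
    then have "lab x y = {s}" using s by (simp add: tp_def)
    then show ?thesis by (auto simp: lab_def)
  qed
  have right: "\<exists>x. [x, y] \<in> interp A s" if y: "y \<in> U" for y
  proof -
    obtain x where x: "x \<in> U" "tp x y = tp a b" using ex_tp'[OF y, of "tp a b"] ab by (auto simp: tps_def)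
    then have "lab x y = {s}" using s by (simp add: tp_def)
    then show ?thesis by (auto simp: lab_def)
  qed
  have "sig B s = Some 2" "interp B s = interp A s"
    using expansion sig_A[OF s(1)] s(1) unfolding fo_expansion_def map_le_def by auto
  then have "(2, interp A s) \<in> relations_upto B l" "(2, E) \<in> relations_upto B l"
    unfolding relations_upto_def relations_def E_def by (simp_all, metis)
  then have "csp_instance (relations_upto B l) {0, 1, 2} C"
    by (auto simp: csp_instance_def C_def numeral_2_eq_2)
  moreover have "minimal k l {0, 1, 2} C"
    unfolding minimal_def
  proof (intro conjI allI impI)
    fix X :: "nat set" assume X: "X \<subseteq> {0, 1, 2} \<and> card X \<le> l"
    have "X \<noteq> {0, 1, 2}"
    proof
      assume "X = {0, 1, 2}"
      then have "card X = 3" by simp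
      then show False using X l by linarith
    qed
    then have "X \<subseteq> {0, 1} \<or> X \<subseteq> {1, 2} \<or> X \<subseteq> {0, 2}" using X by blast
    then show "\<exists>c\<in>C. X \<subseteq> set (fst c)" by (auto simp: C_def)
  next
    fix X :: "nat set" assume X: "X \<subseteq> {0, 1, 2} \<and> card X \<le> k"
    have fin: "finite X" using X finite_subset by blast
    have two: "set (fst c) = set (fst d) \<longrightarrow> c = d" if "c \<in> C" "d \<in> C" for c d
      using that by (auto simp: C_def doubleton_eq_iff)
    have card2: "card (set (fst c)) = 2" if "c \<in> C" for c using that by (auto simp: C_def)
    show "\<forall>c\<in>C. \<forall>d\<in>C. X \<subseteq> set (fst c) \<and> X \<subseteq> set (fst d) \<longrightarrow>
        (\<forall>ys. distinct ys \<and> set ys = X \<longrightarrow> projection c ys = projection d ys)"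
    proof (intro ballI impI allI)
      fix c d ys
      assume cd: "c \<in> C" "d \<in> C" "X \<subseteq> set (fst c) \<and> X \<subseteq> set (fst d)" "distinct ys \<and> set ys = X"
      show "projection c ys = projection d ys"
      proof (cases "card X = 2")
        case True
        then have "set (fst c) = X" "set (fst d) = X"
          using cd card2 card_subset_eq[of "set (fst c)" X] card_subset_eq[of "set (fst d)" X] by auto
        then show ?thesis using two cd by metis
      next
        case False
        have "card X \<le> 2" using X l by auto
        then have "length ys = 0 \<or> length ys = 1"
          using False cd(4) distinct_card[of ys] by (cases "length ys") auto
        then consider "ys = []" | x where "ys = [x]" by (auto simp: length_Suc_conv)
        then show ?thesis
        proof cases
          case 1
          have "projection e ys = ([], {[]})" if "e \<in> C" for e
            using that ab_s ab(1) unfolding C_def projection_def 1 E_def by auto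
          then show ?thesis using cd by simp
        next
          case 2
          have "projection e ys = ([x], {[z] | z. z \<in> U})" if e: "e \<in> C" "x \<in> set (fst e)" for e
          proof -
            have proj_s: "{map (\<lambda>y. the (map_of (zip [p, q] t) y)) [x] | t. t \<in> interp A s} = {[z] | z. z \<in> U}"
              if "x = p \<or> x = q" "p \<noteq> q" for p q :: nat
            proof (intro equalityI subsetI)
              fix r assume "r \<in> {map (\<lambda>y. the (map_of (zip [p, q] t) y)) [x] | t. t \<in> interp A s}"
              then obtain t where t: "t \<in> interp A s" "r = map (\<lambda>y. the (map_of (zip [p, q] t) y)) [x]" by auto
              obtain u v where "t = [u, v]" "u \<in> U" "v \<in> U" using shape[OF t(1)] by blast
              then show "r \<in> {[z] | z. z \<in> U}" using t(2) that by auto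
            next
              fix r assume "r \<in> {[z] | z. z \<in> U}"
              then obtain z where z: "r = [z]" "z \<in> U" by auto
              obtain y y' where "[z, y] \<in> interp A s" "[y', z] \<in> interp A s"
                using left[OF z(2)] right[OF z(2)] by blast
              then show "r \<in> {map (\<lambda>y. the (map_of (zip [p, q] t) y)) [x] | t. t \<in> interp A s}"
                using that z(1)
                by (auto intro: exI[of _ "[z, y]"] exI[of _ "[y', z]"])
            qed
            have proj_E: "{map (\<lambda>y. the (map_of (zip [p, q] t) y)) [x] | t. t \<in> E} = {[z] | z. z \<in> U}"
              if "x = p \<or> x = q" "p \<noteq> q" for p q :: nat
              using that unfolding E_def by (auto intro: exI[of _ "[z, z]" for z])
            obtain p q S where S: "e = ([p, q], S)" "S = interp A s \<or> S = E" "p \<noteq> q" "x = p \<or> x = q"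
              using e unfolding C_def by fastforce
            have "{map (\<lambda>y. the (map_of (zip [p, q] t) y)) [x] | t. t \<in> S} = {[z] | z. z \<in> U}"
              using S(2)
            proof
              assume "S = interp A s"
              then show ?thesis using proj_s[OF S(4,3)] by (simp only:)
            next
              assume "S = E"
              then show ?thesis using proj_E[OF S(4,3)] by (simp only:)
            qed
            then show ?thesis unfolding projection_def 2 S(1) by simp
          qed
          moreover have "x \<in> set (fst c)" "x \<in> set (fst d)" using cd(3,4) 2 by auto
          ultimately show ?thesis using cd(1,2) by simp
        qed
      qed
    qed
  qed
  moreover have "partial_solution B C {} (\<lambda>_. a)"
    using ab_s ab(1) unfolding partial_solution_def satisfies_def projection_def C_def E_def by auto
  ultimately obtain g where "solution B {0, 1, 2} C g"
    using assms unfolding extension_property_def by blast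
  then show False using ne by (auto simp: solution_def satisfies_def C_def E_def)
qed

text \<open>The chain \<open>o1(w\<^sub>0, u\<^sub>0)\<close>, \<open>T(w\<^sub>i, u\<^sub>i, u\<^bsub>i+1\<^esub>)\<close>, \<open>o2(w\<^sub>l, u\<^sub>l)\<close> has no solution in which all
  \<open>w\<^sub>i\<close> are equal, but it has one if a single \<open>w\<^sub>j\<close> is allowed to differ. The variables \<open>w\<^sub>i\<close> and
  \<open>u\<^sub>i\<close> are encoded as \<open>2 i\<close> and \<open>2 i + 1\<close>.\<close>

lemma no_propagating_ternary_relation:
  assumes ext: "extension_property k l" and T: "pp 3 T"
    and oo: "o1 \<in> tps" "o2 \<in> tps" "o1 \<in> C" "o2 \<notin> C"
    and propagates: "\<And>x y z. [x, y, z] \<in> T \<Longrightarrow> tp x y \<in> C \<Longrightarrow> tp x z \<in> C"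
    and full: "\<And>x y z t. x \<in> U \<Longrightarrow> y \<in> U \<Longrightarrow> z \<in> U \<Longrightarrow> t \<in> {o1, o2} \<Longrightarrow>
      tp x y = t \<Longrightarrow> tp x z = t \<Longrightarrow> [x, y, z] \<in> T"
  shows False
proof -
  have l: "3 \<le> l" by (rule width_ge_3[OF ext])
  define \<Phi> where "\<Phi> = {([0::nat, 1], rel {o1}), ([2 * l, 2 * l + 1], rel {o2})} \<union>
    (\<lambda>i. ([2 * i, 2 * i + 1, 2 * i + 3], T)) ` {..<l}"
  define W where "W = (\<lambda>i::nat. 2 * i) ` {..l}"
  obtain b where b: "b \<in> U" using univ_nonempty by blast
  obtain u where u: "u \<in> U" "tp b u = o1" using ex_tp[OF b oo(1)] by metis
  obtain u' where u': "u' \<in> U" "tp b u' = o2" using ex_tp[OF b oo(2)] by metis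
  have "u \<noteq> u'" using u u' oo by auto
  have card_W: "card W = Suc l" unfolding W_def by (subst card_image) (auto simp: inj_on_def)
  have local: "\<exists>g. range g \<subseteq> U \<and> (\<forall>(xs, R)\<in>\<Phi>. map g xs \<in> R) \<and> (\<forall>x\<in>X. g x = b)"
    if X: "X \<subseteq> W" "card X \<le> l" for X
  proof -
    have "X \<noteq> W" using X card_W by auto
    then obtain j where j: "j \<le> l" "2 * j \<notin> X" using X(1) unfolding W_def by auto
    \<comment> \<open>\<open>c\<close> is the value of the exceptional \<open>w j\<close>. The
      \<open>u i\<close> take the value \<open>p\<close> up to \<open>j\<close> and \<open>q\<close>
      afterwards, so that their type over \<open>b\<close> switches from \<open>o1\<close> to
      \<open>o2\<close> exactly at the exceptional place.\<close>
    have "\<exists>c p q. c \<in> U \<and> p \<in> U \<and> q \<in> U \<and> (0 < j \<longrightarrow> tp b p = o1) \<and> (j < l \<longrightarrow> tp b q = o2) \<and>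
        (j = 0 \<longrightarrow> tp c p = o1) \<and> (j = l \<longrightarrow> tp c p = o2) \<and>
        (j < l \<longrightarrow> (\<exists>t\<in>{o1, o2}. tp c p = t \<and> tp c q = t))"
    proof -
      consider "j = 0" | "j = l" | "0 < j" "j < l" using j(1) by linarith
      then show ?thesis
      proof cases
        case 1
        obtain c where "c \<in> U" "tp c u' = o1" using ex_tp'[OF u'(1) oo(1)] by metis
        then show ?thesis using 1 u' l by (intro exI[of _ c] exI[of _ u']) auto
      next
        case 2
        obtain c where "c \<in> U" "tp c u = o2" using ex_tp'[OF u(1) oo(2)] by metis
        then show ?thesis using 2 u l by (intro exI[of _ c] exI[of _ u]) auto
      next
        case 3
        \<comment> \<open>Since \<open>u\<close> and \<open>u'\<close> differ, the type that
          \<open>c\<close> has to both of them must not be equality.\<close>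
        have "o1 \<in> neq_tps \<or> o2 \<in> neq_tps" using oo tps_cases by metis
        then obtain t where t: "t \<in> {o1, o2}" "t \<in> neq_tps" by blast
        obtain c where "c \<in> U" "tp u c = prod.swap t" "tp u' c = prod.swap t"
          using extend_by_one[of "[u, u']" "\<lambda>_. prod.swap t"] u u' swap_neq_tps[OF t(2)] by auto
        then have "c \<in> U" "tp c u = t" "tp c u' = t" using tp_swap[of c] by auto
        then show ?thesis using 3 u u' t(1) by (intro exI[of _ c] exI[of _ u] exI[of _ u']) auto
      qed
    qed
    then obtain c p q where c: "c \<in> U" "p \<in> U" "q \<in> U" "0 < j \<Longrightarrow> tp b p = o1" "j < l \<Longrightarrow> tp b q = o2"
        "j = 0 \<Longrightarrow> tp c p = o1" "j = l \<Longrightarrow> tp c p = o2"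
        "j < l \<Longrightarrow> \<exists>t\<in>{o1, o2}. tp c p = t \<and> tp c q = t"
      by blast
    define w where "w i = (if i = j then c else b)" for i
    define v where "v i = (if i \<le> j then p else q)" for i
    define g where "g m = (if even m then w (m div 2) else v (m div 2))" for m
    have g: "g (2 * i) = w i" "g (Suc (2 * i)) = v i" "g (2 * i + 3) = v (Suc i)" for i
      by (auto simp: g_def)
    have "[w i, v i, v (Suc i)] \<in> T" if i: "i < l" for i
    proof -
      have "\<exists>t\<in>{o1, o2}. tp (w i) (v i) = t \<and> tp (w i) (v (Suc i)) = t"
        using c(4,5,8) j(1) i by (cases i j rule: linorder_cases) (auto simp: w_def v_def)
      moreover have "w i \<in> U" "v i \<in> U" "v (Suc i) \<in> U" using b c by (auto simp: w_def v_def)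
      ultimately show ?thesis using full by blast
    qed
    moreover have "tp (w 0) (v 0) = o1" using c by (auto simp: w_def v_def)
    moreover have "tp (w l) (v l) = o2" using c j(1) by (auto simp: w_def v_def)
    moreover have "w i \<in> U" "v i \<in> U" for i using b c by (auto simp: w_def v_def)
    moreover have "g 0 = w 0" "g 1 = v 0" using g(1,2)[of 0] by auto
    ultimately have "\<forall>(xs, R)\<in>\<Phi>. map g xs \<in> R" by (auto simp: \<Phi>_def rel_iff g)
    moreover have "range g \<subseteq> U" using b c by (auto simp: g_def w_def v_def)
    moreover have "g x = b" if "x \<in> X" for x
    proof -
      from that X(1) have "x \<in> W" by blast
      then obtain i where "x = 2 * i" by (auto simp: W_def)
      then show ?thesis using that j(2) by (auto simp: g w_def)
    qed
    ultimately show ?thesis by blast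
  qed
  obtain g where g: "g ` {..2 * l + 1} \<subseteq> U" "\<And>xs R. (xs, R) \<in> \<Phi> \<Longrightarrow> map g xs \<in> R" "\<And>x. x \<in> W \<Longrightarrow> g x = b"
  proof (rule decomposition[OF ext, of "{..2 * l + 1}" W "\<lambda>_. b" \<Phi>])
    show "W \<subseteq> {..2 * l + 1}" by (auto simp: W_def)
    show "finite \<Phi>" by (simp add: \<Phi>_def)
    show "distinct xs \<and> set xs \<subseteq> {..2 * l + 1} \<and> length xs \<le> l \<and> pp (length xs) R"
      if "(xs, R) \<in> \<Phi>" for xs R
      using that l T pp_rel_singleton[of o1] pp_rel_singleton[of o2] oo
      by (auto simp: \<Phi>_def eval_nat_numeral)
  qed (use local b in auto)
  have wb: "g (2 * i) = b" if "i \<le> l" for i using g(3) that by (simp add: W_def)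
  have "tp b (g (2 * i + 1)) \<in> C" if "i \<le> l" for i
    using that
  proof (induction i)
    case 0
    have "[g 0, g 1] \<in> rel {o1}" using g(2)[of "[0, 1]"] by (simp add: \<Phi>_def)
    then show ?case using wb[of 0] oo by (simp add: rel_iff)
  next
    case (Suc i)
    have "[g (2 * i), g (2 * i + 1), g (2 * i + 3)] \<in> T"
      using g(2)[of "[2 * i, 2 * i + 1, 2 * i + 3]"] Suc.prems by (auto simp: \<Phi>_def)
    moreover have "2 * Suc i + 1 = 2 * i + 3" by simp
    ultimately show ?case using propagates Suc wb[of i] by (metis Suc_leD)
  qed
  moreover have "[g (2 * l), g (2 * l + 1)] \<in> rel {o2}"
    using g(2)[of "[2 * l, 2 * l + 1]"] by (simp add: \<Phi>_def)
  ultimately show False using wb[of l] oo by (auto simp: rel_iff)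
qed


section \<open>Propagation between pairs\<close>

lemma extend_by_types:
  assumes "length ps \<le> 5" "distinct (map fst ps)" "\<forall>(x, t)\<in>set ps. x \<in> U \<and> t \<in> neq_tps"
  shows "\<exists>z\<in>U. z \<notin> fst ` set ps \<and> (\<forall>(x, t)\<in>set ps. tp x z = t)"
proof -
  have m: "the (map_of ps x) = t" if "(x, t) \<in> set ps" for x t
    using that assms(2) by simp
  have "\<exists>z\<in>U. z \<notin> set (map fst ps) \<and> (\<forall>x\<in>set (map fst ps). tp x z = the (map_of ps x))"
  proof (rule extend_by_one)
    show "\<forall>x\<in>set (map fst ps). the (map_of ps x) \<in> neq_tps"
    proof
      fix x assume "x \<in> set (map fst ps)"
      then obtain t where "(x, t) \<in> set ps" by auto
      then show "the (map_of ps x) \<in> neq_tps" using m[of x t] assms(3) by auto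
    qed
  qed (use assms in auto)
  then obtain z where z: "z \<in> U" "z \<notin> fst ` set ps" "\<forall>x\<in>fst ` set ps. tp x z = the (map_of ps x)"
    by auto
  then have "tp x z = t" if "(x, t) \<in> set ps" for x t
    using m[OF that] that by (metis fst_conv imageI)
  then show ?thesis using z(1,2) by blast
qed

lemma pp_transfer4:
  assumes Q: "pp 4 Q" and mem: "[a, b, c, d] \<in> Q" and U: "{a', b', c', d'} \<subseteq> U"
    and eq: "tp a b = tp a' b'" "tp a c = tp a' c'" "tp a d = tp a' d'"
      "tp b c = tp b' c'" "tp b d = tp b' d'" "tp c d = tp c' d'"
  shows "[a', b', c', d'] \<in> Q"
proof (rule pp_definable_transfer[OF Q mem])
  have sw: "tp y x = tp y' x'" if "tp x y = tp x' y'" for x y x' y'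
    using that tp_swap[where a = x and b = y] tp_swap[where a = x' and b = y'] by simp
  fix i j :: nat assume "i < 4" "j < 4"
  then have "i = 0 \<or> i = 1 \<or> i = 2 \<or> i = 3" "j = 0 \<or> j = 1 \<or> j = 2 \<or> j = 3" by linarith+
  then show "tp ([a, b, c, d] ! i) ([a, b, c, d] ! j) = tp ([a', b', c', d'] ! i) ([a', b', c', d'] ! j)"
    using eq eq[THEN sw] by (elim disjE) simp_all
qed (use U in auto)

text \<open>Ordinary relational composition, with a quaternary relation read as a binary relation
  between pairs.\<close>

definition comp_rel :: "'a list set \<Rightarrow> 'a list set \<Rightarrow> 'a list set" where
  "comp_rel Q Q' = {[a, b, e, f] | a b e f. \<exists>c d. [a, b, c, d] \<in> Q \<and> [c, d, e, f] \<in> Q'}"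

lemma comp_rel_iff:
  "[a, b, e, f] \<in> comp_rel Q Q' \<longleftrightarrow> (\<exists>c d. [a, b, c, d] \<in> Q \<and> [c, d, e, f] \<in> Q')"
  by (simp add: comp_rel_def)

lemma pp_comp_rel:
  assumes "pp 4 Q" "pp 4 Q'"
  shows "pp 4 (comp_rel Q Q')"
proof (rule pp_projection[where \<Phi> = "{([0, 1, 2, 3], Q), ([2, 3, 4, 5], Q')}" and ys = "[0, 1, 4, 5]"])
  show "comp_rel Q Q' = {map g [0::nat, 1, 4, 5] | g. range g \<subseteq> U \<and>
      (\<forall>(xs, R)\<in>{([0, 1, 2, 3], Q), ([2, 3, 4, 5], Q')}. map g xs \<in> R)}" (is "?L = ?R")
  proof (intro equalityI subsetI)
    fix xs assume "xs \<in> ?L"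
    then obtain a b c d e f where xs: "xs = [a, b, e, f]" "[a, b, c, d] \<in> Q" "[c, d, e, f] \<in> Q'"
      by (auto simp: comp_rel_def)
    then have "set [a, b, c, d, e, f] \<subseteq> U" using pp_subset[OF assms(1)] pp_subset[OF assms(2)] by force
    then show "xs \<in> ?R" using range_pick[of "[a, b, c, d, e, f]" U] xs
      by (intro CollectI exI[of _ "pick [a, b, c, d, e, f]"]) simp
  next
    fix xs assume "xs \<in> ?R"
    then obtain g where "xs = [g (0::nat), g 1, g 4, g 5]" "[g 0, g 1, g 2, g 3] \<in> Q" "[g 2, g 3, g 4, g 5] \<in> Q'"
      by (auto simp del: One_nat_def)
    then show "xs \<in> ?L" by (auto simp: comp_rel_def)
  qed
qed (use assms in \<open>auto simp: eval_nat_numeral\<close>)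

lemma pp_swap:
  assumes "pp 4 Q"
  shows "pp 4 {[b, a, d, c] | a b c d. [a, b, c, d] \<in> Q}"
proof (rule pp_projection[where \<Phi> = "{([0, 1, 2, 3], Q)}" and ys = "[1, 0, 3, 2]"])
  show "{[b, a, d, c] | a b c d. [a, b, c, d] \<in> Q} = {map g [1::nat, 0, 3, 2] | g. range g \<subseteq> U \<and>
      (\<forall>(xs, R)\<in>{([0, 1, 2, 3], Q)}. map g xs \<in> R)}" (is "?L = ?R")
  proof (intro equalityI subsetI)
    fix xs assume "xs \<in> ?L"
    then obtain a b c d where xs: "xs = [b, a, d, c]" "[a, b, c, d] \<in> Q" by auto
    then show "xs \<in> ?R" using range_pick[of "[a, b, c, d]" U] pp_subset[OF assms xs(2)]
      by (intro CollectI exI[of _ "pick [a, b, c, d]"]) simp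
  next
    fix xs assume "xs \<in> ?R"
    then obtain g where "xs = [g (1::nat), g 0, g 3, g 2]" "[g 0, g 1, g 2, g 3] \<in> Q"
      by (auto simp del: One_nat_def)
    then show "xs \<in> ?L" by auto
  qed
qed (use assms in \<open>auto simp: eval_nat_numeral\<close>)

text \<open>A loop of \<open>Q\<close> comes with fixed types between its two pairs. Going through
  an intermediate pair that sees both outer pairs in the prescribed way leaves the types between the
  outer pairs arbitrary; this is what \<open>S\<close> is for. Passing from \<open>(x, y)\<close> to
  another pair and back to \<open>(x, z)\<close>, as in \<open>T\<close>, gives the common first
  element.\<close>

lemma no_propagating_relation:
  assumes ext: "extension_property k l" and Q: "pp 4 Q" and o12: "o1 \<in> C" "o2 \<notin> C"
    and propagates: "\<And>a b c d. [a, b, c, d] \<in> Q \<Longrightarrow> tp a b \<in> C \<Longrightarrow> tp c d \<in> C"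
    and loops: "\<And>t. t \<in> {o1, o2} \<Longrightarrow> \<exists>a b c d. [a, b, c, d] \<in> Q \<and> tp a b = t \<and> tp c d = t \<and>
      (a = b \<or> c \<notin> {a, b} \<and> d \<notin> {a, b} \<or> c = a \<and> d \<noteq> b)"
  shows False
proof -
  define S where "S = comp_rel Q Q"
  have S: "pp 4 S" unfolding S_def using pp_comp_rel Q by blast
  have prop_S: "tp c d \<in> C" if "[a, b, c, d] \<in> S" "tp a b \<in> C" for a b c d
    using that propagates unfolding S_def comp_rel_iff by blast
  define T where "T = {[x, y, z] | x y z. \<exists>p q. [x, y, p, q] \<in> S \<and> [p, q, x, z] \<in> S}"
  have T_iff: "[x, y, z] \<in> T \<longleftrightarrow> (\<exists>p q. [x, y, p, q] \<in> S \<and> [p, q, x, z] \<in> S)" for x y z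
    by (simp add: T_def)
  have T: "pp 3 T"
  proof (rule pp_projection[where \<Phi> = "{([0, 1, 3, 4], S), ([3, 4, 0, 2], S)}" and ys = "[0, 1, 2]"])
    show "T = {map g [0::nat, 1, 2] | g. range g \<subseteq> U \<and>
        (\<forall>(xs, R)\<in>{([0, 1, 3, 4], S), ([3, 4, 0, 2], S)}. map g xs \<in> R)}" (is "?L = ?R")
    proof (intro equalityI subsetI)
      fix xs assume "xs \<in> ?L"
      then obtain x y z p q where xs: "xs = [x, y, z]" "[x, y, p, q] \<in> S" "[p, q, x, z] \<in> S"
        by (auto simp: T_def)
      then have "set [x, y, z, p, q] \<subseteq> U" using pp_subset[OF S] by force
      then show "xs \<in> ?R" using range_pick[of "[x, y, z, p, q]" U] xs
        by (intro CollectI exI[of _ "pick [x, y, z, p, q]"]) simp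
    next
      fix xs assume "xs \<in> ?R"
      then obtain g where "xs = [g (0::nat), g 1, g 2]" "[g 0, g 1, g 3, g 4] \<in> S" "[g 3, g 4, g 0, g 2] \<in> S"
        by (auto simp del: One_nat_def)
      then show "xs \<in> ?L" by (auto simp: T_def)
    qed
  qed (use S in \<open>auto simp: eval_nat_numeral\<close>)
  have full: "[x, y, z] \<in> T"
    if xyz: "x \<in> U" "y \<in> U" "z \<in> U" and t: "t \<in> {o1, o2}" "tp x y = t" "tp x z = t" for x y z t
  proof -
    obtain a b c d where abcd: "[a, b, c, d] \<in> Q" "tp a b = t" "tp c d = t"
      and pat: "a = b \<or> c \<notin> {a, b} \<and> d \<notin> {a, b} \<or> c = a \<and> d \<noteq> b"
      using loops[OF t(1)] by blast
    have U: "a \<in> U" "b \<in> U" "c \<in> U" "d \<in> U" using pp_subset[OF Q abcd(1)] by auto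
    note tr = pp_transfer4[OF Q abcd(1)]
    have swapped: "tp v u = tp v' u'" if "tp u v = tp u' v'" for u v u' v'
      using that tp_swap[where a = u and b = v] tp_swap[where a = u' and b = v'] by simp
    show ?thesis
    proof (cases "a = b")
      case True
      then have "x = y" "x = z" "c = d" using t abcd xyz U tp_eq_iff tp_refl by metis+
      show ?thesis
      proof (cases "c = a")
        case True
        then have "[x, x, x, x] \<in> Q" using tr[of x x x x] xyz \<open>a = b\<close> \<open>c = d\<close> by simp
        then have "[x, x, x, x] \<in> S" unfolding S_def comp_rel_iff by blast
        then show ?thesis using \<open>x = y\<close> \<open>x = z\<close> unfolding T_iff by blast
      next
        case False
        have far: "[u, u, p, p] \<in> S" if up: "u \<in> U" "p \<in> U" "u \<noteq> p" for u p
        proof -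
          obtain v where v: "v \<in> U" "tp u v = tp a c" "tp p v = tp c a"
            using extend_by_types[of "[(u, tp a c), (p, tp c a)]"] up U False
              neq_tps_I[of a c] neq_tps_I[of c a] by auto
          have "[u, u, v, v] \<in> Q"
            by (rule tr) (use v up \<open>a = b\<close> \<open>c = d\<close> in simp_all)
          moreover have "[v, v, p, p] \<in> Q"
            by (rule tr) (use v(1) swapped[OF v(3)] up \<open>a = b\<close> \<open>c = d\<close> in simp_all)
          ultimately show ?thesis unfolding S_def comp_rel_iff by blast
        qed
        obtain s where "s \<in> neq_tps" using neq_tps_nonempty by blast
        then obtain p where "p \<in> U" "p \<noteq> x" using extend_by_one[of "[x]" "\<lambda>_. s"] xyz by auto
        then have "[x, x, p, p] \<in> S" "[p, p, x, x] \<in> S" using far xyz by auto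
        then show ?thesis using \<open>x = y\<close> \<open>x = z\<close> unfolding T_iff by blast
      qed
    next
      case False
      then have tn: "t \<in> neq_tps" using abcd U neq_tps_I by blast
      then have ne: "u \<noteq> v" if "tp u v = t" for u v using that eq_tp_notin tp_refl by metis
      have xy: "x \<noteq> y" "x \<noteq> z" "c \<noteq> d" using ne t abcd by auto
      consider (fresh) "c \<notin> {a, b}" "d \<notin> {a, b}" | (keep) "c = a" "d \<noteq> b" using pat False by blast
      then show ?thesis
      proof cases
        case fresh
        have far: "[x, y, p, q] \<in> S"
          if xyU: "x \<in> U" "y \<in> U" "p \<in> U" "q \<in> U" and txy: "tp x y = t" "tp p q = t"
            and disj: "p \<notin> {x, y}" "q \<notin> {x, y}" for x y p q
        proof -
          have ds: "x \<noteq> y" "p \<noteq> q" using ne txy by auto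
          \<comment> \<open>\<open>v\<close> and \<open>w\<close> play the roles of \<open>c\<close>
            and \<open>d\<close> after \<open>(x, y)\<close> and those of \<open>a\<close> and
            \<open>b\<close> before \<open>(p, q)\<close>, whence the reversed types such as
            \<open>tp c a\<close> over \<open>p\<close>.\<close>
          have "\<exists>v\<in>U. v \<notin> {x, y, p, q} \<and> tp x v = tp a c \<and> tp y v = tp b c \<and> tp p v = tp c a \<and> tp q v = tp d a"
            using extend_by_types[of "[(x, tp a c), (y, tp b c), (p, tp c a), (q, tp d a)]"] xyU ds disj U
              fresh neq_tps_I[of a c] neq_tps_I[of b c] neq_tps_I[of c a] neq_tps_I[of d a] by auto
          then obtain v where v: "v \<in> U" "v \<notin> {x, y, p, q}" "tp x v = tp a c" "tp y v = tp b c"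
            "tp p v = tp c a" "tp q v = tp d a" by blast
          \<comment> \<open>A one-point extension over five points, the most that liberality
            allows.\<close>
          have "\<exists>w\<in>U. tp x w = tp a d \<and> tp y w = tp b d \<and> tp p w = tp c b \<and> tp q w = tp d b \<and> tp v w = t"
            using extend_by_types[of "[(x, tp a d), (y, tp b d), (p, tp c b), (q, tp d b), (v, t)]"]
              xyU ds disj U fresh v(1,2) tn
              neq_tps_I[of a d] neq_tps_I[of b d] neq_tps_I[of c b] neq_tps_I[of d b] by auto
          then obtain w where w: "w \<in> U" "tp x w = tp a d" "tp y w = tp b d"
            "tp p w = tp c b" "tp q w = tp d b" "tp v w = t" by blast
          have "[x, y, v, w] \<in> Q" by (rule tr) (use xyU v w abcd txy in simp_all)
          moreover have "[v, w, p, q] \<in> Q"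
            by (rule tr) (use xyU v(1) w(1,6) abcd txy swapped[OF v(5)] swapped[OF v(6)]
              swapped[OF w(4)] swapped[OF w(5)] in simp_all)
          ultimately show ?thesis unfolding S_def comp_rel_iff by blast
        qed
        obtain p where p: "p \<in> U" "p \<notin> {x, y, z}"
          using extend_by_one[of "[x, y, z]" "\<lambda>_. t"] xyz tn by auto
        obtain q where q: "q \<in> U" "q \<notin> {x, y, z}" "tp p q = t"
          using extend_by_one[of "[x, y, z, p]" "\<lambda>_. t"] xyz tn p by auto
        have "[x, y, p, q] \<in> S" "[p, q, x, z] \<in> S" using far xyz t p q by auto
        then show ?thesis unfolding T_iff by blast
      next
        case keep
        have far: "[x, y, x, z] \<in> S"
          if xyU: "y \<in> U" "z \<in> U" and txy: "tp x y = t" "tp x z = t" and disj: "y \<noteq> z" for y z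
        proof -
          have ds: "x \<noteq> y" "x \<noteq> z" using ne txy by auto
          have "\<exists>v\<in>U. tp x v = t \<and> tp y v = tp b d \<and> tp z v = tp d b"
            using extend_by_types[of "[(x, t), (y, tp b d), (z, tp d b)]"]
              xyU xyz ds disj U keep tn neq_tps_I[of b d] neq_tps_I[of d b] by auto
          then obtain v where v: "v \<in> U" "tp x v = t" "tp y v = tp b d" "tp z v = tp d b" by blast
          have ad: "tp a d = t" using abcd(3) keep(1) by simp
          have "[x, y, x, v] \<in> Q"
            by (rule tr) (use xyz(1) xyU v txy abcd(2) ad keep(1) swapped[OF trans[OF txy(1) abcd(2)[symmetric]]] in simp_all)
          moreover have "[x, v, x, z] \<in> Q"
            by (rule tr) (use xyz(1) xyU v(1,2) txy abcd(2) ad keep(1) swapped[OF v(4)]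
              swapped[OF trans[OF v(2) abcd(2)[symmetric]]] in simp_all)
          ultimately
          show ?thesis unfolding S_def comp_rel_iff by blast
        qed
        \<comment> \<open>\<open>far\<close> needs distinct second components; the detour through a
          new \<open>w\<close> also covers \<open>y = z\<close>.\<close>
        obtain w where w: "w \<in> U" "w \<notin> {x, y, z}" "tp x w = t"
          using extend_by_one[of "[x, y, z]" "\<lambda>_. t"] xyz tn by auto
        have "[x, y, x, w] \<in> S" "[x, w, x, z] \<in> S" using far[of y w] far[of w z] xyz w t by auto
        then show ?thesis unfolding T_iff by blast
      qed
    qed
  qed
  have tps12: "o1 \<in> tps" "o2 \<in> tps"
    using loops[of o1] loops[of o2] pp_subset[OF Q] unfolding tps_def by fastforce+
  have prop_T: "tp x z \<in> C" if "[x, y, z] \<in> T" "tp x y \<in> C" for x y z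
    using that prop_S unfolding T_iff by blast
  show False by (rule no_propagating_ternary_relation[OF ext T tps12 o12 prop_T full])
qed

section \<open>Overlap patterns of two pairs\<close>

text \<open>\<open>pattern None a b c d\<close> means that \<open>c\<close> and \<open>d\<close> are new; \<open>pattern (Some (i, j)) a b c d\<close> that
  exactly one element is kept, where \<open>True\<close> stands for the first and \<open>False\<close> for the second
  component of a pair.\<close>

definition sel :: "bool \<Rightarrow> 'b \<Rightarrow> 'b \<Rightarrow> 'b" where
  "sel i a b = (if i then a else b)"

definition pattern :: "(bool \<times> bool) option \<Rightarrow> 'b \<Rightarrow> 'b \<Rightarrow> 'b \<Rightarrow> 'b \<Rightarrow> bool" where
  "pattern p a b c d = (case p of None \<Rightarrow> c \<notin> {a, b} \<and> d \<notin> {a, b}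
     | Some (i, j) \<Rightarrow> sel j c d = sel i a b \<and> sel (\<not> j) c d \<notin> {a, b})"

text \<open>An element shared by the outer pairs of a free composition must survive both steps: the
  position where the first step puts it has to be the one from which the second step takes
  it.\<close>

definition pattern_comp :: "(bool \<times> bool) option \<Rightarrow> (bool \<times> bool) option \<Rightarrow> (bool \<times> bool) option" where
  "pattern_comp p q = (case (p, q) of (Some (i, j), Some (k, m)) \<Rightarrow> if j = k then Some (i, m) else None
     | _ \<Rightarrow> None)"

text \<open>\<open>pattern_comp p p\<close> is \<open>None\<close> or keeps an element in its own
  position. Because it is idempotent, relations with this pattern can be composed without changing
  it.\<close>

lemma pattern_comp_square: "pattern_comp (pattern_comp p p) (pattern_comp p p) = pattern_comp p p"
  by (auto simp: pattern_comp_def split: option.splits)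

text \<open>Free amalgamation over \<open>(c, d)\<close>: the copy of \<open>(e', f')\<close> meets
  the old elements only where the tuple of \<open>Q'\<close> forces it. Types over elements outside
  the tuple of \<open>Q'\<close> are immaterial and set to an arbitrary \<open>s\<close>. Adding
  \<open>f\<close> after \<open>e\<close> is a one-point extension over up to five points.\<close>

lemma glue_tuples:
  assumes Q': "pp 4 Q'" and U: "{a, b, c, d} \<subseteq> U" "a \<noteq> b" "c \<noteq> d"
    and t': "[c', d', e', f'] \<in> Q'" "tp c' d' = tp c d" "e' \<noteq> f'"
  obtains e f where "[c, d, e, f] \<in> Q'" "tp e f = tp e' f'"
    "e' = c' \<Longrightarrow> e = c" "e' = d' \<Longrightarrow> e = d" "f' = c' \<Longrightarrow> f = c" "f' = d' \<Longrightarrow> f = d"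
    "e' \<notin> {c', d'} \<Longrightarrow> e \<notin> {a, b, c, d}" "f' \<notin> {c', d'} \<Longrightarrow> f \<notin> {a, b, c, d}"
proof -
  have U': "c' \<in> U" "d' \<in> U" "e' \<in> U" "f' \<in> U" using pp_subset[OF Q' t'(1)] by auto
  have "c' \<noteq> d'" using t'(2) U by (metis insert_subset tp_eq_iff tp_refl)
  have sw: "tp d' c' = tp d c" using t'(2) tp_swap[of d' c'] tp_swap[of d c] by simp
  obtain s where s: "s \<in> neq_tps" using neq_tps_nonempty by blast
  obtain e where e: "e \<in> U" "tp c e = tp c' e'" "tp d e = tp d' e'"
    "e' = c' \<Longrightarrow> e = c" "e' = d' \<Longrightarrow> e = d" "e' \<notin> {c', d'} \<Longrightarrow> e \<notin> {a, b, c, d}"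
  proof -
    consider "e' = c'" | "e' = d'" | "e' \<notin> {c', d'}" by blast
    then show thesis
    proof cases
      case 1
      then show thesis using that[of c] U sw \<open>c' \<noteq> d'\<close> by auto
    next
      case 2
      then show thesis using that[of d] U t'(2) \<open>c' \<noteq> d'\<close> by auto
    next
      case 3
      then have "\<exists>e\<in>U. e \<notin> {a, b, c, d} \<and> tp c e = tp c' e' \<and> tp d e = tp d' e'"
      proof -
        define \<phi> where "\<phi> x = (if x = c then tp c' e' else if x = d then tp d' e' else s)" for x
        have "\<phi> x \<in> neq_tps" for x using 3 U' s by (auto simp: \<phi>_def intro: neq_tps_I)
        then have "\<exists>e\<in>U. e \<notin> set [a, b, c, d] \<and> (\<forall>x\<in>set [a, b, c, d]. tp x e = \<phi> x)"
          using U by (intro extend_by_one) auto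
        moreover have "\<phi> c = tp c' e'" "\<phi> d = tp d' e'" using U(3) by (auto simp: \<phi>_def)
        ultimately show ?thesis by auto
      qed
      then show thesis using that 3 by blast
    qed
  qed
  have ec: "e \<noteq> c" if "e' \<noteq> c'" using that e(2) U' by (metis tp_eq_iff tp_refl)
  have ed: "e \<noteq> d" if "e' \<noteq> d'" using that e(3) U' by (metis tp_eq_iff tp_refl)
  have swe: "tp e' c' = tp e c" "tp e' d' = tp e d"
    using e(2,3) tp_swap[of e' c'] tp_swap[of e c] tp_swap[of e' d'] tp_swap[of e d] by auto
  obtain f where f: "f \<in> U" "tp c f = tp c' f'" "tp d f = tp d' f'" "tp e f = tp e' f'"
    "f' = c' \<Longrightarrow> f = c" "f' = d' \<Longrightarrow> f = d" "f' \<notin> {c', d'} \<Longrightarrow> f \<notin> {a, b, c, d}"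
  proof -
    consider "f' = c'" | "f' = d'" | "f' \<notin> {c', d'}" by blast
    then show thesis
    proof cases
      case 1
      then show thesis using that[of c] U sw swe \<open>c' \<noteq> d'\<close> by auto
    next
      case 2
      then show thesis using that[of d] U t'(2) swe \<open>c' \<noteq> d'\<close> by auto
    next
      case 3
      define \<phi> where "\<phi> x = (if x = c then tp c' f' else if x = d then tp d' f'
        else if x = e then tp e' f' else s)" for x
      have "\<phi> x \<in> neq_tps" for x using 3 U' s t'(3) by (auto simp: \<phi>_def intro: neq_tps_I)
      then have "\<exists>f\<in>U. f \<notin> set [a, b, c, d, e] \<and> (\<forall>x\<in>set [a, b, c, d, e]. tp x f = \<phi> x)"
        using U e(1) by (intro extend_by_one) auto
      moreover have "\<phi> c = tp c' f'" "\<phi> d = tp d' f'" using U(3) by (auto simp: \<phi>_def)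
      ultimately obtain f where f: "f \<in> U" "f \<notin> {a, b, c, d, e}" "tp c f = tp c' f'" "tp d f = tp d' f'"
        "tp e f = \<phi> e" by auto
      have "tp e f = tp e' f'"
      proof (cases "e' \<in> {c', d'}")
        case True
        then show ?thesis using f(3,4) e(4,5) by auto
      next
        case False
        then show ?thesis using f(5) ec ed by (simp add: \<phi>_def)
      qed
      then show thesis using that[of f] f 3 by blast
    qed
  qed
  have "[c, d, e, f] \<in> Q'" using pp_transfer4[OF Q' t'(1), of c d e f] U e(1,2,3) f(1-4) t'(2) by simp
  then show thesis using that e f by blast
qed

text \<open>Free gluing creates no accidental equality, so the overlap of the outer pairs is the one
  that \<open>pattern_comp\<close> computes.\<close>

lemma comp_rel_pattern:
  assumes Q: "pp 4 Q" "pp 4 Q'"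
    and t: "[a, b, c, d] \<in> Q" "pattern p a b c d" "a \<noteq> b" "c \<noteq> d"
    and t': "[c', d', e', f'] \<in> Q'" "pattern p' c' d' e' f'" "tp c' d' = tp c d" "e' \<noteq> f'"
  shows "\<exists>e f. [a, b, e, f] \<in> comp_rel Q Q' \<and> tp e f = tp e' f' \<and> pattern (pattern_comp p p') a b e f"
proof -
  have U: "{a, b, c, d} \<subseteq> U" using pp_subset[OF Q(1) t(1)] by auto
  obtain e f where ef: "[c, d, e, f] \<in> Q'" "tp e f = tp e' f'"
    "e' = c' \<Longrightarrow> e = c" "e' = d' \<Longrightarrow> e = d" "f' = c' \<Longrightarrow> f = c" "f' = d' \<Longrightarrow> f = d"
    "e' \<notin> {c', d'} \<Longrightarrow> e \<notin> {a, b, c, d}" "f' \<notin> {c', d'} \<Longrightarrow> f \<notin> {a, b, c, d}"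
    using glue_tuples[OF Q(2) U t(3,4) t'(1,3,4)] by blast
  have "pattern (pattern_comp p p') a b e f"
  proof (cases p)
    case None
    then show ?thesis using t(2) ef(3-8) t'(2)
      by (cases p') (auto simp: pattern_def pattern_comp_def sel_def split: if_splits)
  next
    case (Some ij)
    obtain i j where "p = Some (i, j)" using Some by (cases ij) auto
    then show ?thesis using t(2,4) ef(3-8) t'(2)
      by (cases p'; cases i; cases j) (auto simp: pattern_def pattern_comp_def sel_def split: if_splits prod.splits)
  qed
  moreover have "[a, b, e, f] \<in> comp_rel Q Q'" using t(1) ef(1) by (auto simp: comp_rel_iff)
  ultimately show ?thesis using ef(2) by blast
qed

text \<open>Squaring \<open>Q\<close> turns the crossing overlap \<open>Some (False, True)\<close>
  into \<open>None\<close> and keeps the other two, and these are overlaps that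
  \<open>no_propagating_relation\<close> accepts.\<close>

lemma no_propagating_relation_pattern:
  assumes ext: "extension_property k l" and Q: "pp 4 Q" and o12: "o1 \<in> C" "o2 \<notin> C"
    and propagates: "\<And>a b c d. [a, b, c, d] \<in> Q \<Longrightarrow> tp a b \<in> C \<Longrightarrow> tp c d \<in> C"
    and loops: "\<And>t. t \<in> {o1, o2} \<Longrightarrow> \<exists>a b c d. [a, b, c, d] \<in> Q \<and> tp a b = t \<and> tp c d = t \<and>
      (a = b \<or> (\<exists>p\<in>{None, Some (True, True), Some (False, True)}. pattern p a b c d))"
  shows False
proof (rule no_propagating_relation[OF ext pp_comp_rel[OF Q Q] o12])
  show "tp c d \<in> C" if "[a, b, c, d] \<in> comp_rel Q Q" "tp a b \<in> C" for a b c d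
    using that propagates unfolding comp_rel_iff by blast
  fix t assume "t \<in> {o1, o2}"
  then obtain a b c d where t: "[a, b, c, d] \<in> Q" "tp a b = t" "tp c d = t"
    "a = b \<or> (\<exists>p\<in>{None, Some (True, True), Some (False, True)}. pattern p a b c d)"
    using loops by blast
  have U: "a \<in> U" "b \<in> U" "c \<in> U" "d \<in> U" using pp_subset[OF Q t(1)] by auto
  show "\<exists>a b c d. [a, b, c, d] \<in> comp_rel Q Q \<and> tp a b = t \<and> tp c d = t \<and>
      (a = b \<or> c \<notin> {a, b} \<and> d \<notin> {a, b} \<or> c = a \<and> d \<noteq> b)"
  proof (cases "a = b")
    case True
    then have cd: "c = d" using t U tp_eq_iff tp_refl by metis
    obtain e where e: "e \<in> U" "tp c e = tp a c" using ex_tp[OF U(3), of "tp a c"] U by (auto simp: tps_def)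
    have "[c, c, e, e] \<in> Q" using pp_transfer4[OF Q t(1), of c c e e] e U True cd by simp
    then have "[a, a, e, e] \<in> comp_rel Q Q" using t(1) True cd unfolding comp_rel_iff by blast
    then show ?thesis using True t by (metis tp_refl)
  next
    case False
    then have "c \<noteq> d" using t U tp_eq_iff tp_refl by metis
    obtain p where p: "p \<in> {None, Some (True, True), Some (False, True)}" "pattern p a b c d"
      using t(4) False by blast
    obtain e f where ef: "[a, b, e, f] \<in> comp_rel Q Q" "tp e f = tp c d" "pattern (pattern_comp p p) a b e f"
      using comp_rel_pattern[OF Q Q t(1) p(2) False \<open>c \<noteq> d\<close> t(1) p(2) _ \<open>c \<noteq> d\<close>] t by auto
    have "e \<notin> {a, b} \<and> f \<notin> {a, b} \<or> e = a \<and> f \<noteq> b"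
      using p(1) ef(3) by (auto simp: pattern_comp_def pattern_def sel_def)
    then show ?thesis using ef t
      by (intro exI[of _ a] exI[of _ b] exI[of _ e] exI[of _ f]) simp
  qed
qed

lemma pp_transport:
  assumes "pp 4 R" "pp 2 (rel N)"
  shows "pp 4 {[x, y, v, p] | x y v p. \<exists>u. [x, y, u, v] \<in> R \<and> [u, p] \<in> rel N}"
proof (rule pp_projection[where \<Phi> = "{([0, 1, 2, 3], R), ([2, 4], rel N)}" and ys = "[0, 1, 3, 4]"])
  show "{[x, y, v, p] | x y v p. \<exists>u. [x, y, u, v] \<in> R \<and> [u, p] \<in> rel N} = {map g [0::nat, 1, 3, 4] | g. range g \<subseteq> U \<and>
      (\<forall>(xs, R)\<in>{([0, 1, 2, 3], R), ([2, 4], rel N)}. map g xs \<in> R)}" (is "?L = ?R")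
  proof (intro equalityI subsetI)
    fix xs assume "xs \<in> ?L"
    then obtain x y u v p where xs: "xs = [x, y, v, p]" "[x, y, u, v] \<in> R" "[u, p] \<in> rel N" by auto
    then have "set [x, y, u, v, p] \<subseteq> U" using pp_subset[OF assms(1) xs(2)] by (simp add: rel_iff)
    then show "xs \<in> ?R" using range_pick[of "[x, y, u, v, p]" U] xs
      by (intro CollectI exI[of _ "pick [x, y, u, v, p]"]) simp
  next
    fix xs assume "xs \<in> ?R"
    then obtain g where "xs = [g (0::nat), g 1, g 3, g 4]" "[g 0, g 1, g 2, g 3] \<in> R" "[g 2, g 4] \<in> rel N"
      by (auto simp del: One_nat_def)
    then show "xs \<in> ?L" by auto
  qed
qed (use assms in \<open>auto simp: eval_nat_numeral\<close>)

text \<open>If type \<open>t\<close> on \<open>(x, y)\<close> forced \<open>u = v\<close>, then moving an edge from \<open>u\<close> to \<open>v\<close> would give a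
  propagating relation from \<open>(x, y)\<close> to \<open>(v, p)\<close>.\<close>

lemma no_forced_equality:
  assumes ext: "extension_property k l" and R: "pp 4 R" and t: "t \<in> neq_tps"
    and mem: "[x, y, u, v] \<in> R" "tp x y = t" and mem': "[x', y', u', v'] \<in> R" "u' \<noteq> v'"
  shows "\<exists>x y u v. [x, y, u, v] \<in> R \<and> tp x y = t \<and> u \<noteq> v"
proof (rule ccontr)
  assume "\<not> ?thesis"
  then have forced: "u = v" if "[x, y, u, v] \<in> R" "tp x y = t" for x y u v using that by blast
  have U: "x \<in> U" "y \<in> U" "u \<in> U" "v \<in> U" "x' \<in> U" "y' \<in> U" "u' \<in> U" "v' \<in> U"
    using pp_subset[OF R mem(1)] pp_subset[OF R mem'(1)] by auto
  have "u = v" using forced mem by blast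
  \<comment> \<open>Below, the last element of a loop is chosen outside a nondegenerate first pair,
    so only \<open>c\<close> can be shared; this leads to exactly three patterns.\<close>
  have pat: "\<exists>p\<in>{None, Some (True, True), Some (False, True)}. pattern p a b c d"
    if "a \<noteq> b" "d \<notin> {a, b}" for a b c d :: 'a
  proof -
    consider "c = a" | "c = b" | "c \<notin> {a, b}" by blast
    then show ?thesis using that by cases (auto simp: pattern_def sel_def)
  qed
  \<comment> \<open>\<open>N\<close> is chosen so that a type outside the propagated set has a loop,
    too. If some tuple of \<open>R\<close> has distinct elements in both pairs, then
    \<open>{t}\<close> is propagated and the type \<open>s\<close> of its first pair loops.
    Otherwise every type in \<open>neq_tps\<close> forces equality, so \<open>neq_tps\<close> is
    propagated and \<open>eq_tp\<close> loops.\<close>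
  define N where "N = (if \<exists>x y u v. [x, y, u, v] \<in> R \<and> x \<noteq> y \<and> u \<noteq> v then {t} else neq_tps)"
  define Q where "Q = {[x, y, v, p] | x y v p. \<exists>u. [x, y, u, v] \<in> R \<and> [u, p] \<in> rel N}"
  have Q_iff: "[a, b, c, d] \<in> Q \<longleftrightarrow> (\<exists>u. [a, b, u, c] \<in> R \<and> [u, d] \<in> rel N)" for a b c d
    by (simp add: Q_def)
  have "t \<in> tps" using t tps_cases by blast
  then have Q: "pp 4 Q" unfolding Q_def N_def using pp_transport[OF R] pp_rel_singleton pp_rel_neq by simp
  have "t \<in> N" using t by (simp add: N_def)
  obtain p where p: "p \<in> U" "p \<notin> {x, y, u}" "tp u p = t"
    using extend_by_one[of "[x, y, u]" "\<lambda>_. t"] U t by auto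
  have xy: "x \<noteq> y" using mem(2) t eq_tp_notin by auto
  have loop: "\<exists>a b c d. [a, b, c, d] \<in> Q \<and> tp a b = t \<and> tp c d = t \<and>
      (a = b \<or> (\<exists>p\<in>{None, Some (True, True), Some (False, True)}. pattern p a b c d))"
  proof (intro exI conjI disjI2)
    show "[x, y, u, p] \<in> Q" unfolding Q_iff rel_iff using mem(1) \<open>u = v\<close> p U \<open>t \<in> N\<close> by auto
    show "\<exists>q\<in>{None, Some (True, True), Some (False, True)}. pattern q x y u p" using pat xy p(2) by blast
  qed (use mem p in auto)
  show False
  proof (cases "\<exists>x y u v. [x, y, u, v] \<in> R \<and> x \<noteq> y \<and> u \<noteq> v")
    case True
    then obtain a b c d where abcd: "[a, b, c, d] \<in> R" "a \<noteq> b" "c \<noteq> d" by blast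
    have Ua: "a \<in> U" "b \<in> U" "c \<in> U" "d \<in> U" using pp_subset[OF R abcd(1)] by auto
    have N: "N = {t}" using True by (simp add: N_def)
    define s where "s = tp a b"
    have s: "s \<in> neq_tps" "s \<noteq> t" using Ua abcd forced neq_tps_I by (auto simp: s_def)
    \<comment> \<open>As \<open>c\<close> and \<open>d\<close> differ, the types of the new point
      over them are independent: the edge from \<open>c\<close> must lie in \<open>N\<close>, the
      edge from \<open>d\<close> must have type \<open>s\<close>.\<close>
    define \<phi> where "\<phi> z = (if z = d then s else t)" for z
    have "\<exists>q\<in>U. q \<notin> set [a, b, c, d] \<and> (\<forall>z\<in>set [a, b, c, d]. tp z q = \<phi> z)"
      by (rule extend_by_one) (use Ua s t in \<open>auto simp: \<phi>_def\<close>)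
    then obtain q where q: "q \<in> U" "q \<notin> {a, b, c, d}" "tp c q = t" "tp d q = s"
      using abcd(3) by (auto simp: \<phi>_def)
    show False
    proof (rule no_propagating_relation_pattern[OF ext Q, of t "{t}" s])
      show "tp c d \<in> {t}" if "[a, b, c, d] \<in> Q" "tp a b \<in> {t}" for a b c d
        using that forced unfolding Q_iff rel_iff N by blast
      have "\<exists>a b c d. [a, b, c, d] \<in> Q \<and> tp a b = s \<and> tp c d = s \<and>
        (a = b \<or> (\<exists>p\<in>{None, Some (True, True), Some (False, True)}. pattern p a b c d))"
      proof (intro exI conjI disjI2)
        show "[a, b, d, q] \<in> Q" unfolding Q_iff rel_iff N using abcd q Ua by auto
        show "\<exists>p\<in>{None, Some (True, True), Some (False, True)}. pattern p a b d q"
          using pat abcd(2) q(2) by blast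
      qed (use s_def q in auto)
      then show "\<exists>a b c d. [a, b, c, d] \<in> Q \<and> tp a b = r \<and> tp c d = r \<and>
        (a = b \<or> (\<exists>p\<in>{None, Some (True, True), Some (False, True)}. pattern p a b c d))"
        if "r \<in> {t, s}" for r using that loop by blast
    qed (use s in auto)
  next
    case False
    then have N: "N = neq_tps" unfolding N_def by (rule if_not_P)
    have "x' = y'" using False mem' by blast
    show False
    proof (rule no_propagating_relation_pattern[OF ext Q, of t neq_tps eq_tp])
      fix a b c d assume a: "[a, b, c, d] \<in> Q" "tp a b \<in> neq_tps"
      then have "a \<noteq> b" using eq_tp_notin by auto
      then show "tp c d \<in> neq_tps" using a(1) False unfolding Q_iff rel_iff N by blast
    next
      have "[u', v'] \<in> rel neq_tps" using U mem'(2) neq_tps_I by (simp add: rel_iff)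
      \<comment> \<open>The edge from \<open>u'\<close> leads to \<open>v'\<close> itself, which
        makes the target pair degenerate.\<close>
      then have "[x', x', v', v'] \<in> Q" unfolding Q_iff N using mem'(1) \<open>x' = y'\<close> by auto
      then have "\<exists>a b c d. [a, b, c, d] \<in> Q \<and> tp a b = eq_tp \<and> tp c d = eq_tp \<and>
        (a = b \<or> (\<exists>p\<in>{None, Some (True, True), Some (False, True)}. pattern p a b c d))"
        by (metis tp_refl)
      then show "\<exists>a b c d. [a, b, c, d] \<in> Q \<and> tp a b = r \<and> tp c d = r \<and>
        (a = b \<or> (\<exists>p\<in>{None, Some (True, True), Some (False, True)}. pattern p a b c d))"
        if "r \<in> {t, eq_tp}" for r using that loop by blast
    qed (use t eq_tp_notin in auto)
  qed
qed

text \<open>An implication from \<open>C\<close> on the first pair to \<open>C'\<close> on the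
  second that is subdirect: every type on either side has a witness, and all these witnesses have
  the same overlap \<open>p\<close>. Equality is excluded from \<open>P\<close> and
  \<open>P'\<close> so that witnesses can be glued.\<close>

definition arc :: "(bool \<times> bool) option \<Rightarrow> 'a list set \<Rightarrow> ('s set \<times> 's set) set \<Rightarrow> ('s set \<times> 's set) set \<Rightarrow>
    ('s set \<times> 's set) set \<Rightarrow> ('s set \<times> 's set) set \<Rightarrow> bool" where
  "arc p Q P C P' C' \<longleftrightarrow> pp 4 Q \<and> P \<subseteq> neq_tps \<and> P' \<subseteq> neq_tps \<and>
     (\<forall>a b c d. [a, b, c, d] \<in> Q \<longrightarrow> tp a b \<in> P \<and> tp c d \<in> P' \<and> (tp a b \<in> C \<longrightarrow> tp c d \<in> C')) \<and>
     (\<forall>t\<in>P. \<exists>a b c d. [a, b, c, d] \<in> Q \<and> tp a b = t \<and> pattern p a b c d) \<and>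
     (\<forall>t\<in>P'. \<exists>a b c d. [a, b, c, d] \<in> Q \<and> tp c d = t \<and> pattern p a b c d)"

lemma arcD:
  assumes "arc p Q P C P' C'"
  shows "pp 4 Q" "P \<subseteq> neq_tps" "P' \<subseteq> neq_tps"
    "\<And>a b c d. [a, b, c, d] \<in> Q \<Longrightarrow> tp a b \<in> P"
    "\<And>a b c d. [a, b, c, d] \<in> Q \<Longrightarrow> tp c d \<in> P'"
    "\<And>a b c d. [a, b, c, d] \<in> Q \<Longrightarrow> tp a b \<in> C \<Longrightarrow> tp c d \<in> C'"
    "\<And>t. t \<in> P \<Longrightarrow> \<exists>a b c d. [a, b, c, d] \<in> Q \<and> tp a b = t \<and> pattern p a b c d"
    "\<And>t. t \<in> P' \<Longrightarrow> \<exists>a b c d. [a, b, c, d] \<in> Q \<and> tp c d = t \<and> pattern p a b c d"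
  using assms unfolding arc_def by blast+

lemma tp_neqD: "tp a b \<in> neq_tps \<Longrightarrow> a \<noteq> b"
  using eq_tp_notin by auto

lemma arc_comp:
  assumes Q: "arc p Q P C P' C'" and Q': "arc p' Q' P' C' P'' C''"
  shows "arc (pattern_comp p p') (comp_rel Q Q') P C P'' C''"
proof -
  note D = arcD[OF Q] and D' = arcD[OF Q']
  have glue: "\<exists>e f. [a, b, e, f] \<in> comp_rel Q Q' \<and> tp e f = tp e' f' \<and> pattern (pattern_comp p p') a b e f"
    if "[a, b, c, d] \<in> Q" "pattern p a b c d" "[c', d', e', f'] \<in> Q'" "pattern p' c' d' e' f'" "tp c' d' = tp c d"
    for a b c d c' d' e' f'
  proof (rule comp_rel_pattern[OF D(1) D'(1) that(1,2) _ _ that(3,4,5)])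
    show "a \<noteq> b" using D(4)[OF that(1)] D(2) tp_neqD by blast
    show "c \<noteq> d" using D(5)[OF that(1)] D(3) tp_neqD by blast
    show "e' \<noteq> f'" using D'(5)[OF that(3)] D'(3) tp_neqD by blast
  qed
  have "\<exists>a b c d. [a, b, c, d] \<in> comp_rel Q Q' \<and> tp a b = t \<and> pattern (pattern_comp p p') a b c d"
    if tP: "t \<in> P" for t
  proof -
    obtain a b c d where 1: "[a, b, c, d] \<in> Q" "tp a b = t" "pattern p a b c d"
      using D(7)[OF tP] by blast
    obtain c' d' e' f' where 2: "[c', d', e', f'] \<in> Q'" "tp c' d' = tp c d" "pattern p' c' d' e' f'"
      using D'(7)[OF D(5)[OF 1(1)]] by blast
    show ?thesis using glue[OF 1(1,3) 2(1,3,2)] 1(2) by blast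
  qed
  moreover have "\<exists>a b c d. [a, b, c, d] \<in> comp_rel Q Q' \<and> tp c d = t \<and> pattern (pattern_comp p p') a b c d"
    if tP: "t \<in> P''" for t
  proof -
    obtain c' d' e' f' where 2: "[c', d', e', f'] \<in> Q'" "tp e' f' = t" "pattern p' c' d' e' f'"
      using D'(8)[OF tP] by blast
    obtain a b c d where 1: "[a, b, c, d] \<in> Q" "tp c d = tp c' d'" "pattern p a b c d"
      using D(8)[OF D'(4)[OF 2(1)]] by blast
    show ?thesis using glue[OF 1(1,3) 2(1,3) 1(2)[symmetric]] 2(2) by blast
  qed
  moreover have "tp a b \<in> P \<and> tp e f \<in> P'' \<and> (tp a b \<in> C \<longrightarrow> tp e f \<in> C'')"
    if "[a, b, e, f] \<in> comp_rel Q Q'" for a b e f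
    using that D(4,6) D'(5,6) unfolding comp_rel_iff by blast
  ultimately show ?thesis
    unfolding arc_def using pp_comp_rel[OF D(1) D'(1)] D(2) D'(3) by blast
qed

section \<open>Cycles of implications\<close>

lemma trans_total_loop:
  assumes "finite X" "X \<noteq> {}" "trans E" "\<And>x. x \<in> X \<Longrightarrow> \<exists>y\<in>X. (x, y) \<in> E"
  obtains x where "x \<in> X" "(x, x) \<in> E"
proof -
  define E' where "E' = E \<inter> X \<times> X"
  have tr: "trans E'" using assms(3) unfolding E'_def trans_def by blast
  have "\<exists>x. (x, x) \<in> E'"
  proof (rule ccontr)
    assume "\<nexists>x. (x, x) \<in> E'"
    then have "acyclic E'" using trancl_id[OF tr] by (auto simp: acyclic_def)
    moreover have "finite E'" using assms(1) by (simp add: E'_def)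
    ultimately have "wf (E'\<inverse>)" by (rule finite_acyclic_wf_converse[rotated])
    then obtain z where z: "z \<in> X" "\<forall>y. (y, z) \<in> E'\<inverse> \<longrightarrow> y \<notin> X"
      using assms(2) unfolding wf_eq_minimal by (metis ex_in_conv)
    obtain y where "y \<in> X" "(z, y) \<in> E" using assms(4)[OF z(1)] by blast
    then have "(y, z) \<in> E'\<inverse>" using z(1) by (simp add: E'_def)
    then show False using z(2) \<open>y \<in> X\<close> by blast
  qed
  then obtain x where "(x, x) \<in> E'" by blast
  then show thesis using that[of x] unfolding E'_def by blast
qed

text \<open>A type in \<open>C\<close> leads only into \<open>C\<close>; by contraposition a type in
  \<open>P - C\<close> is reached only from \<open>P - C\<close>. Finiteness of \<open>P\<close>
  therefore gives a loop on each side. To have both in a single relation, the second loop is sought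
  only among relations that already loop at \<open>o1\<close>, and these are closed under
  composition.\<close>

lemma no_arc_cycle:
  assumes ext: "extension_property k l" and arc: "arc p Q P C P C"
    and C: "C \<noteq> {}" "C \<subset> P"
  shows False
proof -
  define q where "q = pattern_comp p p"
  have qq: "pattern_comp q q = q" unfolding q_def by (rule pattern_comp_square)
  define \<Q> where "\<Q> = {Q. arc q Q P C P C}"
  have "P \<subseteq> tps" using arcD(2)[OF arc] tps_cases by blast
  then have fin: "finite P" using finite_tps finite_subset by blast
  have Q0: "comp_rel Q Q \<in> \<Q>" using arc_comp[OF arc arc] by (simp add: \<Q>_def q_def)
  have comp: "comp_rel R S \<in> \<Q>" if "R \<in> \<Q>" "S \<in> \<Q>" for R S
    using that arc_comp[of q R P C P C q S P C] by (simp add: \<Q>_def qq)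
  define r where "r R = {(t, t'). \<exists>a b c d. [a, b, c, d] \<in> R \<and> tp a b = t \<and> tp c d = t' \<and> pattern q a b c d}" for R
  have r_comp: "(t, t'') \<in> r (comp_rel R S)" if R: "R \<in> \<Q>" and S: "S \<in> \<Q>" and t: "(t, t') \<in> r R" "(t', t'') \<in> r S"
    for R S t t' t''
  proof -
    note DR = arcD[OF R[unfolded \<Q>_def mem_Collect_eq]] and DS = arcD[OF S[unfolded \<Q>_def mem_Collect_eq]]
    obtain a b c d where 1: "[a, b, c, d] \<in> R" "tp a b = t" "tp c d = t'" "pattern q a b c d"
      using t(1) by (auto simp: r_def)
    obtain c' d' e' f' where 2: "[c', d', e', f'] \<in> S" "tp c' d' = t'" "tp e' f' = t''" "pattern q c' d' e' f'"
      using t(2) by (auto simp: r_def)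
    have "a \<noteq> b" "c \<noteq> d" "e' \<noteq> f'"
      using DR(4,5)[OF 1(1)] DR(2) DS(5)[OF 2(1)] tp_neqD by blast+
    then show ?thesis
      using comp_rel_pattern[OF DR(1) DS(1) 1(1,4) _ _ 2(1,4)] 1 2 unfolding qq r_def by auto
  qed
  have fwd: "\<exists>t'\<in>C. (t, t') \<in> r R" if Rt: "R \<in> \<Q>" "t \<in> C" for R t
  proof -
    note D = arcD[OF Rt(1)[unfolded \<Q>_def mem_Collect_eq]]
    obtain a b c d where "[a, b, c, d] \<in> R" "tp a b = t" "pattern q a b c d"
      using D(7)[of t] Rt(2) C(2) by blast
    then show ?thesis using D(6) Rt(2) unfolding r_def by blast
  qed
  have bwd: "\<exists>t'\<in>P - C. (t', t) \<in> r R" if Rt: "R \<in> \<Q>" "t \<in> P - C" for R t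
  proof -
    note D = arcD[OF Rt(1)[unfolded \<Q>_def mem_Collect_eq]]
    obtain a b c d where "[a, b, c, d] \<in> R" "tp c d = t" "pattern q a b c d"
      using D(8)[of t] Rt(2) by blast
    then show ?thesis using D(4,6) Rt(2) unfolding r_def by blast
  qed
  define E where "E = {(t, t'). \<exists>R\<in>\<Q>. (t, t') \<in> r R}"
  have "trans E" using r_comp comp unfolding E_def trans_def by blast
  moreover have "finite C" using fin C(2) finite_subset by blast
  moreover have "\<exists>t'\<in>C. (t, t') \<in> E" if "t \<in> C" for t
    using fwd[OF Q0 that] Q0 unfolding E_def by blast
  ultimately obtain o1 where "o1 \<in> C" "(o1, o1) \<in> E"
    using trans_total_loop[of C E] C(1) by metis
  then obtain R where R: "R \<in> \<Q>" "(o1, o1) \<in> r R" by (auto simp: E_def)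
  \<comment> \<open>The direction is reversed because it is the predecessors that are known to stay
    outside \<open>C\<close>.\<close>
  define E' where "E' = {(t', t). \<exists>S\<in>\<Q>. (t, t') \<in> r S \<and> (o1, o1) \<in> r S}"
  have "trans E'" using r_comp comp unfolding E'_def trans_def by blast
  moreover have "finite (P - C)" "P - C \<noteq> {}" using fin C(2) by auto
  moreover have "\<exists>t'\<in>P - C. (t, t') \<in> E'" if "t \<in> P - C" for t
    using bwd[OF R(1) that] R unfolding E'_def by blast
  ultimately obtain o2 where o2: "o2 \<in> P - C" "(o2, o2) \<in> E'"
    using trans_total_loop[of "P - C" E'] by metis
  then obtain S where S: "S \<in> \<Q>" "(o1, o1) \<in> r S" "(o2, o2) \<in> r S" by (auto simp: E'_def)
  note D = arcD[OF S(1)[unfolded \<Q>_def mem_Collect_eq]]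
  have loop: "\<exists>a b c d. [a, b, c, d] \<in> S \<and> tp a b = t \<and> tp c d = t \<and> pattern q a b c d" if "t \<in> {o1, o2}" for t
    using that S by (auto simp: r_def)
  have "q = None \<or> q = Some (True, True) \<or> q = Some (False, False)"
    unfolding q_def pattern_comp_def by (auto split: option.splits)
  then consider "q = None \<or> q = Some (True, True)" | "q = Some (False, False)" by blast
  then show False
  proof cases
    case 1
    show False
    proof (rule no_propagating_relation_pattern[OF ext D(1) \<open>o1 \<in> C\<close>, of o2])
      show "o2 \<notin> C" using o2 by simp
      show "\<exists>a b c d. [a, b, c, d] \<in> S \<and> tp a b = t \<and> tp c d = t \<and>
        (a = b \<or> (\<exists>p\<in>{None, Some (True, True), Some (False, True)}. pattern p a b c d))"
        if "t \<in> {o1, o2}" for t using loop[OF that] 1 by blast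
    qed (rule D(6))
  next
    case 2
    \<comment> \<open>Reversing both pairs turns an element kept in second position into one kept in
      first position.\<close>
    define S' where "S' = {[b, a, d, c] | a b c d. [a, b, c, d] \<in> S}"
    have S'_iff: "[a, b, c, d] \<in> S' \<longleftrightarrow> [b, a, d, c] \<in> S" for a b c d by (simp add: S'_def)
    have sw: "tp b a \<in> prod.swap ` X \<longleftrightarrow> tp a b \<in> X" for a b X
      using tp_swap[where a = a and b = b] by (metis image_eqI imageE swap_swap)
    have sw1: "tp b a = prod.swap t \<longleftrightarrow> tp a b = t" for a b t
      using tp_swap[where a = a and b = b] by (metis swap_swap)
    show False
    proof (rule no_propagating_relation_pattern[OF ext, of S' "prod.swap o1" "prod.swap ` C" "prod.swap o2"])
      show "pp 4 S'" unfolding S'_def by (rule pp_swap[OF D(1)])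
      show "prod.swap o2 \<notin> prod.swap ` C" using o2 by (auto simp: inj_image_mem_iff)
      show "tp c d \<in> prod.swap ` C" if "[a, b, c, d] \<in> S'" "tp a b \<in> prod.swap ` C" for a b c d
        using that D(6) unfolding S'_iff sw by blast
      fix t assume "t \<in> {prod.swap o1, prod.swap o2}"
      then obtain t' where t': "t' \<in> {o1, o2}" "t = prod.swap t'" by blast
      obtain a b c d where abcd: "[a, b, c, d] \<in> S" "tp a b = t'" "tp c d = t'" "pattern q a b c d"
        using loop[OF t'(1)] by blast
      then have "[b, a, d, c] \<in> S'" "tp b a = t" "tp d c = t" "pattern (Some (True, True)) b a d c"
        using 2 t'(2) by (auto simp: S'_iff sw1 pattern_def sel_def)
      then show "\<exists>a b c d. [a, b, c, d] \<in> S' \<and> tp a b = t \<and> tp c d = t \<and>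
        (a = b \<or> (\<exists>p\<in>{None, Some (True, True), Some (False, True)}. pattern p a b c d))" by blast
    qed (use \<open>o1 \<in> C\<close> in simp)
  qed
qed


section \<open>Minimal instances\<close>

lemma MaxBound_ge: "3 \<le> MaxBound F" "E \<in> F \<Longrightarrow> card (univ E) \<le> MaxBound F"
  using bounded unfolding finitely_bounded_by_def MaxBound_def by auto

lemma pp_rel_types:
  assumes "pp 2 R"
  shows "rel {tp a b | a b. [a, b] \<in> R} = R"
proof (intro equalityI subsetI)
  fix xs assume "xs \<in> rel {tp a b | a b. [a, b] \<in> R}"
  then obtain x y a b where xs: "xs = [x, y]" "x \<in> U" "y \<in> U" "tp x y = tp a b" "[a, b] \<in> R"
    by (auto simp: rel_def)
  have "tp y x = tp b a" using xs(4) tp_swap[of y x] tp_swap[of b a] by simp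
  then show "xs \<in> R"
    using xs by (intro pp_definable_transfer[OF assms xs(5)]) (auto simp: less_2_cases_iff)
next
  fix xs assume xs: "xs \<in> R"
  then have "length xs = 2" "set xs \<subseteq> U" using pp_definable_tuple[OF assms] by auto
  then obtain a b where "xs = [a, b]" "a \<in> U" "b \<in> U"
    by (cases xs; cases "tl xs") auto
  then show "xs \<in> rel {tp a b | a b. [a, b] \<in> R}" using xs by (auto simp: rel_iff)
qed

lemma pp_rel_swap:
  assumes "pp 2 (rel D)"
  shows "pp 2 (rel (prod.swap ` D))"
proof (rule pp_projection[where \<Phi> = "{([0, 1], rel D)}" and ys = "[1, 0]"])
  have sw: "tp b a \<in> prod.swap ` D \<longleftrightarrow> tp a b \<in> D" for a b
    using tp_swap[where a = a and b = b] by (metis image_eqI imageE swap_swap)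
  show "rel (prod.swap ` D) = {map g [1::nat, 0] | g. range g \<subseteq> U \<and>
      (\<forall>(xs, R)\<in>{([0, 1], rel D)}. map g xs \<in> R)}" (is "?L = ?R")
  proof (intro equalityI subsetI)
    fix xs assume "xs \<in> ?L"
    then obtain a b where xs: "xs = [b, a]" "a \<in> U" "b \<in> U" "tp b a \<in> prod.swap ` D" by (auto simp: rel_def)
    then show "xs \<in> ?R" using range_pick[of "[a, b]" U] sw
      by (intro CollectI exI[of _ "pick [a, b]"]) (simp add: rel_iff)
  next
    fix xs assume "xs \<in> ?R"
    then obtain g where "xs = [g (1::nat), g 0]" "[g 0, g 1] \<in> rel D" by (auto simp del: One_nat_def)
    then show "xs \<in> ?L" using sw by (simp add: rel_iff)
  qed
qed (use assms in \<open>auto simp: eval_nat_numeral\<close>)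

end

text \<open>\<open>k\<close> and \<open>l\<close> are the parameters of strict width and are
  independent of the minimality of the instance; \<open>ext\<close> serves only to refute
  propagating relations.\<close>

locale minimal_instance = liberal_expansion A B F
  for A B :: "('s, 'a) rstruct" and F :: "('s, nat) rstruct set" +
  fixes V :: "nat set" and C :: "'a constraint set" and k l :: nat
  assumes ext: "extension_property k l"
    and inst: "csp_instance (relations_upto B (MaxBound F)) V C"
    and min: "minimal 2 (MaxBound F) V C"
    and nontriv: "nontrivial C"
begin

abbreviation scope :: "'a constraint \<Rightarrow> nat set" where
  "scope c \<equiv> set (fst c)"

lemma finite_V: "finite V"
  using inst by (simp add: csp_instance_def)

lemma constraint:
  assumes "c \<in> C"
  shows "distinct (fst c)" "scope c \<subseteq> V" "pp (length (fst c)) (snd c)"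
proof -
  have c: "set (fst c) \<subseteq> V" "distinct (fst c)" "(length (fst c), snd c) \<in> relations_upto B (MaxBound F)"
    using assms inst unfolding csp_instance_def by (auto simp: case_prod_beta)
  show "distinct (fst c)" "scope c \<subseteq> V" by (fact c)+
  show "pp (length (fst c)) (snd c)" by (rule pp_definable_relations_upto[OF wf_B c(3)])
qed

lemma covered:
  assumes "X \<subseteq> V" "card X \<le> MaxBound F"
  obtains c where "c \<in> C" "X \<subseteq> scope c"
proof -
  have "\<exists>c\<in>C. X \<subseteq> scope c" using min assms unfolding minimal_def by simp
  then show thesis using that by (elim bexE)
qed

text \<open>The 3 in the definition of \<open>MaxBound\<close> is used here: three variables in one
  scope are needed to see that forced equality is transitive and respects types.\<close>

lemma covered3:
  assumes "x \<in> V" "y \<in> V" "z \<in> V"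
  obtains c where "c \<in> C" "x \<in> scope c" "y \<in> scope c" "z \<in> scope c"
proof -
  have "card {x, y, z} \<le> length [x, y, z]" using card_length[of "[x, y, z]"] by simp
  then have "card {x, y, z} \<le> MaxBound F" using MaxBound_ge(1) by simp
  then obtain c where "c \<in> C" "{x, y, z} \<subseteq> scope c" using covered[of "{x, y, z}"] assms by auto
  then show thesis using that by auto
qed

definition local_sols :: "'a constraint \<Rightarrow> (nat \<Rightarrow> 'a) set" where
  "local_sols c = {g. range g \<subseteq> U \<and> map g (fst c) \<in> snd c}"

lemma projection_local_sols:
  assumes c: "c \<in> C" and ys: "set ys \<subseteq> scope c"
  shows "snd (projection c ys) = {map g ys | g. g \<in> local_sols c}"
proof (intro equalityI subsetI)
  note D = constraint[OF c]
  fix r assume "r \<in> snd (projection c ys)"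
  then obtain t where t: "t \<in> snd c" "r = map (\<lambda>y. the (map_of (zip (fst c) t) y)) ys"
    by (auto simp: projection_def)
  have len: "length t = length (fst c)" and tU: "set t \<subseteq> U"
    using pp_definable_tuple[OF D(3) t(1)] by auto
  obtain e where e: "e \<in> U" using univ_nonempty by blast
  define g where "g y = (if y \<in> scope c then the (map_of (zip (fst c) t) y) else e)" for y
  have gi: "g (fst c ! i) = t ! i" if "i < length (fst c)" for i
    using that len D(1) by (simp add: g_def map_of_zip_nth)
  then have gt: "map g (fst c) = t" using len by (auto intro: nth_equalityI)
  have "g y \<in> U" for y
  proof (cases "y \<in> scope c")
    case True
    then obtain i where "i < length (fst c)" "y = fst c ! i" by (metis in_set_conv_nth)
    then show ?thesis using gi tU len by auto
  qed (use e in \<open>simp add: g_def\<close>)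
  then have "g \<in> local_sols c" using gt t(1) by (auto simp: local_sols_def)
  moreover have "r = map g ys" using t(2) ys by (auto simp: g_def)
  ultimately show "r \<in> {map g ys | g. g \<in> local_sols c}" by blast
next
  fix r assume "r \<in> {map g ys | g. g \<in> local_sols c}"
  then obtain g where g: "g \<in> local_sols c" "r = map g ys" by blast
  have "map (\<lambda>y. the (map_of (zip (fst c) (map g (fst c))) y)) ys = map g ys"
    using ys by (auto simp: map_of_zip_map)
  then have "r = map (\<lambda>y. the (map_of (zip (fst c) (map g (fst c))) y)) ys" using g(2) by simp
  then show "r \<in> snd (projection c ys)" using g(1) unfolding projection_def local_sols_def by auto
qed

lemma local_sols_nonempty:
  assumes "c \<in> C"
  shows "local_sols c \<noteq> {}"
proof -
  have "snd (projection c []) \<noteq> {}" using nontriv assms by (auto simp: projection_def nontrivial_def)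
  then show ?thesis using projection_local_sols[OF assms, of "[]"] by auto
qed

text \<open>This is why 2 suffices as first parameter of the width: types are data on pairs, and
  constraints agree on pairs.\<close>

lemma local_sols_agree:
  assumes c: "c \<in> C" "d \<in> C" and xy: "x \<in> scope c" "y \<in> scope c" "x \<in> scope d" "y \<in> scope d"
    and g: "g \<in> local_sols c"
  obtains g' where "g' \<in> local_sols d" "g' x = g x" "g' y = g y"
proof -
  \<comment> \<open>\<open>minimal\<close> compares projections along distinct tuples only, hence
    the separate case \<open>x = y\<close>.\<close>
  define ys where "ys = (if x = y then [x] else [x, y])"
  have ys: "distinct ys" "set ys = {x, y}" by (auto simp: ys_def)
  have "card {x, y} \<le> 2" by (simp add: card_insert_if)
  moreover have "{x, y} \<subseteq> V" using constraint(2)[OF c(1)] xy by blast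
  ultimately have "projection c ys = projection d ys"
    using min c xy ys unfolding minimal_def by (metis (no_types, lifting) empty_subsetI insert_subset)
  then have "map g ys \<in> {map g ys | g. g \<in> local_sols d}"
    using projection_local_sols[OF c(1), of ys] projection_local_sols[OF c(2), of ys] xy ys(2) g by auto
  then obtain g' where "g' \<in> local_sols d" "map g ys = map g' ys" by blast
  then show thesis using that[of g'] ys(2) by (metis insertCI map_eq_conv)
qed

section \<open>Families of type sets consistent with the constraints\<close>

definition assigns :: "(nat \<Rightarrow> nat \<Rightarrow> ('s set \<times> 's set) set) \<Rightarrow> 'a constraint \<Rightarrow> (nat \<Rightarrow> 'a) set" where
  "assigns P c = {g \<in> local_sols c. \<forall>x\<in>scope c. \<forall>y\<in>scope c. tp (g x) (g y) \<in> P x y}"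

text \<open>The instance restricted by \<open>P\<close> stays nontrivial and consistent on pairs: as
  every constraint realizes exactly the types in \<open>P x y\<close>, any two constraints still
  agree.\<close>

definition good :: "(nat \<Rightarrow> nat \<Rightarrow> ('s set \<times> 's set) set) \<Rightarrow> bool" where
  "good P \<longleftrightarrow> (\<forall>x\<in>V. \<forall>y\<in>V. pp 2 (rel (P x y))) \<and>
     (\<forall>c\<in>C. assigns P c \<noteq> {} \<and>
        (\<forall>x\<in>scope c. \<forall>y\<in>scope c. (\<lambda>g. tp (g x) (g y)) ` assigns P c = P x y))"

lemma assignsD:
  assumes "g \<in> assigns P c"
  shows "g x \<in> U" "map g (fst c) \<in> snd c"
    "x \<in> scope c \<Longrightarrow> y \<in> scope c \<Longrightarrow> tp (g x) (g y) \<in> P x y"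
  using assms by (auto simp: assigns_def local_sols_def)

lemma good_tp:
  assumes "good P" "c \<in> C" "x \<in> scope c" "y \<in> scope c"
  shows "t \<in> P x y \<longleftrightarrow> (\<exists>g\<in>assigns P c. tp (g x) (g y) = t)"
proof -
  have im: "(\<lambda>g. tp (g x) (g y)) ` assigns P c = P x y" using assms unfolding good_def by blast
  show ?thesis unfolding im[symmetric] by blast
qed

lemma good_assigns: "good P \<Longrightarrow> c \<in> C \<Longrightarrow> \<exists>g. g \<in> assigns P c"
  unfolding good_def by blast

lemma good_pp: "good P \<Longrightarrow> x \<in> V \<Longrightarrow> y \<in> V \<Longrightarrow> pp 2 (rel (P x y))"
  unfolding good_def by blast

lemma good_nonempty:
  assumes "good P" "x \<in> V" "y \<in> V"
  shows "P x y \<noteq> {}" "P x y \<subseteq> tps"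
proof -
  obtain c where c: "c \<in> C" "x \<in> scope c" "y \<in> scope c" using covered3[OF assms(2,3,3)] .
  obtain g where g: "g \<in> assigns P c" using good_assigns[OF assms(1) c(1)] by blast
  then show "P x y \<noteq> {}" using assignsD(3)[OF g c(2,3)] by blast
  show "P x y \<subseteq> tps"
  proof
    fix t assume "t \<in> P x y"
    then obtain g where g: "g \<in> assigns P c" "tp (g x) (g y) = t" using good_tp[OF assms(1) c] by blast
    then show "t \<in> tps" using assignsD(1)[OF g(1)] unfolding tps_def by blast
  qed
qed

lemma good_refl:
  assumes "good P" "x \<in> V"
  shows "P x x = {eq_tp}"
proof -
  obtain c where c: "c \<in> C" "x \<in> scope c" using covered3[OF assms(2,2,2)] .
  obtain g where "g \<in> assigns P c" using good_assigns[OF assms(1) c(1)] by blast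
  then have "t \<in> P x x \<longleftrightarrow> t = eq_tp" for t
    using good_tp[OF assms(1) c c(2), of t] tp_refl by metis
  then show ?thesis by blast
qed

lemma pp_assigns:
  assumes P: "good P" and c: "c \<in> C" and K: "finite K"
    "\<And>u v D. (u, v, D) \<in> K \<Longrightarrow> u \<noteq> v \<and> pp 2 (rel D)" and n: "n = length ys"
  shows "pp n {map g ys | g. g \<in> assigns P c \<and> (\<forall>(u, v, D)\<in>K. tp (g u) (g v) \<in> D)}"
proof (rule pp_projection[where ys = ys])
  note D = constraint[OF c]
  \<comment> \<open>Diagonal pairs are left out because scopes must be distinct; their condition
    holds by \<open>good_refl\<close>.\<close>
  define \<Phi> where "\<Phi> = {c} \<union> (\<lambda>(x, y). ([x, y], rel (P x y))) ` {(x, y) \<in> scope c \<times> scope c. x \<noteq> y}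
    \<union> (\<lambda>(u, v, D). ([u, v], rel D)) ` K"
  have "finite {(x, y) \<in> scope c \<times> scope c. x \<noteq> y}"
    by (rule finite_subset[of _ "scope c \<times> scope c"]) auto
  then show "finite \<Phi>" unfolding \<Phi>_def using K(1) by blast
  show "distinct xs \<and> pp (length xs) R" if "(xs, R) \<in> \<Phi>" for xs R
  proof -
    have "(xs, R) = c \<or> (\<exists>x y. x \<in> scope c \<and> y \<in> scope c \<and> x \<noteq> y \<and> xs = [x, y] \<and> R = rel (P x y)) \<or>
        (\<exists>u v E. (u, v, E) \<in> K \<and> xs = [u, v] \<and> R = rel E)"
      using that unfolding \<Phi>_def by (auto split: prod.splits)
    then consider "(xs, R) = c"
      | x y where "x \<in> scope c" "y \<in> scope c" "x \<noteq> y" "xs = [x, y]" "R = rel (P x y)"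
      | u v E where "(u, v, E) \<in> K" "xs = [u, v]" "R = rel E"
      by (elim disjE exE conjE)
    then show ?thesis
    proof cases
      case 1
      then show ?thesis using D(1,3) by auto
    next
      case 2
      then show ?thesis using good_pp[OF P subsetD[OF D(2) 2(1)] subsetD[OF D(2) 2(2)]]
        by (simp add: eval_nat_numeral)
    next
      case 3
      then show ?thesis using K(2)[OF 3(1)] by (simp add: eval_nat_numeral)
    qed
  qed
  have "g \<in> assigns P c \<and> (\<forall>(u, v, D)\<in>K. tp (g u) (g v) \<in> D) \<longleftrightarrow>
      range g \<subseteq> U \<and> (\<forall>(xs, R)\<in>\<Phi>. map g xs \<in> R)" for g
  proof (cases "range g \<subseteq> U")
    case True
    then have gU: "g x \<in> U" for x by auto
    have diag: "tp (g x) (g x) \<in> P x x" if "x \<in> scope c" for x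
      using good_refl[OF P] D(2) that by auto
    have "(\<forall>(xs, R)\<in>\<Phi>. map g xs \<in> R) \<longleftrightarrow> map g (fst c) \<in> snd c \<and>
        (\<forall>x\<in>scope c. \<forall>y\<in>scope c. x \<noteq> y \<longrightarrow> tp (g x) (g y) \<in> P x y) \<and>
        (\<forall>(u, v, D)\<in>K. tp (g u) (g v) \<in> D)"
      unfolding \<Phi>_def ball_Un by (auto simp: rel_iff gU split: prod.splits)
    moreover have "(\<forall>x\<in>scope c. \<forall>y\<in>scope c. x \<noteq> y \<longrightarrow> tp (g x) (g y) \<in> P x y) \<longleftrightarrow>
        (\<forall>x\<in>scope c. \<forall>y\<in>scope c. tp (g x) (g y) \<in> P x y)"
    proof (intro iffI ballI impI)
      fix x y assume a: "\<forall>x\<in>scope c. \<forall>y\<in>scope c. x \<noteq> y \<longrightarrow> tp (g x) (g y) \<in> P x y"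
        and xy: "x \<in> scope c" "y \<in> scope c"
      show "tp (g x) (g y) \<in> P x y"
      proof (cases "x = y")
        case True
        then show ?thesis using diag[OF xy(1)] by simp
      next
        case False
        then show ?thesis using a xy by simp
      qed
    qed simp
    ultimately show ?thesis using True unfolding assigns_def local_sols_def by simp
  qed (auto simp: assigns_def local_sols_def)
  then show "{map g ys | g. g \<in> assigns P c \<and> (\<forall>(u, v, D)\<in>K. tp (g u) (g v) \<in> D)} =
      {map g ys | g. range g \<subseteq> U \<and> (\<forall>(xs, R)\<in>\<Phi>. map g xs \<in> R)}" by (simp only:)
qed (rule n)

definition initial :: "nat \<Rightarrow> nat \<Rightarrow> ('s set \<times> 's set) set" where
  "initial x y = {tp (g x) (g y) | g. \<exists>c\<in>C. x \<in> scope c \<and> y \<in> scope c \<and> g \<in> local_sols c}"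

lemma assigns_initial: "c \<in> C \<Longrightarrow> assigns initial c = local_sols c"
  unfolding assigns_def initial_def by blast

lemma initial_image:
  assumes "c \<in> C" "x \<in> scope c" "y \<in> scope c"
  shows "(\<lambda>g. tp (g x) (g y)) ` local_sols c = initial x y"
proof (intro equalityI subsetI)
  fix t assume "t \<in> initial x y"
  then obtain g d where g: "d \<in> C" "x \<in> scope d" "y \<in> scope d" "g \<in> local_sols d" "t = tp (g x) (g y)"
    unfolding initial_def by blast
  obtain g' where g': "g' \<in> local_sols c" "g' x = g x" "g' y = g y"
    using local_sols_agree[OF g(1) assms(1) g(2,3) assms(2,3) g(4)] .
  show "t \<in> (\<lambda>g. tp (g x) (g y)) ` local_sols c"
    by (rule image_eqI[OF _ g'(1)]) (simp only: g(5) g'(2,3))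
next
  fix t assume "t \<in> (\<lambda>g. tp (g x) (g y)) ` local_sols c"
  then show "t \<in> initial x y" using assms unfolding initial_def by blast
qed

lemma good_initial: "good initial"
  unfolding good_def
proof (intro conjI ballI)
  fix x y assume xy: "x \<in> V" "y \<in> V"
  obtain c where c: "c \<in> C" "x \<in> scope c" "y \<in> scope c" using covered3[OF xy xy(2)] .
  define R where "R = {map g [x, y] | g. g \<in> local_sols c}"
  have R: "pp 2 R"
  proof (rule pp_projection[where \<Phi> = "{c}" and ys = "[x, y]"])
    show "R = {map g [x, y] | g. range g \<subseteq> U \<and> (\<forall>(xs, R)\<in>{c}. map g xs \<in> R)}"
      unfolding R_def local_sols_def by (cases c) auto
    show "distinct xs \<and> pp (length xs) R" if "(xs, R) \<in> {c}" for xs R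
      using constraint[OF c(1)] that by (cases c) auto
  qed auto
  have "initial x y = {tp a b | a b. [a, b] \<in> R}"
    unfolding initial_image[OF c, symmetric] R_def by auto
  then show "pp 2 (rel (initial x y))" using pp_rel_types[OF R] R by simp
next
  fix c assume "c \<in> C"
  then show "assigns initial c \<noteq> {}" using assigns_initial local_sols_nonempty by simp
  fix x y assume "x \<in> scope c" "y \<in> scope c"
  then show "(\<lambda>g. tp (g x) (g y)) ` assigns initial c = initial x y"
    using initial_image \<open>c \<in> C\<close> assigns_initial by simp
qed

section \<open>Separating variables that are not forced to be equal\<close>

definition typed_assigns :: "(nat \<times> nat \<times> ('s set \<times> 's set)) list \<Rightarrow> 'a constraint \<Rightarrow> (nat \<Rightarrow> 'a) set" where
  "typed_assigns K c = {g \<in> assigns initial c. \<forall>(u, v, t)\<in>set K. tp (g u) (g v) = t}"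

lemma typed_assigns_Cons:
  "g \<in> typed_assigns ((u, v, t) # K) c \<longleftrightarrow> g \<in> typed_assigns K c \<and> tp (g u) (g v) = t"
  by (auto simp: typed_assigns_def)

lemma pp_typed_assigns:
  assumes c: "c \<in> C" and K: "\<forall>(u, v, t)\<in>set K. u \<noteq> v \<and> t \<in> neq_tps"
  shows "pp 4 {map g [p, q, r, s] | g. g \<in> typed_assigns K c}"
proof -
  define K' where "K' = (\<lambda>(u, v, t). (u, v, {t})) ` set K"
  have "pp 4 {map g [p, q, r, s] | g. g \<in> assigns initial c \<and> (\<forall>(u, v, D)\<in>K'. tp (g u) (g v) \<in> D)}"
  proof (rule pp_assigns[OF good_initial c])
    fix u v D assume "(u, v, D) \<in> K'"
    then obtain t where t: "(u, v, t) \<in> set K" "D = {t}" unfolding K'_def by auto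
    then have "u \<noteq> v" "t \<in> neq_tps" using K by auto
    then show "u \<noteq> v \<and> pp 2 (rel D)" using pp_rel_singleton[of t] tps_cases[of t] t(2) by simp
  qed (simp_all add: K'_def)
  moreover have "g \<in> typed_assigns K c \<longleftrightarrow>
      g \<in> assigns initial c \<and> (\<forall>(u, v, D)\<in>K'. tp (g u) (g v) \<in> D)" for g
    unfolding typed_assigns_def K'_def by (simp add: case_prod_beta)
  ultimately show ?thesis by (simp only:)
qed

text \<open>Types are pinned one at a time. Under the earlier pins one assignment separates
  \<open>p\<close> and \<open>q\<close> and another one has type \<open>t\<close> on
  \<open>(u, v)\<close>; \<open>no_forced_equality\<close>, applied to the values of
  \<open>(u, v, p, q)\<close>, provides an assignment that does both.\<close>

lemma separate_pair:
  assumes c: "c \<in> C" and pq: "p \<in> scope c" "q \<in> scope c" "initial p q \<noteq> {eq_tp}"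
    and K: "\<forall>(u, v, t)\<in>set K. u \<noteq> v \<and> t \<in> neq_tps" "typed_assigns K c \<noteq> {}"
  shows "\<exists>g\<in>typed_assigns K c. g p \<noteq> g q"
  using K
proof (induction K)
  case Nil
  have "p \<in> V" "q \<in> V" using constraint(2)[OF c] pq(1,2) by blast+
  then obtain t where "t \<in> initial p q" "t \<noteq> eq_tp"
    using good_nonempty(1)[OF good_initial] pq(3) by blast
  then obtain g where g: "g \<in> assigns initial c" "tp (g p) (g q) = t"
    using good_tp[OF good_initial c pq(1,2)] by blast
  then have "g p \<noteq> g q" using \<open>t \<noteq> eq_tp\<close> tp_refl by metis
  moreover have "g \<in> typed_assigns [] c" using g(1) by (simp add: typed_assigns_def)
  ultimately show ?case by blast
next
  case (Cons w K)
  obtain u v t where w: "w = (u, v, t)" by (cases w)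
  define R where "R = {map g [u, v, p, q] | g. g \<in> typed_assigns K c}"
  have R: "pp 4 R" unfolding R_def by (rule pp_typed_assigns[OF c]) (use Cons.prems in simp)
  obtain g where g: "g \<in> typed_assigns K c" "tp (g u) (g v) = t"
    using Cons.prems(2) typed_assigns_Cons unfolding w by blast
  obtain g' where g': "g' \<in> typed_assigns K c" "g' p \<noteq> g' q" using Cons.IH Cons.prems(1) g(1) by auto
  have "[g u, g v, g p, g q] \<in> R" "[g' u, g' v, g' p, g' q] \<in> R" using g g' unfolding R_def by auto
  moreover have "t \<in> neq_tps" using Cons.prems(1) w by simp
  ultimately obtain a b d e where "[a, b, d, e] \<in> R" "tp a b = t" "d \<noteq> e"
    using no_forced_equality[OF ext R _ _ g(2) _ g'(2)] by blast
  then obtain h where "h \<in> typed_assigns K c" "tp (h u) (h v) = t" "h p \<noteq> h q"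
    unfolding R_def by auto
  then show ?case using typed_assigns_Cons unfolding w by blast
qed

text \<open>A pair once separated is pinned to the type just found, so that it stays separated while
  the remaining pairs are treated.\<close>

lemma separate_pairs:
  assumes c: "c \<in> C" and ps: "\<forall>(p, q)\<in>set ps. p \<in> scope c \<and> q \<in> scope c \<and> initial p q \<noteq> {eq_tp}"
    and K: "\<forall>(u, v, t)\<in>set K. u \<noteq> v \<and> t \<in> neq_tps" "typed_assigns K c \<noteq> {}"
  shows "\<exists>g\<in>typed_assigns K c. \<forall>(p, q)\<in>set ps. g p \<noteq> g q"
  using ps K
proof (induction ps arbitrary: K)
  case Nil
  show ?case using Nil.prems(3) by auto
next
  case (Cons w ps)
  obtain p q where w: "w = (p, q)" by (cases w)
  have pq: "p \<in> scope c" "q \<in> scope c" "initial p q \<noteq> {eq_tp}" using Cons.prems(1) unfolding w by simp_all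
  obtain g where g: "g \<in> typed_assigns K c" "g p \<noteq> g q"
    using separate_pair[OF c pq Cons.prems(2,3)] by blast
  define t where "t = tp (g p) (g q)"
  have "g \<in> assigns initial c" using g(1) by (simp add: typed_assigns_def)
  then have gU: "g x \<in> U" for x by (rule assignsD(1))
  have t: "t \<in> neq_tps" using neq_tps_I gU g(2) by (simp add: t_def)
  have "p \<noteq> q" using g(2) by auto
  have "g \<in> typed_assigns ((p, q, t) # K) c" using g(1) typed_assigns_Cons t_def by blast
  then obtain h where h: "h \<in> typed_assigns ((p, q, t) # K) c" "\<forall>(p, q)\<in>set ps. h p \<noteq> h q"
    using Cons.IH[of "(p, q, t) # K"] Cons.prems t \<open>p \<noteq> q\<close> by auto
  then have "h \<in> typed_assigns K c" "tp (h p) (h q) = t" using typed_assigns_Cons by blast+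
  moreover from this have "h p \<noteq> h q" using t tp_neqD by metis
  ultimately show ?case using h(2) w by auto
qed

definition injective :: "nat \<Rightarrow> nat \<Rightarrow> ('s set \<times> 's set) set" where
  "injective x y = (if initial x y = {eq_tp} then {eq_tp} else initial x y \<inter> neq_tps)"

text \<open>Removing equality everywhere at once loses no other type: pin the type \<open>t\<close>
  on \<open>(x, y)\<close> and separate all pairs that can be separated.\<close>

lemma good_injective: "good injective"
  unfolding good_def
proof (intro conjI ballI)
  fix x y assume xy: "x \<in> V" "y \<in> V"
  have "eq_tp \<in> tps" using tps_cases by blast
  then show "pp 2 (rel (injective x y))"
    using pp_rel_singleton pp_Int[OF good_pp[OF good_initial xy] pp_rel_neq] by (simp add: injective_def)
next
  fix c assume c: "c \<in> C"
  have sub: "injective x y \<subseteq> initial x y" for x y by (auto simp: injective_def)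
  have realize: "\<exists>g\<in>assigns injective c. g \<in> typed_assigns K c"
    if K: "\<forall>(u, v, t)\<in>set K. u \<noteq> v \<and> t \<in> neq_tps" "typed_assigns K c \<noteq> {}" for K
  proof -
    have "finite {(p, q) \<in> scope c \<times> scope c. initial p q \<noteq> {eq_tp}}"
      by (rule finite_subset[of _ "scope c \<times> scope c"]) auto
    from finite_list[OF this]
    obtain ps where ps: "set ps = {(p, q) \<in> scope c \<times> scope c. initial p q \<noteq> {eq_tp}}" ..
    have "\<forall>(p, q)\<in>set ps. p \<in> scope c \<and> q \<in> scope c \<and> initial p q \<noteq> {eq_tp}"
      unfolding ps by simp
    then obtain g where g: "g \<in> typed_assigns K c" "\<forall>(p, q)\<in>set ps. g p \<noteq> g q"
      using separate_pairs[OF c _ K, of ps] by blast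
    then have g0: "g \<in> assigns initial c" by (simp add: typed_assigns_def)
    have "tp (g x) (g y) \<in> injective x y" if "x \<in> scope c" "y \<in> scope c" for x y
    proof -
      have "tp (g x) (g y) \<in> initial x y" using assignsD(3)[OF g0 that] .
      moreover have "tp (g x) (g y) \<in> neq_tps" if "initial x y \<noteq> {eq_tp}"
      proof -
        have "(x, y) \<in> set ps" unfolding ps using that \<open>x \<in> scope c\<close> \<open>y \<in> scope c\<close> by simp
        then have "g x \<noteq> g y" using g(2) by blast
        then show ?thesis using assignsD(1)[OF g0] neq_tps_I by blast
      qed
      ultimately show ?thesis unfolding injective_def by (cases "initial x y = {eq_tp}") simp_all
    qed
    then have "g \<in> assigns injective c" using g0 by (simp add: assigns_def)
    then show ?thesis using g(1) by blast
  qed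
  have "typed_assigns [] c \<noteq> {}" using good_assigns[OF good_initial c] by (auto simp: typed_assigns_def)
  then obtain g0 where g0: "g0 \<in> assigns injective c" using realize[of "[]"] by auto
  then show "assigns injective c \<noteq> {}" by blast
  fix x y assume xy: "x \<in> scope c" "y \<in> scope c"
  show "(\<lambda>g. tp (g x) (g y)) ` assigns injective c = injective x y"
  proof (intro equalityI subsetI)
    fix t assume t: "t \<in> injective x y"
    show "t \<in> (\<lambda>g. tp (g x) (g y)) ` assigns injective c"
    proof (cases "initial x y = {eq_tp}")
      case True
      then have "tp (g0 x) (g0 y) = t" using t assignsD(3)[OF g0 xy] by (simp add: injective_def)
      then show ?thesis using g0 by blast
    next
      case False
      then have t': "t \<in> initial x y" "t \<in> neq_tps" using t by (auto simp: injective_def)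
      obtain g where g: "g \<in> assigns initial c" "tp (g x) (g y) = t"
        using good_tp[OF good_initial c xy] t'(1) by blast
      then have "x \<noteq> y" using t'(2) tp_neqD by blast
      moreover have "g \<in> typed_assigns [(x, y, t)] c" using g by (simp add: typed_assigns_def)
      ultimately obtain h where "h \<in> assigns injective c" "h \<in> typed_assigns [(x, y, t)] c"
        using realize[of "[(x, y, t)]"] t'(2) by auto
      then show ?thesis by (auto simp: typed_assigns_def)
    qed
  next
    fix t assume "t \<in> (\<lambda>g. tp (g x) (g y)) ` assigns injective c"
    then show "t \<in> injective x y" using assignsD(3) xy by blast
  qed
qed

section \<open>Forced equalities and states\<close>

abbreviation eqv :: "nat \<Rightarrow> nat \<Rightarrow> bool" where
  "eqv x y \<equiv> injective x y = {eq_tp}"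

definition state :: "(nat \<Rightarrow> nat \<Rightarrow> ('s set \<times> 's set) set) \<Rightarrow> bool" where
  "state P \<longleftrightarrow> good P \<and> (\<forall>x\<in>V. \<forall>y\<in>V. P x y \<subseteq> injective x y)"

lemma injective_neq: "\<not> eqv x y \<Longrightarrow> injective x y \<subseteq> neq_tps"
  unfolding injective_def by (cases "initial x y = {eq_tp}") simp_all

text \<open>Types in \<open>injective\<close> are either all equality or all inequality. So
  coincidences among values depend only on the variables, which makes overlaps uniform.\<close>

lemma state_eq_iff:
  assumes P: "state P" and c: "c \<in> C" "x \<in> scope c" "y \<in> scope c" and g: "g \<in> assigns P c"
  shows "g x = g y \<longleftrightarrow> eqv x y"
proof -
  have "x \<in> V" "y \<in> V" using constraint(2)[OF c(1)] c(2,3) by blast+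
  then have "tp (g x) (g y) \<in> injective x y" using P assignsD(3)[OF g c(2,3)] unfolding state_def by blast
  then have t: "tp (g x) (g y) \<in> injective x y" .
  show ?thesis
  proof (cases "eqv x y")
    case True
    then show ?thesis using t tp_eq_iff[OF assignsD(1)[OF g] assignsD(1)[OF g]] by simp
  next
    case False
    then show ?thesis using t injective_neq[OF False] tp_neqD by blast
  qed
qed

lemma state_good: "state P \<Longrightarrow> good P"
  by (simp add: state_def)

lemma state_injective: "state injective"
  using good_injective by (simp add: state_def)

text \<open>All three claims are read off from a single assignment on a scope that contains the
  three variables.\<close>

lemma eqv_trans:
  assumes "x \<in> V" "y \<in> V" "z \<in> V" "eqv x y"
  shows "eqv y x" "eqv y z \<longleftrightarrow> eqv x z" "eqv z y \<longleftrightarrow> eqv z x"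
proof -
  obtain c where c: "c \<in> C" "x \<in> scope c" "y \<in> scope c" "z \<in> scope c" using covered3[OF assms(1-3)] .
  obtain g where g: "g \<in> assigns injective c" using good_assigns[OF good_injective c(1)] by blast
  note iff = state_eq_iff[OF state_injective c(1) _ _ g]
  have "g x = g y" using iff[OF c(2,3)] assms(4) by blast
  then show "eqv y x" "eqv y z \<longleftrightarrow> eqv x z" "eqv z y \<longleftrightarrow> eqv z x"
    using iff[OF c(3,2)] iff[OF c(3,4)] iff[OF c(2,4)] iff[OF c(4,3)] iff[OF c(4,2)] by auto
qed

lemma state_swap:
  assumes P: "state P" and xy: "x \<in> V" "y \<in> V"
  shows "P y x = prod.swap ` P x y"
proof -
  obtain c where c: "c \<in> C" "x \<in> scope c" "y \<in> scope c" using covered3[OF xy xy(2)] .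
  have "P y x = (\<lambda>g. tp (g y) (g x)) ` assigns P c" "P x y = (\<lambda>g. tp (g x) (g y)) ` assigns P c"
    using state_good[OF P] c unfolding good_def by blast+
  moreover have "tp (g y) (g x) = prod.swap (tp (g x) (g y))" for g :: "nat \<Rightarrow> 'a" by (rule tp_swap)
  ultimately show ?thesis by (simp add: image_image)
qed

lemma state_cong_left:
  assumes P: "state P" and xy: "x \<in> V" "x' \<in> V" "y \<in> V" "eqv x x'"
  shows "P x y = P x' y"
proof -
  obtain c where c: "c \<in> C" "x \<in> scope c" "x' \<in> scope c" "y \<in> scope c" using covered3[OF xy(1-3)] .
  have "P x y = (\<lambda>g. tp (g x) (g y)) ` assigns P c" "P x' y = (\<lambda>g. tp (g x') (g y)) ` assigns P c"
    using state_good[OF P] c unfolding good_def by blast+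
  moreover have "tp (g x) (g y) = tp (g x') (g y)" if "g \<in> assigns P c" for g
    using state_eq_iff[OF P c(1-3) that] xy(4) by simp
  ultimately show ?thesis by (simp cong: image_cong)
qed

lemma state_cong:
  assumes P: "state P" and xy: "x \<in> V" "x' \<in> V" "y \<in> V" "y' \<in> V" "eqv x x'" "eqv y y'"
  shows "P x y = P x' y'"
proof -
  have "P x y = P x' y" by (rule state_cong_left[OF P xy(1-3,5)])
  also have "\<dots> = prod.swap ` P y x'" by (rule state_swap[OF P xy(3,2)])
  also have "P y x' = P y' x'" by (rule state_cong_left[OF P xy(3,4,2,6)])
  also have "prod.swap ` P y' x' = P x' y'" by (rule state_swap[OF P xy(4,2), symmetric])
  finally show ?thesis .
qed

lemma nonsingleton_not_eqv:
  assumes P: "state P" and xy: "x \<in> V" "y \<in> V" and D: "D \<subset> P x y" "D \<noteq> {}"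
  shows "\<not> eqv x y" "P x y \<subseteq> neq_tps"
proof -
  have sub: "P x y \<subseteq> injective x y" using P xy unfolding state_def by blast
  show "\<not> eqv x y"
  proof
    assume "eqv x y"
    then have "P x y \<subseteq> {eq_tp}" using sub by simp
    then show False using D by blast
  qed
  then show "P x y \<subseteq> neq_tps" using injective_neq sub by blast
qed

text \<open>By \<open>state_eq_iff\<close> all assignments have the same overlap, and it is one that
  \<open>pattern\<close> can record: the excluded cases are those in which the two pairs share both
  elements.\<close>

lemma eqv_pattern:
  assumes P: "state P" and c: "c \<in> C" and sc: "x \<in> scope c" "y \<in> scope c" "u \<in> scope c" "v \<in> scope c"
    and ne: "\<not> eqv x y" "\<not> eqv u v" "\<not> (eqv u x \<and> eqv v y)" "\<not> (eqv u y \<and> eqv v x)"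
  obtains p where "\<And>g. g \<in> assigns P c \<Longrightarrow> pattern p (g x) (g y) (g u) (g v)"
proof -
  note iff = state_eq_iff[OF P c]
  have V: "x \<in> V" "y \<in> V" "u \<in> V" "v \<in> V" using constraint(2)[OF c] sc by auto
  have vx: "\<not> eqv v x" if "eqv u x" using that eqv_trans(1,2,3) V ne(2) by metis
  have vy: "\<not> eqv v y" if "eqv u y" using that eqv_trans(1,2,3) V ne(2) by metis
  define p where "p = (if eqv u x then Some (True, True) else if eqv u y then Some (False, True)
    else if eqv v x then Some (True, False) else if eqv v y then Some (False, False) else None)"
  have "pattern p (g x) (g y) (g u) (g v)" if g: "g \<in> assigns P c" for g
    using iff[OF sc(3,1) g] iff[OF sc(3,2) g] iff[OF sc(4,1) g] iff[OF sc(4,2) g] vx vy ne(3,4)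
    unfolding pattern_def p_def sel_def by auto
  then show thesis using that by blast
qed

text \<open>The restriction is copied to every pair forced equal to \<open>(x, y)\<close>, also in
  reverse order; by \<open>state_cong\<close> and \<open>state_swap\<close> a state cannot treat
  these pairs differently.\<close>

definition refine :: "(nat \<Rightarrow> nat \<Rightarrow> ('s set \<times> 's set) set) \<Rightarrow> nat \<Rightarrow> nat \<Rightarrow> ('s set \<times> 's set) set \<Rightarrow>
    nat \<Rightarrow> nat \<Rightarrow> ('s set \<times> 's set) set" where
  "refine P x y D u v = (if eqv u x \<and> eqv v y then D
     else if eqv u y \<and> eqv v x then prod.swap ` D else P u v)"

text \<open>If the restriction costs a constraint some types on a pair \<open>(u, v)\<close> that is
  no copy of \<open>(x, y)\<close>, then the surviving types form a proper nonempty subset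
  \<open>D'\<close>, and the projection of the constraint to the two pairs is an arc;
  \<open>eqv_pattern\<close> makes its overlap uniform.\<close>

lemma refine_or_arc:
  assumes P: "state P" and xy: "x \<in> V" "y \<in> V" and D: "D \<subset> P x y" "D \<noteq> {}" "pp 2 (rel D)"
  shows "state (refine P x y D) \<or> (\<exists>u\<in>V. \<exists>v\<in>V. \<exists>D'. D' \<subset> P u v \<and> D' \<noteq> {} \<and> pp 2 (rel D') \<and>
    (\<exists>p Q. arc p Q (P x y) D (P u v) D'))"
proof (rule disjCI)
  assume no_arc: "\<not> (\<exists>u\<in>V. \<exists>v\<in>V. \<exists>D'. D' \<subset> P u v \<and> D' \<noteq> {} \<and> pp 2 (rel D') \<and>
    (\<exists>p Q. arc p Q (P x y) D (P u v) D'))"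
  note good = state_good[OF P]
  let ?R = "refine P x y D"
  have nxy: "\<not> eqv x y" "P x y \<subseteq> neq_tps" using nonsingleton_not_eqv[OF P xy D(1,2)] by auto
  have swP: "prod.swap ` D \<subseteq> P y x" using state_swap[OF P xy] D(1) by blast
  have sub: "?R u v \<subseteq> P u v" if "u \<in> V" "v \<in> V" for u v
    using state_cong[OF P that(1) xy(1) that(2) xy(2)] state_cong[OF P that(1) xy(2) that(2) xy(1)] D(1) swP
    by (auto simp: refine_def)
  have "assigns ?R c \<noteq> {} \<and> (\<forall>u\<in>scope c. \<forall>v\<in>scope c. (\<lambda>g. tp (g u) (g v)) ` assigns ?R c = ?R u v)"
    if c: "c \<in> C" for c
  proof (cases "\<exists>x'\<in>scope c. \<exists>y'\<in>scope c. eqv x' x \<and> eqv y' y")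
    case False
    then have "?R u v = P u v" if "u \<in> scope c" "v \<in> scope c" for u v
      using that by (auto simp: refine_def)
    then have "assigns ?R c = assigns P c" by (auto simp: assigns_def)
    then show ?thesis using good c \<open>\<And>u v. u \<in> scope c \<Longrightarrow> v \<in> scope c \<Longrightarrow> ?R u v = P u v\<close>
      unfolding good_def by auto
  next
    case True
    \<comment> \<open>The scope of \<open>c\<close> may miss \<open>x\<close> and \<open>y\<close>;
      \<open>x'\<close> and \<open>y'\<close> stand in for them.\<close>
    then obtain x' y' where x': "x' \<in> scope c" "y' \<in> scope c" "eqv x' x" "eqv y' y" by blast
    have sV: "s \<in> V" if "s \<in> scope c" for s using constraint(2)[OF c] that by blast
    note x'V = sV[OF x'(1)] sV[OF x'(2)]
    have Pxy: "P x' y' = P x y" using state_cong[OF P x'V(1) xy(1) x'V(2) xy(2)] x' by blast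
    have cl: "eqv s x \<longleftrightarrow> eqv s x'" "eqv s y \<longleftrightarrow> eqv s y'" if "s \<in> V" for s
      using eqv_trans(3)[OF x'V(1) xy(1) that x'(3)] eqv_trans(3)[OF x'V(2) xy(2) that x'(4)] by auto
    note iff = state_eq_iff[OF P c]
    define G where "G = {g \<in> assigns P c. tp (g x') (g y') \<in> D}"
    have same: "tp (g u) (g v) = tp (g x') (g y')"
      if "g \<in> assigns P c" "u \<in> scope c" "v \<in> scope c" "eqv u x" "eqv v y" for g u v
      using that iff[OF that(2) x'(1) that(1)] iff[OF that(3) x'(2) that(1)] cl sV by auto
    have swapped: "tp (g u) (g v) = prod.swap (tp (g x') (g y'))"
      if "g \<in> assigns P c" "u \<in> scope c" "v \<in> scope c" "eqv u y" "eqv v x" for g u v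
    proof -
      have "g u = g y'" "g v = g x'"
        using that iff[OF that(2) x'(2) that(1)] iff[OF that(3) x'(1) that(1)] cl sV by auto
      then show ?thesis using tp_swap[of "g y'" "g x'"] by simp
    qed
    have aG: "assigns ?R c = G"
    proof (intro equalityI subsetI)
      fix g assume g: "g \<in> assigns ?R c"
      have "g \<in> assigns P c" using g sub sV unfolding assigns_def by blast
      moreover have "tp (g x') (g y') \<in> D" using assignsD(3)[OF g x'(1,2)] x' by (simp add: refine_def)
      ultimately show "g \<in> G" by (simp add: G_def)
    next
      fix g assume "g \<in> G"
      then have g: "g \<in> assigns P c" "tp (g x') (g y') \<in> D" by (auto simp: G_def)
      have "tp (g u) (g v) \<in> ?R u v" if uv: "u \<in> scope c" "v \<in> scope c" for u v
        using same[OF g(1) uv] swapped[OF g(1) uv] assignsD(3)[OF g(1) uv] g(2)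
        unfolding refine_def by auto
      then show "g \<in> assigns ?R c" using g(1) by (simp add: assigns_def)
    qed
    have DG: "(\<lambda>g. tp (g x') (g y')) ` G = D"
    proof (intro equalityI subsetI)
      fix t assume "t \<in> D"
      then obtain g where g: "g \<in> assigns P c" "tp (g x') (g y') = t"
        using good_tp[OF good c x'(1,2)] D(1) Pxy by blast
      show "t \<in> (\<lambda>g. tp (g x') (g y')) ` G"
        by (rule image_eqI[of _ _ g]) (use g \<open>t \<in> D\<close> in \<open>simp_all add: G_def\<close>)
    qed (auto simp: G_def)
    then have G_ne: "G \<noteq> {}" using D(2) by auto
    have "(\<lambda>g. tp (g u) (g v)) ` G = ?R u v" if uv: "u \<in> scope c" "v \<in> scope c" for u v
    proof -
      consider (same) "eqv u x \<and> eqv v y" | (swapped) "eqv u y \<and> eqv v x" "\<not> (eqv u x \<and> eqv v y)"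
        | (other) "\<not> (eqv u x \<and> eqv v y)" "\<not> (eqv u y \<and> eqv v x)" by blast
      then show ?thesis
      proof cases
        case same
        then have "(\<lambda>g. tp (g u) (g v)) ` G = (\<lambda>g. tp (g x') (g y')) ` G"
          using \<open>\<And>g u v. g \<in> assigns P c \<Longrightarrow> u \<in> scope c \<Longrightarrow> v \<in> scope c \<Longrightarrow> eqv u x \<Longrightarrow> eqv v y \<Longrightarrow>
            tp (g u) (g v) = tp (g x') (g y')\<close> uv by (intro image_cong) (auto simp: G_def)
        then show ?thesis using DG same by (simp add: refine_def)
      next
        case swapped
        then have "(\<lambda>g. tp (g u) (g v)) ` G = (\<lambda>g. prod.swap (tp (g x') (g y'))) ` G"
          using \<open>\<And>g u v. g \<in> assigns P c \<Longrightarrow> u \<in> scope c \<Longrightarrow> v \<in> scope c \<Longrightarrow> eqv u y \<Longrightarrow> eqv v x \<Longrightarrow>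
            tp (g u) (g v) = prod.swap (tp (g x') (g y'))\<close> uv by (intro image_cong) (auto simp: G_def)
        also have "\<dots> = prod.swap ` D" unfolding DG[symmetric] by (simp add: image_image)
        finally show ?thesis unfolding refine_def if_not_P[OF swapped(2)] if_P[OF swapped(1)] .
      next
        case other
        then have RP: "?R u v = P u v" by (auto simp: refine_def)
        define D' where "D' = (\<lambda>g. tp (g u) (g v)) ` G"
        have D'_sub: "D' \<subseteq> P u v" using assignsD(3) uv unfolding D'_def G_def by blast
        have D'_ne: "D' \<noteq> {}" using G_ne by (simp add: D'_def)
        show ?thesis
        proof (rule ccontr)
          assume "\<not> ?thesis"
          then have D': "D' \<subset> P u v" using D'_sub RP by (auto simp: D'_def)
          have nuv: "\<not> eqv u v" "P u v \<subseteq> neq_tps"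
            using nonsingleton_not_eqv[OF P sV[OF uv(1)] sV[OF uv(2)] D' D'_ne] by auto
          have nxy': "\<not> eqv x' y'" using nonsingleton_not_eqv(1)[OF P x'V] D(1,2) Pxy by metis
          have "x' \<noteq> y'" using nxy' good_refl[OF good_injective x'V(1)] by auto
          define R where "R = {map g [u, v] | g. g \<in> assigns P c \<and> (\<forall>(u, v, D)\<in>{(x', y', D)}. tp (g u) (g v) \<in> D)}"
          have R: "pp 2 R"
            unfolding R_def by (rule pp_assigns[OF good c]) (use \<open>x' \<noteq> y'\<close> D(3) in auto)
          have "D' = {tp a b | a b. [a, b] \<in> R}" unfolding D'_def G_def R_def by auto
          then have ppD': "pp 2 (rel D')" using pp_rel_types[OF R] R by simp
          define Q where "Q = {map g [x', y', u, v] | g. g \<in> assigns P c \<and> (\<forall>(u, v, D)\<in>{}. tp (g u) (g v) \<in> D)}"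
          have Q: "pp 4 Q" unfolding Q_def by (rule pp_assigns[OF good c]) auto
          have Q_iff: "[a, b, d, e] \<in> Q \<longleftrightarrow> (\<exists>g\<in>assigns P c. a = g x' \<and> b = g y' \<and> d = g u \<and> e = g v)"
            for a b d e unfolding Q_def by auto
          have o: "\<not> (eqv u x' \<and> eqv v y')" "\<not> (eqv u y' \<and> eqv v x')"
            using other cl sV[OF uv(1)] sV[OF uv(2)] by auto
          obtain p where p: "\<And>g. g \<in> assigns P c \<Longrightarrow> pattern p (g x') (g y') (g u) (g v)"
            using eqv_pattern[OF P c x'(1,2) uv nxy' nuv(1) o] by blast
          have "arc p Q (P x y) D (P u v) D'"
            unfolding arc_def
          proof (intro conjI allI impI ballI)
            fix a b d e assume "[a, b, d, e] \<in> Q"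
            then obtain g where g: "g \<in> assigns P c" "a = g x'" "b = g y'" "d = g u" "e = g v"
              unfolding Q_iff by blast
            show "tp a b \<in> P x y" using assignsD(3)[OF g(1) x'(1,2)] g Pxy by simp
            show "tp d e \<in> P u v" using assignsD(3)[OF g(1) uv] g by simp
            show "tp d e \<in> D'" if "tp a b \<in> D" using that g unfolding D'_def G_def by blast
          next
            fix t assume "t \<in> P x y"
            then obtain g where "g \<in> assigns P c" "tp (g x') (g y') = t"
              using good_tp[OF good c x'(1,2)] Pxy by blast
            then show "\<exists>a b d e. [a, b, d, e] \<in> Q \<and> tp a b = t \<and> pattern p a b d e"
              using p unfolding Q_iff by blast
          next
            fix t assume "t \<in> P u v"
            then obtain g where "g \<in> assigns P c" "tp (g u) (g v) = t"
              using good_tp[OF good c uv] by blast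
            then show "\<exists>a b d e. [a, b, d, e] \<in> Q \<and> tp d e = t \<and> pattern p a b d e"
              using p unfolding Q_iff by blast
          qed (use Q nxy(2) nuv(2) in auto)
          then show False using no_arc sV[OF uv(1)] sV[OF uv(2)] D' D'_ne ppD' by blast
        qed
      qed
    qed
    then show ?thesis using aG G_ne by simp
  qed
  moreover have "pp 2 (rel (?R u v))" if "u \<in> V" "v \<in> V" for u v
    using D(3) pp_rel_swap[OF D(3)] good_pp[OF good that] by (simp add: refine_def)
  ultimately have "good ?R" unfolding good_def by blast
  then show "state ?R" using sub P unfolding state_def by blast
qed

text \<open>In a state of least total size no restriction gives a state again, so each restriction
  has an outgoing arc. Arcs compose and restrictions are finite in number, so one of them would have
  an arc to itself, against \<open>no_arc_cycle\<close>. Hence there are no restrictions; but a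
  single type is primitive positive definable and would be one in any larger type set.\<close>

lemma singleton_state:
  obtains P where "state P" "\<And>x y. x \<in> V \<Longrightarrow> y \<in> V \<Longrightarrow> is_singleton (P x y)"
proof -
  define size where "size P = (\<Sum>z\<in>V \<times> V. card (P (fst z) (snd z)))" for P :: "nat \<Rightarrow> nat \<Rightarrow> ('s set \<times> 's set) set"
  obtain P where P: "state P" and least: "\<And>P'. state P' \<Longrightarrow> size P \<le> size P'"
    using state_injective ex_has_least_nat[of state injective size] by blast
  note good = state_good[OF P]
  have fin: "finite (P x y)" if "x \<in> V" "y \<in> V" for x y
    using good_nonempty(2)[OF good that] finite_tps finite_subset by blast
  have no_refine: "\<not> state (refine P x y D)" if xy: "x \<in> V" "y \<in> V" and D: "D \<subset> P x y" "D \<noteq> {}" for x y D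
  proof
    assume "state (refine P x y D)"
    then have "size P \<le> size (refine P x y D)" by (rule least)
    moreover have "size (refine P x y D) < size P"
      unfolding size_def
    proof (rule sum_strict_mono_ex1)
      show "finite (V \<times> V)" using finite_V by simp
      have swP: "prod.swap ` D \<subseteq> P y x" using state_swap[OF P xy] D(1) by blast
      have le: "refine P x y D u v \<subseteq> P u v" if "u \<in> V" "v \<in> V" for u v
        using state_cong[OF P that(1) xy(1) that(2) xy(2)] state_cong[OF P that(1) xy(2) that(2) xy(1)] D(1) swP
        by (auto simp: refine_def)
      show "\<forall>z\<in>V \<times> V. card (refine P x y D (fst z) (snd z)) \<le> card (P (fst z) (snd z))"
      proof
        fix z assume "z \<in> V \<times> V"
        then have "fst z \<in> V" "snd z \<in> V" by auto
        then show "card (refine P x y D (fst z) (snd z)) \<le> card (P (fst z) (snd z))"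
          using fin le by (intro card_mono)
      qed
      have "refine P x y D x y = D" using good_refl[OF good_injective] xy by (simp add: refine_def)
      then have "card (refine P x y D x y) < card (P x y)" using D(1) fin[OF xy] by (simp add: psubset_card_mono)
      then show "\<exists>z\<in>V \<times> V. card (refine P x y D (fst z) (snd z)) < card (P (fst z) (snd z))"
        using xy by (intro bexI[of _ "(x, y)"]) auto
    qed
    ultimately show False by simp
  qed
  define X where "X = {(x, y, D). x \<in> V \<and> y \<in> V \<and> D \<subset> P x y \<and> D \<noteq> {} \<and> pp 2 (rel D)}"
  define E where "E = {(a, b). \<exists>p Q. arc p Q (P (fst a) (fst (snd a))) (snd (snd a))
    (P (fst b) (fst (snd b))) (snd (snd b))}"
  have "X \<subseteq> V \<times> V \<times> Pow tps" using good_nonempty(2)[OF good] unfolding X_def by blast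
  then have "finite X" using finite_V finite_tps by (meson finite_Pow_iff finite_SigmaI finite_subset)
  have "trans E"
  proof (rule transI)
    fix a b d assume "(a, b) \<in> E" "(b, d) \<in> E"
    then show "(a, d) \<in> E" unfolding E_def mem_Collect_eq case_prod_conv by (blast intro: arc_comp)
  qed
  have total: "\<exists>w\<in>X. (z, w) \<in> E" if "z \<in> X" for z
  proof -
    obtain x y D where z: "z = (x, y, D)" by (cases z)
    then have D: "x \<in> V" "y \<in> V" "D \<subset> P x y" "D \<noteq> {}" "pp 2 (rel D)" using that unfolding X_def by simp_all
    then obtain u v D' p Q where "u \<in> V" "v \<in> V" "D' \<subset> P u v" "D' \<noteq> {}" "pp 2 (rel D')"
      "arc p Q (P x y) D (P u v) D'"
      using refine_or_arc[OF P D(1,2,3,4,5)] no_refine[OF D(1,2,3,4)] by blast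
    then show ?thesis unfolding z by (intro bexI[of _ "(u, v, D')"]) (auto simp: X_def E_def)
  qed
  have "X = {}"
  proof (rule ccontr)
    assume "X \<noteq> {}"
    obtain z where "z \<in> X" "(z, z) \<in> E"
      using trans_total_loop[OF \<open>finite X\<close> \<open>X \<noteq> {}\<close> \<open>trans E\<close> total] by blast
    moreover obtain x y D where z: "z = (x, y, D)" by (cases z)
    ultimately obtain p Q where "D \<subset> P x y" "D \<noteq> {}" "arc p Q (P x y) D (P x y) D"
      unfolding X_def E_def by auto
    then show False using no_arc_cycle[OF ext] by blast
  qed
  have "is_singleton (P x y)" if xy: "x \<in> V" "y \<in> V" for x y
  proof -
    obtain t where t: "t \<in> P x y" using good_nonempty(1)[OF good xy] by blast
    then have "t \<in> tps" using good_nonempty(2)[OF good xy] by blast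
    then have "pp 2 (rel {t})" by (rule pp_rel_singleton)
    moreover have "(x, y, {t}) \<notin> X" using \<open>X = {}\<close> by simp
    ultimately have "\<not> {t} \<subset> P x y" using xy unfolding X_def by simp
    then have "P x y = {t}" using t by blast
    then show ?thesis by (simp add: is_singleton_def)
  qed
  then show thesis using that P by blast
qed

text \<open>\<open>embed_labelling\<close> demands types other than equality between distinct
  points, so it is applied to one representative of each class of \<open>eqv\<close>. A constraint
  then holds because some local assignment of it has the same types as \<open>h\<close>.\<close>

lemma ex_solution: "\<exists>h. solution B V C h"
proof -
  obtain P where P: "state P" and sing: "\<And>x y. x \<in> V \<Longrightarrow> y \<in> V \<Longrightarrow> is_singleton (P x y)"
    using singleton_state by blast
  note good = state_good[OF P]
  define \<tau> where "\<tau> x y = the_elem (P x y)" for x y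
  have Pt: "P x y = {\<tau> x y}" if "x \<in> V" "y \<in> V" for x y
    using sing[OF that] by (simp add: \<tau>_def is_singleton_the_elem)
  have assign_tp: "tp (g x) (g y) = \<tau> x y" if "c \<in> C" "g \<in> assigns P c" "x \<in> scope c" "y \<in> scope c" for c g x y
    using assignsD(3)[OF that(2,3,4)] Pt constraint(2)[OF that(1)] that(3,4) by auto
  define rep where "rep x = Min {z \<in> V. eqv x z}" for x
  have rep: "rep x \<in> V" "eqv x (rep x)" if "x \<in> V" for x
  proof -
    have "x \<in> {z \<in> V. eqv x z}" using that good_refl[OF good_injective that] by simp
    then have "rep x \<in> {z \<in> V. eqv x z}" unfolding rep_def using finite_V by (intro Min_in) auto
    then show "rep x \<in> V" "eqv x (rep x)" by auto
  qed
  have rep_eq: "rep x = rep y" if "x \<in> V" "y \<in> V" "eqv x y" for x y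
  proof -
    have "{z \<in> V. eqv x z} = {z \<in> V. eqv y z}" using eqv_trans(2)[OF that(1,2) _ that(3)] by blast
    then show ?thesis by (simp add: rep_def)
  qed
  have rep_neq: "\<not> eqv u v" if uv: "u \<in> rep ` V" "v \<in> rep ` V" "u \<noteq> v" for u v
  proof
    assume e: "eqv u v"
    obtain x y where xy: "x \<in> V" "y \<in> V" "u = rep x" "v = rep y" using uv by blast
    have "rep x = rep u" "rep y = rep v"
      using rep_eq[OF xy(1) rep(1)[OF xy(1)] rep(2)[OF xy(1)]]
        rep_eq[OF xy(2) rep(1)[OF xy(2)] rep(2)[OF xy(2)]] xy by auto
    moreover have "rep u = rep v" using rep_eq[of u v] rep(1) xy e by auto
    ultimately show False using uv(3) xy by simp
  qed
  have repV: "rep ` V \<subseteq> V" using rep(1) by auto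
  have "\<exists>f. realizes f (rep ` V) \<tau>"
  proof (rule embed_labelling)
    show "finite (rep ` V)" using finite_V by simp
    show "\<exists>f. realizes f X \<tau>" if X: "X \<subseteq> rep ` V" "card X \<in> (\<lambda>E. card (univ E)) ` F" for X
    proof -
      \<comment> \<open>The second width parameter enters here: a set of the size of a bound fits
        into one scope, where an assignment realizes \<tau>.\<close>
      have "card X \<le> MaxBound F" using X(2) MaxBound_ge(2) by auto
      moreover have "X \<subseteq> V" using X(1) repV by blast
      ultimately obtain c where c: "c \<in> C" "X \<subseteq> scope c" using covered by blast
      obtain g where g: "g \<in> assigns P c" using good_assigns[OF good c(1)] by blast
      have "realizes g X \<tau>"
        unfolding realizes_def using assign_tp[OF c(1) g] c(2) assignsD(1)[OF g] by blast
      then show ?thesis by blast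
    qed
    show "\<tau> x x = eq_tp" if "x \<in> rep ` V" for x
    proof -
      have "x \<in> V" using that repV by blast
      then show ?thesis using good_refl[OF good] Pt[of x x] by simp
    qed
    show "\<tau> x y \<in> neq_tps" if "x \<in> rep ` V" "y \<in> rep ` V" "x \<noteq> y" for x y
    proof -
      have xy: "x \<in> V" "y \<in> V" using that repV by auto
      have "P x y \<subseteq> injective x y" using P xy unfolding state_def by blast
      then show ?thesis using injective_neq[OF rep_neq[OF that]] Pt[OF xy] by blast
    qed
    show "\<tau> y x = prod.swap (\<tau> x y)" if "x \<in> rep ` V" "y \<in> rep ` V" for x y
    proof -
      have xy: "x \<in> V" "y \<in> V" using that repV by auto
      then show ?thesis using state_swap[OF P xy] Pt[OF xy] Pt[OF xy(2,1)] by simp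
    qed
  qed
  then obtain f where f: "realizes f (rep ` V) \<tau>" ..
  define h where "h x = f (rep x)" for x
  have hU: "h x \<in> U" if "x \<in> V" for x using f that by (auto simp: h_def realizes_def)
  have h_tp: "tp (h x) (h y) = \<tau> x y" if xy: "x \<in> V" "y \<in> V" for x y
  proof -
    have "tp (h x) (h y) = \<tau> (rep x) (rep y)" using f xy by (simp add: h_def realizes_def)
    also have "\<dots> = \<tau> x y"
      using state_cong[OF P xy(1) rep(1)[OF xy(1)] xy(2) rep(1)[OF xy(2)] rep(2)[OF xy(1)] rep(2)[OF xy(2)]]
      by (simp add: \<tau>_def)
    finally show ?thesis .
  qed
  have "map h (fst c) \<in> snd c" if c: "c \<in> C" for c
  proof -
    obtain g where g: "g \<in> assigns P c" using good_assigns[OF good c] by blast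
    note D = constraint[OF c]
    show ?thesis
    proof (rule pp_definable_transfer[OF D(3) assignsD(2)[OF g]])
      show "set (map h (fst c)) \<subseteq> U" using hU D(2) by auto
      fix i j assume ij: "i < length (fst c)" "j < length (fst c)"
      then have s: "fst c ! i \<in> scope c" "fst c ! j \<in> scope c" by auto
      then have "fst c ! i \<in> V" "fst c ! j \<in> V" using D(2) by auto
      then show "tp (map g (fst c) ! i) (map g (fst c) ! j) = tp (map h (fst c) ! i) (map h (fst c) ! j)"
        using assign_tp[OF c g s] h_tp ij by simp
    qed simp
  qed
  then have "solution B V C h" using hU by (auto simp: solution_def satisfies_def)
  then show ?thesis by blast
qed

end

theorem theorem1:
  fixes A B :: "('s, 'a) rstruct"
    and F :: "('s, nat) rstruct set"
  assumes "wf_rstruct A"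
    and "countable (univ A)" and "infinite (univ A)"
    and "homogeneous A"
    and "finitely_bounded_by A F"
    and "binary_core A"
    and "liberal F"
    and "fo_expansion A B"
    and "bounded_strict_width B"
  shows "relational_width B 2 (MaxBound F)"
proof -
  interpret liberal_expansion A B F
    using assms(1,3-8) by unfold_locales
  obtain k l where ext: "extension_property k l"
    using assms(9) bounded_strict_width_iff by blast
  show ?thesis
    unfolding relational_width_def
  proof (intro conjI allI impI iffI)
    show "2 \<le> MaxBound F" using MaxBound_ge(1) by simp
  next
    fix V C assume "\<exists>h. solution B V C h"
    then show "nontrivial C" by (auto simp: solution_def satisfies_def nontrivial_def)
  next
    fix V C
    assume inst: "csp_instance (relations_upto B (MaxBound F)) V C \<and> minimal 2 (MaxBound F) V C"
      and "nontrivial C"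
    then interpret minimal_instance A B F V C k l
      using ext by unfold_locales auto
    show "\<exists>h. solution B V C h" by (rule ex_solution)
  qed
qed

end
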